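(* Let $G$ be a finite nilpotent group. Then $G$ has infinitely many polynomially inequivalent congruence preserving expansions if and only if the lattice of normal subgroups of $G$ splits strongly, i.e., the normal subgroup lattice of $G$ is the union of two proper subintervals that have at least one normal subgroup in common.
   Context: A clone on a set $A$ is a set of finitary operations on $A$ (of arities $n \ge 1$) that contains all projections and is closed under composition. For an algebra $\mathbf{A}$ with universe $A$ (here a group), $\mathrm{Pol}(\mathbf{A})$ is the clone of polynomial functions of $\mathbf{A}$ (the clone generated by the fundamental operations and all constant operations), and $\mathrm{Comp}(\mathbf{A})$ is the clone of all finitary operations on $A$ that preserve every congruence of $\mathbf{A}$. An algebra $\mathbf{A}'$ on the same universe is a congruence preserving expansion of $\mathbf{A}$ if $\mathrm{Pol}(\mathbf{A}) \subseteq \mathrm{Pol}(\mathbf{A}') \subseteq \mathrm{Comp}(\mathbf{A})$. $\mathbf{A}$ has infinitely many polynomially inequivalent congruence preserving expansions if the set of clones $C$ on $A$ with $\mathrm{Pol}(\mathbf{A}) \subseteq C \subseteq \mathrm{Comp}(\mathbf{A})$ is infinite. A bounded lattice $\mathbb{L}$ with bounds $0, 1$ splits strongly if it is the union of two proper subintervals $[0,\delta] \cup [\varepsilon, 1]$ with nonempty intersection; precisely, if there exist $\delta, \varepsilon \in \mathbb{L}$ with $0 < \varepsilon \le \delta < 1$ such that every $\alpha \in \mathbb{L}$ satisfies $\alpha \le \delta$ or $\alpha \ge \varepsilon$. *)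

theory Defs
  imports "HOL-Algebra.Algebra" "HOL-Library.NList"
begin

text \<open>As simplification rules, these two have extra variables in the premise and are very slow.\<close>

declare nlistsE_length [simp del] nlistsE_set [simp del]

section \<open>Finitary operations and clones\<close>

text \<open>
  A finitary operation on \<open>A\<close> is a pair of its arity \<open>n\<close> and a function on the lists of
  length \<open>n\<close> over \<open>A\<close>. The function is extensional, so that equality of pairs is equality
  of operations. There are no nullary operations.
\<close>

type_synonym 'a operation = "nat \<times> ('a list \<Rightarrow> 'a)"

definition operations :: "'a set \<Rightarrow> 'a operation set" where
  "operations A = {(n, f). 1 \<le> n \<and> f \<in> nlists n A \<rightarrow>\<^sub>E A}"

definition proj_op :: "'a set \<Rightarrow> nat \<Rightarrow> nat \<Rightarrow> 'a operation" where
  "proj_op A n i = (n, \<lambda>xs\<in>nlists n A. xs ! i)"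

definition const_op :: "'a set \<Rightarrow> nat \<Rightarrow> 'a \<Rightarrow> 'a operation" where
  "const_op A n a = (n, \<lambda>xs\<in>nlists n A. a)"

definition compose_op :: "'a set \<Rightarrow> nat \<Rightarrow> ('a list \<Rightarrow> 'a) \<Rightarrow> ('a list \<Rightarrow> 'a) list \<Rightarrow> 'a operation" where
  "compose_op A m f gs = (m, \<lambda>xs\<in>nlists m A. f (map (\<lambda>g. g xs) gs))"

definition clone :: "'a set \<Rightarrow> 'a operation set \<Rightarrow> bool" where
  "clone A C \<longleftrightarrow>
     C \<subseteq> operations A \<and>
     (\<forall>n i. i < n \<longrightarrow> proj_op A n i \<in> C) \<and>
     (\<forall>n m f gs. (n, f) \<in> C \<and> length gs = n \<and> (\<forall>g\<in>set gs. (m, g) \<in> C)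
        \<longrightarrow> compose_op A m f gs \<in> C)"


section \<open>Polynomial functions and congruence preserving functions of an algebra\<close>

text \<open>An algebra is given by its universe \<open>A\<close> and the set \<open>F\<close> of its fundamental operations.\<close>

definition Pol :: "'a set \<Rightarrow> 'a operation set \<Rightarrow> 'a operation set" where
  "Pol A F = clone A hull (F \<union> {const_op A n a | n a. 1 \<le> n \<and> a \<in> A})"

definition preserves :: "'a set \<Rightarrow> 'a operation \<Rightarrow> 'a rel \<Rightarrow> bool" where
  "preserves A = (\<lambda>(n, f) \<theta>.
     \<forall>xs\<in>nlists n A. \<forall>ys\<in>nlists n A. (\<forall>i<n. (xs ! i, ys ! i) \<in> \<theta>) \<longrightarrow> (f xs, f ys) \<in> \<theta>)"

definition congruence :: "'a set \<Rightarrow> 'a operation set \<Rightarrow> 'a rel \<Rightarrow> bool" where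
  "congruence A F \<theta> \<longleftrightarrow> equiv A \<theta> \<and> (\<forall>p\<in>F. preserves A p \<theta>)"

definition Comp :: "'a set \<Rightarrow> 'a operation set \<Rightarrow> 'a operation set" where
  "Comp A F = {p \<in> operations A. \<forall>\<theta>. congruence A F \<theta> \<longrightarrow> preserves A p \<theta>}"

text \<open>\<open>F'\<close> is the set of fundamental operations of an expansion on the same universe.\<close>

definition cp_expansion :: "'a set \<Rightarrow> 'a operation set \<Rightarrow> 'a operation set \<Rightarrow> bool" where
  "cp_expansion A F F' \<longleftrightarrow>
     F' \<subseteq> operations A \<and> Pol A F \<subseteq> Pol A F' \<and> Pol A F' \<subseteq> Comp A F"

definition infinitely_many_cp_expansions :: "'a set \<Rightarrow> 'a operation set \<Rightarrow> bool" where
  "infinitely_many_cp_expansions A F \<longleftrightarrow>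
     infinite {C. clone A C \<and> Pol A F \<subseteq> C \<and> C \<subseteq> Comp A F}"

lemma map_apply_nlists:
  assumes "length gs = n" "\<forall>g\<in>set gs. (m, g) \<in> operations A" "xs \<in> nlists m A"
  shows "map (\<lambda>g. g xs) gs \<in> nlists n A"
proof (rule nlistsI)
  show "set (map (\<lambda>g. g xs) gs) \<subseteq> A"
  proof
    fix y assume "y \<in> set (map (\<lambda>g. g xs) gs)"
    then obtain g where g: "g \<in> set gs" "y = g xs" by auto
    then have "g \<in> nlists m A \<rightarrow>\<^sub>E A" using assms(2) by (simp add: operations_def)
    then show "y \<in> A" using PiE_mem[OF _ assms(3)] g(2) by blast
  qed
qed (simp add: assms(1))

lemma cloneI:
  assumes "C \<subseteq> operations A" "\<And>n i. i < n \<Longrightarrow> proj_op A n i \<in> C"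
    "\<And>n m f gs. (n, f) \<in> C \<Longrightarrow> length gs = n \<Longrightarrow> (\<And>g. g \<in> set gs \<Longrightarrow> (m, g) \<in> C)
       \<Longrightarrow> compose_op A m f gs \<in> C"
  shows "clone A C"
  unfolding clone_def
proof (intro conjI allI impI)
  show "compose_op A m f gs \<in> C"
    if "(n, f) \<in> C \<and> length gs = n \<and> (\<forall>g\<in>set gs. (m, g) \<in> C)" for n m f gs
    by (rule assms(3)[of n f gs m]) (use that in simp_all)
qed (rule assms(1), erule assms(2))

lemma clone_subset: "clone A C \<Longrightarrow> C \<subseteq> operations A"
  unfolding clone_def by (rule conjunct1)

lemma clone_proj: "clone A C \<Longrightarrow> i < n \<Longrightarrow> proj_op A n i \<in> C"
  unfolding clone_def by (elim conjE allE) (erule mp)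

lemma clone_compose:
  assumes "clone A C" "(n, f) \<in> C" "length gs = n" "\<And>g. g \<in> set gs \<Longrightarrow> (m, g) \<in> C"
  shows "compose_op A m f gs \<in> C"
proof -
  have "(n, f) \<in> C \<and> length gs = n \<and> (\<forall>g\<in>set gs. (m, g) \<in> C) \<longrightarrow> compose_op A m f gs \<in> C"
    using assms(1)[unfolded clone_def, THEN conjunct2, THEN conjunct2] by (elim allE)
  then show ?thesis by (rule mp) (intro conjI ballI assms(2-4))
qed

lemma operationsI:
  "1 \<le> n \<Longrightarrow> (\<And>xs. xs \<in> nlists n A \<Longrightarrow> f xs \<in> A) \<Longrightarrow> (n, \<lambda>xs\<in>nlists n A. f xs) \<in> operations A"
  by (simp add: operations_def)

lemma clone_operations: "clone A (operations A)"
proof (rule cloneI)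
  fix n i :: nat assume "i < n"
  then show "proj_op A n i \<in> operations A"
    unfolding proj_op_def by (intro operationsI nlistsE_nth_in) simp_all
next
  fix n m f gs
  assume f: "(n, f) \<in> operations A" and len: "length gs = n"
    and gs: "\<And>g. g \<in> set gs \<Longrightarrow> (m, g) \<in> operations A"
  have n: "1 \<le> n" "f \<in> nlists n A \<rightarrow>\<^sub>E A" using f by (simp_all add: operations_def)
  have "hd gs \<in> set gs" using n(1) len by (intro hd_in_set) force
  then have "1 \<le> m" using gs[of "hd gs"] by (simp add: operations_def)
  then show "compose_op A m f gs \<in> operations A"
    unfolding compose_op_def
    using PiE_mem[OF n(2) map_apply_nlists[OF len]] gs by (intro operationsI) blast+
qed (rule subset_refl)

lemma clone_Inter:
  assumes "T \<noteq> {}" "\<And>C. C \<in> T \<Longrightarrow> clone A C"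
  shows "clone A (\<Inter>T)"
proof (rule cloneI)
  obtain C where "C \<in> T" using assms(1) by blast
  then have "\<Inter>T \<subseteq> C" by blast
  then show "\<Inter>T \<subseteq> operations A"
    using clone_subset[OF assms(2)[OF \<open>C \<in> T\<close>]] by (rule order_trans)
next
  fix n i :: nat assume "i < n"
  then show "proj_op A n i \<in> \<Inter>T" by (intro InterI clone_proj assms(2))
next
  fix n m f gs
  assume *: "(n, f) \<in> \<Inter>T" "length gs = n" "\<And>g. g \<in> set gs \<Longrightarrow> (m, g) \<in> \<Inter>T"
  show "compose_op A m f gs \<in> \<Inter>T"
  proof (rule InterI)
    fix C assume C: "C \<in> T"
    show "compose_op A m f gs \<in> C"
      by (rule clone_compose[OF assms(2)[OF C] InterD[OF *(1) C] *(2)]) (rule InterD[OF *(3) C])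
  qed
qed

lemma const_op_in_operations: "1 \<le> n \<Longrightarrow> a \<in> A \<Longrightarrow> const_op A n a \<in> operations A"
  unfolding const_op_def by (rule operationsI)

lemma clone_Pol:
  assumes "F \<subseteq> operations A"
  shows "clone A (Pol A F)"
  unfolding Pol_def hull_def
proof (rule clone_Inter)
  have "{const_op A n a | n a. 1 \<le> n \<and> a \<in> A} \<subseteq> operations A"
  proof
    fix p assume "p \<in> {const_op A n a | n a. 1 \<le> n \<and> a \<in> A}"
    then obtain n a where "p = const_op A n a" "1 \<le> n" "a \<in> A" by (elim CollectE exE conjE)
    then show "p \<in> operations A" by (simp only: const_op_in_operations)
  qed
  with assms have "F \<union> {const_op A n a | n a. 1 \<le> n \<and> a \<in> A} \<subseteq> operations A"
    by (rule Un_least)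
  then have "operations A \<in> {t. clone A t \<and> F \<union> {const_op A n a | n a. 1 \<le> n \<and> a \<in> A} \<subseteq> t}"
    by (intro CollectI conjI clone_operations)
  then show "{t. clone A t \<and> F \<union> {const_op A n a | n a. 1 \<le> n \<and> a \<in> A} \<subseteq> t} \<noteq> {}"
    by (metis empty_iff)
qed (elim CollectE conjE)

text \<open>The clones counted above are exactly the clones of polynomial functions of expansions.\<close>

lemma cp_expansion_clones:
  "{C. clone A C \<and> Pol A F \<subseteq> C \<and> C \<subseteq> Comp A F} = {Pol A F' | F'. cp_expansion A F F'}"
proof (intro equalityI subsetI)
  fix C assume "C \<in> {C. clone A C \<and> Pol A F \<subseteq> C \<and> C \<subseteq> Comp A F}"
  then have C: "clone A C" "Pol A F \<subseteq> C" "C \<subseteq> Comp A F" by auto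
  have "{const_op A n a | n a. 1 \<le> n \<and> a \<in> A} \<subseteq> Pol A F"
    unfolding Pol_def by (rule order_trans[OF _ hull_subset]) blast
  then have "C \<union> {const_op A n a | n a. 1 \<le> n \<and> a \<in> A} = C" using C(2) by blast
  then have "Pol A C = C" unfolding Pol_def using C(1) by (simp add: hull_same)
  moreover from this have "cp_expansion A F C"
    using C clone_subset[OF C(1)] unfolding cp_expansion_def by simp
  ultimately show "C \<in> {Pol A F' | F'. cp_expansion A F F'}" by (intro CollectI exI[of _ C]) simp
next
  fix C assume "C \<in> {Pol A F' | F'. cp_expansion A F F'}"
  then show "C \<in> {C. clone A C \<and> Pol A F \<subseteq> C \<and> C \<subseteq> Comp A F}"
    by (clarsimp simp: cp_expansion_def clone_Pol)
qed


section \<open>Groups\<close>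

text \<open>The neutral element, usually a nullary operation, appears as a unary constant operation.\<close>

definition group_operations :: "('a, 'b) monoid_scheme \<Rightarrow> 'a operation set" where
  "group_operations G =
     {(2, \<lambda>xs\<in>nlists 2 (carrier G). xs ! 0 \<otimes>\<^bsub>G\<^esub> xs ! 1),
      (1, \<lambda>xs\<in>nlists 1 (carrier G). inv\<^bsub>G\<^esub> (xs ! 0)),
      const_op (carrier G) 1 \<one>\<^bsub>G\<^esub>}"

lemma (in group) group_operations_in_operations: "group_operations G \<subseteq> operations (carrier G)"
proof -
  have "(2, \<lambda>xs\<in>nlists 2 (carrier G). xs ! 0 \<otimes> xs ! 1) \<in> operations (carrier G)"
  proof (rule operationsI)
    fix xs assume xs: "xs \<in> nlists 2 (carrier G)"
    have "xs ! 0 \<in> carrier G" by (rule nlistsE_nth_in[OF xs]) simp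
    moreover have "xs ! 1 \<in> carrier G" by (rule nlistsE_nth_in[OF xs]) simp
    ultimately show "xs ! 0 \<otimes> xs ! 1 \<in> carrier G" by (rule m_closed)
  qed simp
  moreover have "(1, \<lambda>xs\<in>nlists 1 (carrier G). inv (xs ! 0)) \<in> operations (carrier G)"
  proof (rule operationsI)
    fix xs assume xs: "xs \<in> nlists 1 (carrier G)"
    have "xs ! 0 \<in> carrier G" by (rule nlistsE_nth_in[OF xs]) simp
    then show "inv (xs ! 0) \<in> carrier G" by (rule inv_closed)
  qed simp
  moreover have "const_op (carrier G) 1 \<one> \<in> operations (carrier G)"
    by (rule const_op_in_operations) simp_all
  ultimately show ?thesis
    unfolding group_operations_def by blast
qed

fun lower_central_series :: "('a, 'b) monoid_scheme \<Rightarrow> nat \<Rightarrow> 'a set" where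
  "lower_central_series G 0 = carrier G"
| "lower_central_series G (Suc n) =
     generate G (\<Union>x\<in>lower_central_series G n. \<Union>y\<in>carrier G.
       {x \<otimes>\<^bsub>G\<^esub> y \<otimes>\<^bsub>G\<^esub> inv\<^bsub>G\<^esub> x \<otimes>\<^bsub>G\<^esub> inv\<^bsub>G\<^esub> y})"

definition nilpotent :: "('a, 'b) monoid_scheme \<Rightarrow> bool" where
  "nilpotent G \<longleftrightarrow> (\<exists>n. lower_central_series G n = {\<one>\<^bsub>G\<^esub>})"

definition normal_subgroup_lattice :: "('a, 'b) monoid_scheme \<Rightarrow> 'a set gorder" where
  "normal_subgroup_lattice G = \<lparr>carrier = {N. N \<lhd> G}, eq = (=), le = (\<subseteq>)\<rparr>"


section \<open>Strong splitting of bounded lattices\<close>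

definition splits_strongly :: "('a, 'b) gorder_scheme \<Rightarrow> bool" where
  "splits_strongly L \<longleftrightarrow>
     (\<exists>\<delta>\<in>carrier L. \<exists>\<epsilon>\<in>carrier L.
        \<bottom>\<^bsub>L\<^esub> \<sqsubset>\<^bsub>L\<^esub> \<epsilon> \<and> \<epsilon> \<sqsubseteq>\<^bsub>L\<^esub> \<delta> \<and> \<delta> \<sqsubset>\<^bsub>L\<^esub> \<top>\<^bsub>L\<^esub> \<and>
        (\<forall>\<alpha>\<in>carrier L. \<alpha> \<sqsubseteq>\<^bsub>L\<^esub> \<delta> \<or> \<epsilon> \<sqsubseteq>\<^bsub>L\<^esub> \<alpha>))"

lemma (in group) normal_subgroup_lattice_bounded:
  "bounded_lattice (normal_subgroup_lattice G)"
  and normal_subgroup_lattice_bottom: "\<bottom>\<^bsub>normal_subgroup_lattice G\<^esub> = {\<one>}"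
  and normal_subgroup_lattice_top: "\<top>\<^bsub>normal_subgroup_lattice G\<^esub> = carrier G"
proof -
  let ?L = "normal_subgroup_lattice G"
  have simps: "carrier ?L = {N. N \<lhd> G}" "(.=\<^bsub>?L\<^esub>) = (=)" "(\<sqsubseteq>\<^bsub>?L\<^esub>) = (\<subseteq>)"
    by (simp_all add: normal_subgroup_lattice_def)
  interpret partial_order ?L
    by unfold_locales (auto simp: simps elem_def)
  have sub: "N \<subseteq> carrier G" "\<one> \<in> N" if "N \<lhd> G" for N
    using normal_imp_subgroup[OF that] by (auto simp: subgroup_def)
  have bot: "least ?L {\<one>} (carrier ?L)"
    using one_is_normal sub by (auto simp: least_def simps)
  have top: "greatest ?L (carrier G) (carrier ?L)"
    using normal_self sub by (auto simp: greatest_def simps)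
  show "bounded_lattice ?L"
  proof unfold_locales
    fix N M assume NM: "N \<in> carrier ?L" "M \<in> carrier ?L"
    let ?J = "\<Inter>{K. K \<lhd> G \<and> N \<subseteq> K \<and> M \<subseteq> K}"
    have "?J \<lhd> G"
    proof (rule normal_invI)
      show "subgroup ?J G"
        by (rule subgroups_Inter) (use normal_self NM sub in \<open>auto simp: simps normal_imp_subgroup\<close>)
      show "x \<otimes> h \<otimes> inv x \<in> ?J" if "x \<in> carrier G" "h \<in> ?J" for x h
        using that by (auto intro: normal.inv_op_closed2)
    qed
    then have "least ?L ?J (Upper ?L {N, M})"
      using NM by (auto simp: least_def Upper_def simps)
    then show "\<exists>s. least ?L s (Upper ?L {N, M})" by blast
    have "greatest ?L (N \<inter> M) (Lower ?L {N, M})"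
      using NM normal_subgroup_intersect by (auto simp: greatest_def Lower_def simps)
    then show "\<exists>s. greatest ?L s (Lower ?L {N, M})" by blast
  qed (use bot top in blast)+
  show "\<bottom>\<^bsub>?L\<^esub> = {\<one>}"
    using bot unfolding bottom_def by (rule some_equality) (meson bot least_unique)
  show "\<top>\<^bsub>?L\<^esub> = carrier G"
    using top unfolding top_def by (rule some_equality) (meson top greatest_unique)
qed

end

theory Submission
  imports Defs "HOL-Number_Theory.Residues"
begin

text \<open>
  Finiteness. If the lattice \<open>L\<close> of normal subgroups has no pair \<open>\<delta> < 1\<close>, \<open>\<mu> > 0\<close> with
  \<open>L = [0, \<delta>] \<union> [\<mu>, 1]\<close>, then for each \<open>\<mu> > 0\<close> the group is the join of the normal subgroups not
  above \<open>\<mu>\<close>. Since higher commutators are distributive over joins, an entry \<open>1\<close> of a nonzero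
  commutator can be replaced such that the commutator gets smaller, but remains nonzero. Hence
  absorbing congruence preserving functions of large arity are trivial, and every clone is
  determined by its functions of small arity. A pair with \<open>\<mu> \<le> \<delta>\<close> is excluded, and a pair with
  \<open>\<not> \<mu> \<le> \<delta>\<close> splits off a direct factor \<open>\<mu>\<close> of prime order \<open>p\<close>, coprime to the order of \<open>\<delta>\<close>, by a
  projection that is a power map. The absorbing functions on this factor either are trivial or
  generate all functions.

  Infinity. For a pair with \<open>\<mu> \<le> \<delta>\<close> one may assume that \<open>\<mu>\<close> contains a central element \<open>u\<close> of prime
  order \<open>p\<close> and that \<open>\<delta>\<close> is the kernel of a homomorphism \<open>\<chi>\<close> to the integers modulo \<open>p\<close>. All functions
  \<open>u [^] (\<chi> x\<^sub>1 * \<dots> * \<chi> x\<^sub>k)\<close> preserve congruences. Polynomial functions of a nilpotent group have bounded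
  degree, so these monomials generate a strictly increasing chain of clones.
\<close>

section \<open>Central torsion elements of nilpotent groups\<close>

context group
begin

text \<open>Operations take values in a group, not in a ring, so their degree has to be read off
  through integer functions. In the infinite case \<open>N\<close> is a normal subgroup maximal
  among those avoiding \<open>u\<close>. Maximality forces the quotient by \<open>N\<close> to be a
  \<open>p\<close>-group, and on it all integer functions modulo \<open>p\<close> vanish after a
  bounded number of differences. One of them returns \<open>i\<close> on \<open>u [^] i\<close>,
  modulo \<open>p\<close>. The clones told apart are not written down by generators but cut out by
  an invariant relation: products of a cube in the group with \<open>u [^] F\<close>, where
  \<open>F\<close> has degree less than \<open>m\<close>. Closure under composition is then
  automatic, and one relation bounds all operations of the clone at once. In the finite case the
  arity bound \<open>card (carrier G) + 2\<close> has two sources: each entry of a higher commutator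
  costs at least one element of the group, and the binary operations, from which multiplication
  modulo \<open>p\<close> is recovered, must be among those compared. Nilpotency supplies central
  elements of order \<open>p\<close>, also modulo a normal subgroup; powers of a central element
  form the normal subgroups on which the splitting is tested.\<close>

lemma inv_mult_cancel: "x \<in> carrier G \<Longrightarrow> y \<in> carrier G \<Longrightarrow> inv x \<otimes> (x \<otimes> y) = y"
  and mult_inv_cancel: "x \<in> carrier G \<Longrightarrow> y \<in> carrier G \<Longrightarrow> x \<otimes> (inv x \<otimes> y) = y"
  by (simp_all flip: m_assoc)

lemma int_pow_commutes:
  assumes "x \<in> carrier G" "y \<in> carrier G" "x \<otimes> y = y \<otimes> x"
  shows "x [^] (i::int) \<otimes> y = y \<otimes> x [^] i"
proof -
  have "x [^] i \<otimes> y = y \<otimes> x [^] i" if "0 \<le> i" for i :: int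
    by (metis group_commutes_pow[OF assms(3,1,2)] pow_nat that)
  moreover have "x [^] i \<otimes> y = y \<otimes> x [^] i" if "i < 0" for i :: int
  proof -
    let ?w = "x [^] nat (- i)"
    have w: "?w \<otimes> y = y \<otimes> ?w" "?w \<in> carrier G"
      using group_commutes_pow[OF assms(3,1,2)] assms(1) by auto
    have "inv ?w \<otimes> (?w \<otimes> y) \<otimes> inv ?w = inv ?w \<otimes> (y \<otimes> ?w) \<otimes> inv ?w" using w by simp
    moreover have "inv ?w \<otimes> (?w \<otimes> y) = y" using w(2) assms(2) by (simp flip: m_assoc)
    moreover have "inv ?w \<otimes> (y \<otimes> ?w) \<otimes> inv ?w = inv ?w \<otimes> y"
      using w(2) assms(2) by (simp add: m_assoc)
    ultimately show ?thesis using that by (simp add: int_pow_def2 del: pow_nat)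
  qed
  ultimately show ?thesis by (meson linorder_not_le)
qed

lemma int_pow_cong:
  assumes "u \<in> carrier G" "u [^] (p::nat) = \<one>" "[i = j] (mod int p)"
  shows "u [^] i = u [^] j"
proof -
  have "int (ord u) dvd int p" using assms(1,2) pow_eq_id by simp
  also have "int p dvd j - i" using assms(3) by (simp add: cong_iff_dvd_diff dvd_diff_commute)
  finally show ?thesis using int_pow_eq[OF assms(1)] by blast
qed

lemma ord_prime:
  assumes "u \<in> carrier G" "u \<noteq> \<one>" "u [^] p = \<one>" "Factorial_Ring.prime p"
  shows "ord u = p"
  using assms by (metis ord_eq_1 pow_eq_id prime_nat_iff)

lemma int_pow_eq_prime:
  assumes "u \<in> carrier G" "u \<noteq> \<one>" "u [^] p = \<one>" "Factorial_Ring.prime p"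
  shows "u [^] i = u [^] (j::int) \<longleftrightarrow> [i = j] (mod int p)"
  using int_pow_eq[OF assms(1)] ord_prime[OF assms]
  by (simp add: cong_iff_dvd_diff dvd_diff_commute)

lemma pow_conj:
  assumes "x \<in> carrier G" "g \<in> carrier G"
  shows "(g \<otimes> x \<otimes> inv g) [^] (n::nat) = g \<otimes> x [^] n \<otimes> inv g"
proof (induction n)
  case (Suc n)
  then show ?case using assms by (simp add: m_assoc inv_mult_cancel)
qed (use assms in simp)

text \<open>If \<open>K i\<close> is the last term with \<open>p\<close>-torsion, and \<open>x\<close> is a torsion element of it, then
  all commutators of \<open>x\<close> lie in \<open>K (Suc i)\<close>. By downward induction \<open>x\<close> commutes with
  the elements of \<open>K (Suc i)\<close>, hence its commutators are themselves \<open>p\<close>-torsion elements.\<close>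

lemma central_chain_torsion:
  assumes sub: "\<And>i. subgroup (K i) G" and mono: "\<And>i. K (Suc i) \<subseteq> K i"
    and comm: "\<And>i x g. x \<in> K i \<Longrightarrow> g \<in> carrier G \<Longrightarrow> x \<otimes> g \<otimes> inv x \<otimes> inv g \<in> K (Suc i)"
    and triv: "K n = {\<one>}"
    and x0: "x0 \<in> K 0" "x0 \<noteq> \<one>" "x0 [^] (p::nat) = \<one>"
  obtains z where "z \<in> K 0" "z \<noteq> \<one>" "z [^] p = \<one>" "\<And>g. g \<in> carrier G \<Longrightarrow> z \<otimes> g = g \<otimes> z"
proof -
  define T where "T i \<longleftrightarrow> (\<exists>x\<in>K i. x \<noteq> \<one> \<and> x [^] p = \<one>)" for i
  have anti: "K j \<subseteq> K i" if "i \<le> j" for i j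
    using that by (rule lift_Suc_antimono_le[of K, OF mono])
  have "T 0" using x0 unfolding T_def by blast
  moreover have "\<forall>i. T i \<longrightarrow> i \<le> n"
  proof (intro allI impI)
    fix i assume "T i"
    then obtain x where "x \<in> K i" "x \<noteq> \<one>" unfolding T_def by blast
    then show "i \<le> n" using anti[of n i] triv by (cases "i \<le> n") auto
  qed
  ultimately obtain i where i: "T i" "\<And>j. T j \<Longrightarrow> j \<le> i"
    using Nat.ex_has_greatest_nat[of T 0 n] by blast
  obtain x where x: "x \<in> K i" "x \<noteq> \<one>" "x [^] p = \<one>" using i(1) unfolding T_def by blast
  have free: "c = \<one>" if "c \<in> K (Suc i)" "c [^] p = \<one>" for c
    using i(2)[of "Suc i"] that unfolding T_def by auto
  have carr: "K j \<subseteq> carrier G" for j using sub subgroup.subset by blast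
  have xc: "x \<in> carrier G" using x carr by blast
  have key: "g \<otimes> x = x \<otimes> g"
    if g: "g \<in> carrier G" and c: "g \<otimes> x \<otimes> inv g \<otimes> inv x \<in> K (Suc i)"
      and cx: "(g \<otimes> x \<otimes> inv g \<otimes> inv x) \<otimes> x = x \<otimes> (g \<otimes> x \<otimes> inv g \<otimes> inv x)" for g
  proof -
    let ?c = "g \<otimes> x \<otimes> inv g \<otimes> inv x"
    have cc: "?c \<in> carrier G" using g xc by simp
    have eq: "?c \<otimes> x = g \<otimes> x \<otimes> inv g" using g xc by (simp add: m_assoc)
    \<comment> \<open>Since \<open>?c\<close> commutes with \<open>x\<close>, its
      \<open>p\<close>-th power equals that of \<open>?c \<otimes> x\<close>, which is a conjugate
      of \<open>x\<close>.\<close>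
    have "?c [^] p = ?c [^] p \<otimes> x [^] p" using x cc by simp
    also have "\<dots> = (?c \<otimes> x) [^] p" using pow_mult_distrib[OF cx cc xc] by simp
    also have "\<dots> = g \<otimes> x [^] p \<otimes> inv g" unfolding eq by (rule pow_conj[OF xc g])
    also have "\<dots> = \<one>" using x g by simp
    finally have "?c = \<one>" using free c by blast
    then have "g \<otimes> x \<otimes> inv g = x" using eq xc by simp
    then show ?thesis using g xc by (metis inv_solve_right m_closed)
  qed
  \<comment> \<open>The induction starts at \<open>n + Suc i\<close> because \<open>n\<close> may
    lie below \<open>Suc i\<close>; the chain is still trivial there.\<close>
  have small: "g \<otimes> x = x \<otimes> g" if "g \<in> K j" "Suc i \<le> j" "j \<le> n + Suc i" for g j
    using that(3,1,2)
  proof (induction j arbitrary: g rule: inc_induct)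
    case base
    then show ?case using anti[of n "n + Suc i"] triv xc by auto
  next
    case (step j)
    have gc: "g \<in> carrier G" using step carr by blast
    have "g \<otimes> x \<otimes> inv g \<otimes> inv x \<in> K (Suc j)" using comm step xc by blast
    moreover from this have "g \<otimes> x \<otimes> inv g \<otimes> inv x \<in> K (Suc i)"
      using anti[of "Suc i" "Suc j"] step by auto
    ultimately show ?case using key[OF gc] step by auto
  qed
  have "g \<otimes> x = x \<otimes> g" if g: "g \<in> carrier G" for g
  proof -
    have "inv (x \<otimes> g \<otimes> inv x \<otimes> inv g) \<in> K (Suc i)"
      using comm[OF x(1) g] sub subgroup.m_inv_closed by metis
    moreover have "inv (x \<otimes> g \<otimes> inv x \<otimes> inv g) = g \<otimes> x \<otimes> inv g \<otimes> inv x"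
      using g xc by (simp add: inv_mult_group m_assoc)
    ultimately have "g \<otimes> x \<otimes> inv g \<otimes> inv x \<in> K (Suc i)" by simp
    then show ?thesis using key[OF g] small[of _ "Suc i"] by auto
  qed
  moreover have "x \<in> K 0" using x anti[of 0 i] by blast
  ultimately show thesis using that[of x] x by metis
qed

lemma lower_central_series_normal: "lower_central_series G n \<lhd> G"
proof (induction n)
  case 0
  then show ?case using normal_self by simp
next
  case (Suc n)
  interpret N: normal "lower_central_series G n" G by (rule Suc)
  show ?case
    unfolding lower_central_series.simps
  proof (rule normal_generateI)
    fix h g
    assume "h \<in> (\<Union>x\<in>lower_central_series G n. \<Union>y\<in>carrier G. {x \<otimes> y \<otimes> inv x \<otimes> inv y})"
      and g: "g \<in> carrier G"
    then obtain x y where xy: "x \<in> lower_central_series G n" "y \<in> carrier G"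
      and h: "h = x \<otimes> y \<otimes> inv x \<otimes> inv y" by blast
    let ?x = "g \<otimes> x \<otimes> inv g" and ?y = "g \<otimes> y \<otimes> inv g"
    have x: "x \<in> carrier G" using xy N.subset by blast
    have "g \<otimes> h \<otimes> inv g = ?x \<otimes> ?y \<otimes> inv ?x \<otimes> inv ?y"
      unfolding h using xy g x by (simp add: m_assoc inv_mult_group inv_mult_cancel)
    then show "g \<otimes> h \<otimes> inv g
      \<in> (\<Union>x\<in>lower_central_series G n. \<Union>y\<in>carrier G. {x \<otimes> y \<otimes> inv x \<otimes> inv y})"
      by (simp only:) (intro UN_I[OF N.inv_op_closed2[OF g xy(1)]] UN_I[of ?y] singletonI; simp add: g xy)
  next
    have "y \<in> carrier G" if "y \<in> lower_central_series G n" for y using that N.subset by blast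
    then show "(\<Union>x\<in>lower_central_series G n. \<Union>y\<in>carrier G. {x \<otimes> y \<otimes> inv x \<otimes> inv y})
      \<subseteq> carrier G"
      by (intro UN_least) (simp only: insert_subset m_closed inv_closed empty_subsetI simp_thms)
  qed
qed

lemma lower_central_series_commutator:
  assumes "x \<in> lower_central_series G n" "g \<in> carrier G"
  shows "x \<otimes> g \<otimes> inv x \<otimes> inv g \<in> lower_central_series G (Suc n)"
  unfolding lower_central_series.simps by (rule generate.incl) (use assms in blast)

lemma lower_central_series_Suc_subset:
  "lower_central_series G (Suc n) \<subseteq> lower_central_series G n"
proof -
  interpret N: normal "lower_central_series G n" G by (rule lower_central_series_normal)
  have "x \<otimes> y \<otimes> inv x \<otimes> inv y \<in> lower_central_series G n"
    if "x \<in> lower_central_series G n" "y \<in> carrier G" for x y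
  proof -
    have x: "x \<in> carrier G" using that N.subset by blast
    have "x \<otimes> (y \<otimes> inv x \<otimes> inv y) \<in> lower_central_series G n"
      using that by (intro N.m_closed N.inv_op_closed2) auto
    then show ?thesis using that x by (simp add: m_assoc)
  qed
  then show ?thesis
    unfolding lower_central_series.simps
    by (intro generate_subgroup_incl N.subgroup_axioms) blast
qed

text \<open>Intersected with \<open>N\<close>, the lower central series remains a central chain that
  ends in the trivial group, so the search for central torsion can be carried out inside
  \<open>N\<close>.\<close>

lemma nilpotent_central_torsion:
  assumes "nilpotent G" "N \<lhd> G" "x \<in> N" "x \<noteq> \<one>" "x [^] (p::nat) = \<one>"
  obtains z where "z \<in> N" "z \<noteq> \<one>" "z [^] p = \<one>" "\<And>g. g \<in> carrier G \<Longrightarrow> z \<otimes> g = g \<otimes> z"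
proof -
  interpret N: normal N G by fact
  obtain n where n: "lower_central_series G n = {\<one>}" using assms(1) unfolding nilpotent_def by blast
  let ?K = "\<lambda>i. lower_central_series G i \<inter> N"
  have 1: "subgroup (?K i) G" for i
    using lower_central_series_normal[of i] assms(2) normal_imp_subgroup normal_subgroup_intersect
    by blast
  have 2: "?K (Suc i) \<subseteq> ?K i" for i using lower_central_series_Suc_subset by blast
  have 3: "y \<otimes> g \<otimes> inv y \<otimes> inv g \<in> ?K (Suc i)" if "y \<in> ?K i" "g \<in> carrier G" for i y g
  proof -
    have y: "y \<in> carrier G" using that N.subset by blast
    have "y \<otimes> (g \<otimes> inv y \<otimes> inv g) \<in> N"
      using that by (intro N.m_closed N.inv_op_closed2) auto
    then have "y \<otimes> g \<otimes> inv y \<otimes> inv g \<in> N" using that y by (simp add: m_assoc)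
    then show ?thesis using lower_central_series_commutator that by blast
  qed
  have "x \<in> ?K 0" using assms(3) N.subset by auto
  moreover have "?K n = {\<one>}" using n N.one_closed by auto
  ultimately obtain z where "z \<in> ?K 0" "z \<noteq> \<one>" "z [^] p = \<one>"
      "\<And>g. g \<in> carrier G \<Longrightarrow> z \<otimes> g = g \<otimes> z"
    using central_chain_torsion[of ?K n x p, OF 1 2 3 _ _ assms(4,5)] by blast
  then show thesis using that[of z] by blast
qed

end

section \<open>Torsion modulo a normal subgroup and central cyclic extensions of it\<close>

context normal
begin

lemma group_hom_Mod: "group_hom G (G Mod H) ((#>) H)"
  using r_coset_hom_Mod factorgroup_is_group is_group
  by (simp add: group_hom_def group_hom_axioms_def)

lemma rcos_eq_iff: "x \<in> carrier G \<Longrightarrow> y \<in> carrier G \<Longrightarrow> H #> x = H #> y \<longleftrightarrow> x \<otimes> inv y \<in> H"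
  by (metis (no_types, lifting) coset_join1 coset_join2 coset_mult_inv1 coset_mult_inv2
      inv_closed m_closed subgroup_axioms subset)

lemma rcos_eq_self_iff: "x \<in> carrier G \<Longrightarrow> H #> x = H \<longleftrightarrow> x \<in> H"
  using coset_join1 coset_join2 subgroup_axioms by blast

text \<open>The images of the lower central series form a central chain in the quotient, and the
  central coset found there is replaced by a representative. Speaking of elements of
  \<open>G\<close> keeps the later arguments free of quotient groups.\<close>

lemma nilpotent_torsion_Mod:
  assumes "nilpotent G" "x \<in> carrier G" "x \<notin> H" "x [^] (p::nat) \<in> H"
  obtains z where "z \<in> carrier G" "z \<notin> H" "z [^] p \<in> H"
    "\<And>g. g \<in> carrier G \<Longrightarrow> z \<otimes> g \<otimes> inv z \<otimes> inv g \<in> H"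
proof -
  let ?Q = "G Mod H"
  interpret h: group_hom G ?Q "(#>) H" by (rule group_hom_Mod)
  obtain n where n: "lower_central_series G n = {\<one>}" using assms(1) unfolding nilpotent_def by blast
  let ?K = "\<lambda>i. (#>) H ` lower_central_series G i"
  have sub: "subgroup (lower_central_series G i) G" for i
    using lower_central_series_normal normal_imp_subgroup by blast
  have 1: "subgroup (?K i) ?Q" for i using h.subgroup_img_is_subgroup[OF sub] .
  have 2: "?K (Suc i) \<subseteq> ?K i" for i using lower_central_series_Suc_subset by blast
  have surj: "\<exists>g\<in>carrier G. q = H #> g" if "q \<in> carrier ?Q" for q
    using that by (auto simp: carrier_FactGroup)
  have 3: "y \<otimes>\<^bsub>?Q\<^esub> g \<otimes>\<^bsub>?Q\<^esub> inv\<^bsub>?Q\<^esub> y \<otimes>\<^bsub>?Q\<^esub> inv\<^bsub>?Q\<^esub> g \<in> ?K (Suc i)"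
    if y: "y \<in> ?K i" and g: "g \<in> carrier ?Q" for i y g
  proof -
    obtain y' where y': "y' \<in> lower_central_series G i" "y = H #> y'" using y by blast
    obtain g' where g': "g' \<in> carrier G" "g = H #> g'" using surj[OF g] by blast
    have y'': "y' \<in> carrier G" using y' sub subgroup.subset by blast
    have "y \<otimes>\<^bsub>?Q\<^esub> g \<otimes>\<^bsub>?Q\<^esub> inv\<^bsub>?Q\<^esub> y \<otimes>\<^bsub>?Q\<^esub> inv\<^bsub>?Q\<^esub> g = H #> (y' \<otimes> g' \<otimes> inv y' \<otimes> inv g')"
      using y'' g' y' by (simp only: h.hom_mult h.hom_inv m_closed inv_closed)
    then show ?thesis using lower_central_series_commutator[OF y'(1) g'(1)] by blast
  qed
  have 4: "?K n = {\<one>\<^bsub>?Q\<^esub>}" using n h.hom_one by (simp del: one_FactGroup)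
  have 5: "H #> x \<in> ?K 0" using assms by simp
  have 6: "H #> x \<noteq> \<one>\<^bsub>?Q\<^esub>" using rcos_eq_self_iff assms by simp
  have 7: "(H #> x) [^]\<^bsub>?Q\<^esub> p = \<one>\<^bsub>?Q\<^esub>"
    using h.hom_nat_pow[OF assms(2), of p] rcos_eq_self_iff[of "x [^] p"] assms by simp
  obtain q where q: "q \<in> ?K 0" "q \<noteq> \<one>\<^bsub>?Q\<^esub>" "q [^]\<^bsub>?Q\<^esub> p = \<one>\<^bsub>?Q\<^esub>"
      "\<And>g. g \<in> carrier ?Q \<Longrightarrow> q \<otimes>\<^bsub>?Q\<^esub> g = g \<otimes>\<^bsub>?Q\<^esub> q"
    using group.central_chain_torsion[OF factorgroup_is_group 1 2 3 4 5 6 7] by metis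
  obtain z where z: "z \<in> carrier G" "q = H #> z" using q(1) by auto
  show thesis
  proof (rule that[OF z(1)])
    show "z \<notin> H" using q(2) z rcos_eq_self_iff by simp
    show "z [^] p \<in> H" using q(3) h.hom_nat_pow[OF z(1), of p] rcos_eq_self_iff[of "z [^] p"] z by simp
    fix g assume g: "g \<in> carrier G"
    have "H #> (z \<otimes> g) = H #> (g \<otimes> z)"
      using q(4)[of "H #> g"] g z h.hom_closed by (simp only: h.hom_mult)
    then have "z \<otimes> g \<otimes> inv (g \<otimes> z) \<in> H" using rcos_eq_iff[of "z \<otimes> g" "g \<otimes> z"] g z by blast
    then show "z \<otimes> g \<otimes> inv z \<otimes> inv g \<in> H" using g z by (simp add: inv_mult_group m_assoc)
  qed
qed

text \<open>The preimage of the central cyclic subgroup of the quotient generated by the coset of \<open>z\<close>.\<close>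

definition adjoin :: "'a \<Rightarrow> 'a set" where
  "adjoin z = {x \<in> carrier G. \<exists>i::int. x \<otimes> inv (z [^] i) \<in> H}"

lemma adjoin_self: "z \<in> carrier G \<Longrightarrow> z \<in> adjoin z"
  unfolding adjoin_def by (auto intro!: exI[of _ 1])

lemma adjoin_superset: "z \<in> carrier G \<Longrightarrow> H \<subseteq> adjoin z"
  unfolding adjoin_def using subset by (auto intro!: exI[of _ 0])

text \<open>Membership in \<open>adjoin z\<close> means that the coset is a power of the coset of
  \<open>z\<close>. These powers form a central subgroup of the quotient, and its preimage is
  normal.\<close>

lemma adjoin_normal:
  assumes z: "z \<in> carrier G" and central: "\<And>g. g \<in> carrier G \<Longrightarrow> z \<otimes> g \<otimes> inv z \<otimes> inv g \<in> H"
  shows "adjoin z \<lhd> G"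
proof -
  let ?Q = "G Mod H"
  interpret h: group_hom G ?Q "(#>) H" by (rule group_hom_Mod)
  let ?q = "H #> z"
  have q: "?q \<in> carrier ?Q" using z h.hom_closed by blast
  have eq: "adjoin z = {x \<in> carrier G. \<exists>i::int. H #> x = ?q [^]\<^bsub>?Q\<^esub> i}"
    unfolding adjoin_def by (simp only: h.hom_int_pow[OF z, symmetric] rcos_eq_iff int_pow_closed[OF z] cong: conj_cong)
  have comm: "?q \<otimes>\<^bsub>?Q\<^esub> (H #> g) = (H #> g) \<otimes>\<^bsub>?Q\<^esub> ?q" if g: "g \<in> carrier G" for g
  proof -
    have "z \<otimes> g \<otimes> inv (g \<otimes> z) \<in> H" using central[OF g] g z by (simp add: inv_mult_group m_assoc)
    then have "H #> (z \<otimes> g) = H #> (g \<otimes> z)"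
      using rcos_eq_iff[of "z \<otimes> g" "g \<otimes> z"] g z by blast
    then show ?thesis using g z by (simp only: h.hom_mult)
  qed
  have comm': "?q [^]\<^bsub>?Q\<^esub> (i::int) \<otimes>\<^bsub>?Q\<^esub> (H #> g) = (H #> g) \<otimes>\<^bsub>?Q\<^esub> ?q [^]\<^bsub>?Q\<^esub> i"
    if g: "g \<in> carrier G" for g i
    using group.int_pow_commutes[OF factorgroup_is_group q] comm[OF g] h.hom_closed[OF g] by blast
  have "subgroup (adjoin z) G"
  proof
    show "\<one> \<in> adjoin z" unfolding adjoin_def by (auto intro!: exI[of _ 0])
    fix x y assume xy: "x \<in> adjoin z" "y \<in> adjoin z"
    then obtain i j :: int where ij: "H #> x = ?q [^]\<^bsub>?Q\<^esub> i" "H #> y = ?q [^]\<^bsub>?Q\<^esub> j"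
      and c: "x \<in> carrier G" "y \<in> carrier G" unfolding eq by blast
    have "H #> (x \<otimes> y) = ?q [^]\<^bsub>?Q\<^esub> (i + j)"
      using ij c h.H.int_pow_mult[OF q] by (simp only: h.hom_mult)
    then show "x \<otimes> y \<in> adjoin z" unfolding eq using c by blast
  next
    fix x assume "x \<in> adjoin z"
    then obtain i :: int where i: "H #> x = ?q [^]\<^bsub>?Q\<^esub> i" and c: "x \<in> carrier G" unfolding eq by blast
    have "H #> (inv x) = ?q [^]\<^bsub>?Q\<^esub> (- i)"
      using i c h.H.int_pow_neg[OF q] by (simp only: h.hom_inv)
    then show "inv x \<in> adjoin z" unfolding eq using c by blast
  qed (auto simp: adjoin_def)
  moreover have "g \<otimes> x \<otimes> inv g \<in> adjoin z" if g: "g \<in> carrier G" and x: "x \<in> adjoin z" for g x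
  proof -
    obtain i :: int where i: "H #> x = ?q [^]\<^bsub>?Q\<^esub> i" and c: "x \<in> carrier G" using x unfolding eq by blast
    have "H #> (g \<otimes> x \<otimes> inv g) = (H #> g) \<otimes>\<^bsub>?Q\<^esub> ?q [^]\<^bsub>?Q\<^esub> i \<otimes>\<^bsub>?Q\<^esub> inv\<^bsub>?Q\<^esub> (H #> g)"
      using g c i by (simp only: h.hom_mult h.hom_inv m_closed inv_closed)
    also have "\<dots> = ?q [^]\<^bsub>?Q\<^esub> i"
      using comm'[OF g, of i, symmetric] h.hom_closed[OF g] q
      by (simp add: h.H.inv_solve_right' del: mult_FactGroup)
    finally show ?thesis unfolding eq using g c by blast
  qed
  ultimately show ?thesis by (rule normal_invI)
qed

end

section \<open>Finite differences modulo a prime\<close>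

definition fdiff :: "(nat \<Rightarrow> int) \<Rightarrow> nat \<Rightarrow> int" where
  "fdiff a k = a (Suc k) - a k"

lemma fdiff_binomial:
  "(fdiff ^^ n) a k = (\<Sum>j\<le>n. (- 1) ^ (n + j) * int (n choose j) * a (k + j))"
proof (induction n arbitrary: k)
  case (Suc n)
  define c :: "nat \<Rightarrow> nat \<Rightarrow> int" where "c n j = (- 1) ^ (n + j) * int (n choose j)" for n j
  have c0: "c (Suc n) 0 = - c n 0" and cS: "c (Suc n) (Suc j) = c n j - c n (Suc j)" for j
    by (simp_all add: c_def algebra_simps)
  have "(\<Sum>j\<le>Suc n. c (Suc n) j * a (k + j))
      = - c n 0 * a k + (\<Sum>j\<le>n. c n j * a (Suc k + j)) - (\<Sum>j\<le>n. c n (Suc j) * a (k + Suc j))"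
    by (simp add: sum.atMost_Suc_shift c0 cS left_diff_distrib sum_subtractf del: sum.atMost_Suc)
  also have "\<dots> = (\<Sum>j\<le>n. c n j * a (Suc k + j)) - (\<Sum>j\<le>Suc n. c n j * a (k + j))"
    by (simp add: sum.atMost_Suc_shift del: sum.atMost_Suc)
  also have "(\<Sum>j\<le>Suc n. c n j * a (k + j)) = (\<Sum>j\<le>n. c n j * a (k + j))"
    by (simp add: c_def)
  finally show ?case using Suc by (simp add: fdiff_def c_def)
qed simp

text \<open>Modulo \<open>p\<close> the \<open>p\<close>-th power of a translation minus the identity is the translation
  by \<open>p\<close> minus the identity.\<close>

lemma fdiff_prime_period:
  assumes p: "Factorial_Ring.prime (p::nat)" and per: "\<And>k. [a (k + p) = a k] (mod int p)"
  shows "int p dvd (fdiff ^^ p) a k"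
proof -
  let ?t = "\<lambda>j. (- 1) ^ (p + j) * int (p choose j) * a (k + j)"
  have p0: "0 < p" using p prime_gt_0_nat by blast
  have "{..p} = insert 0 (insert p {0<..<p})" using p0 by auto
  then have "(fdiff ^^ p) a k = ?t 0 + ?t p + (\<Sum>j\<in>{0<..<p}. ?t j)"
    using p0 by (simp add: fdiff_binomial)
  moreover have "int p dvd (\<Sum>j\<in>{0<..<p}. ?t j)"
  proof (rule dvd_sum)
    fix j assume "j \<in> {0<..<p}"
    then have "p dvd (p choose j)" using p by (intro dvd_choose_prime) auto
    then have "int p dvd int (p choose j)" by simp
    then show "int p dvd ?t j" by (metis dvd_mult dvd_mult2)
  qed
  moreover have "int p dvd ?t 0 + ?t p"
  \<comment> \<open>For odd \<open>p\<close> the two extreme terms form a difference of values one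
    period apart; for \<open>p = 2\<close> they form a sum, which agrees with the difference modulo
    2.\<close>
  proof (cases "even p")
    case True
    then have "p = 2" using p by (metis two_is_prime_nat primes_dvd_imp_eq)
    then show ?thesis using per[of k] by (auto simp: cong_iff_dvd_diff)
  next
    case False
    then show ?thesis using per[of k] by (simp add: cong_iff_dvd_diff)
  qed
  ultimately show ?thesis by (simp add: dvd_add)
qed

lemma cong_const_of_succ:
  fixes f :: "int \<Rightarrow> int"
  assumes "\<And>x. [f (x + 1) = f x] (mod m)"
  shows "[f x = f 0] (mod m)"
proof (induction x rule: int_induct[where k = 0])
  case (step1 i)
  then show ?case using assms[of i] cong_trans by blast
next
  case (step2 i)
  then show ?case using assms[of "i - 1"] cong_trans cong_sym by (metis diff_add_cancel)
qed simp

definition xdiff :: "(int \<Rightarrow> int \<Rightarrow> int) \<Rightarrow> int \<Rightarrow> int \<Rightarrow> int" where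
  "xdiff s x y = s (x + 1) y - s x y"

lemma xdiff_fdiff: "(xdiff ^^ n) s (x + int k) y = (fdiff ^^ n) (\<lambda>k. s (x + int k) y) k"
proof (induction n arbitrary: k)
  case (Suc n)
  show ?case using Suc[of k] Suc[of "Suc k"] by (simp add: xdiff_def fdiff_def algebra_simps)
qed simp

text \<open>Let \<open>m\<close> be the least order at which all differences in \<open>x\<close>
  vanish modulo \<open>p\<close>; periodicity gives \<open>m \<le> p\<close>. Vanishing at
  \<open>x = 0\<close> but not at \<open>(a, b)\<close> excludes \<open>m = 0\<close> and
  \<open>m = 1\<close>. Two orders below \<open>m\<close> the function is affine in
  \<open>x\<close>, and its slope is not identically zero.\<close>

lemma xdiff_affine:
  assumes p: "Factorial_Ring.prime (p::nat)"
    and per: "\<And>x y. [s (x + int p) y = s x y] (mod int p)"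
    and zero: "\<And>y. [s 0 y = 0] (mod int p)"
    and nz: "\<not> int p dvd s a b"
  obtains i b' where
    "\<And>x y. [(xdiff ^^ i) s x y = (xdiff ^^ i) s 0 y + x * ((xdiff ^^ i) s 1 y - (xdiff ^^ i) s 0 y)] (mod int p)"
    "\<not> int p dvd (xdiff ^^ i) s 1 b' - (xdiff ^^ i) s 0 b'"
proof -
  define Z where "Z n \<longleftrightarrow> (\<forall>x y. int p dvd (xdiff ^^ n) s x y)" for n
  have "Z p"
    unfolding Z_def
  proof (intro allI)
    fix x y
    have "int p dvd (fdiff ^^ p) (\<lambda>k. s (x + int k) y) 0"
      by (rule fdiff_prime_period[OF p]) (use per[of "x + int _" y] in \<open>simp add: add.assoc\<close>)
    then show "int p dvd (xdiff ^^ p) s x y" using xdiff_fdiff[of p s x 0 y] by simp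
  qed
  define m where "m = (LEAST n. Z n)"
  have m: "Z m" unfolding m_def by (rule LeastI) (rule \<open>Z p\<close>)
  have least: "\<not> Z n" if "n < m" for n using that not_less_Least unfolding m_def by blast
  have "m \<noteq> 0" using m nz unfolding Z_def by (metis funpow_0)
  moreover have "m \<noteq> 1"
  proof
    assume "m = 1"
    then have "[s (x + 1) y = s x y] (mod int p)" for x y
      using m unfolding Z_def by (simp add: xdiff_def cong_iff_dvd_diff)
    then have "[s a b = s 0 b] (mod int p)" by (rule cong_const_of_succ)
    then show False using zero[of b] nz by (metis cong_0_iff cong_trans)
  qed
  ultimately obtain i where i: "m = Suc (Suc i)" by (metis One_nat_def not0_implies_Suc)
  let ?t = "(xdiff ^^ i) s" and ?d = "(xdiff ^^ Suc i) s"
  have d: "?d x y = ?t (x + 1) y - ?t x y" for x y by (simp add: xdiff_def)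
  have "[?d (x + 1) y = ?d x y] (mod int p)" for x y
    using m unfolding i Z_def by (simp add: xdiff_def cong_iff_dvd_diff)
  then have dc: "[?d x y = ?d 0 y] (mod int p)" for x y
    using cong_const_of_succ[of "\<lambda>x. ?d x y"] by blast
  have "[?t x y - x * ?d 0 y = ?t 0 y - 0 * ?d 0 y] (mod int p)" for x y
  proof (rule cong_const_of_succ)
    fix x
    have "?t (x + 1) y - (x + 1) * ?d 0 y - (?t x y - x * ?d 0 y) = ?d x y - ?d 0 y"
      by (simp only: d) (simp add: algebra_simps)
    then show "[?t (x + 1) y - (x + 1) * ?d 0 y = ?t x y - x * ?d 0 y] (mod int p)"
      using dc by (simp only: cong_iff_dvd_diff)
  qed
  then have "[?t x y = ?t 0 y + x * (?t 1 y - ?t 0 y)] (mod int p)" for x y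
    by (simp only: d cong_iff_dvd_diff) (simp add: algebra_simps)
  moreover obtain a' b' where "\<not> int p dvd ?d a' b'"
    using least[of "Suc i"] i unfolding Z_def by auto
  then have "\<not> int p dvd ?t 1 b' - ?t 0 b'" using dc[of a' b'] d[of 0 b'] cong_dvd_iff by fastforce
  ultimately show thesis using that by blast
qed

text \<open>Differencing a function that is not affine in \<open>x\<close> until it becomes affine in \<open>x\<close>, and then
  doing the same for \<open>y\<close>, leaves a nonzero multiple of \<open>x * y\<close>.\<close>

lemma product_from_absorbing:
  fixes S :: "(int \<Rightarrow> int \<Rightarrow> int) set"
  assumes p: "Factorial_Ring.prime (p::nat)"
    and sub: "\<And>s t. s \<in> S \<Longrightarrow> t \<in> S \<Longrightarrow> (\<lambda>x y. s x y - t x y) \<in> S"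
    and scale: "\<And>s c. s \<in> S \<Longrightarrow> (\<lambda>x y. c * s x y) \<in> S"
    and shift: "\<And>s. s \<in> S \<Longrightarrow> (\<lambda>x y. s (x + 1) y) \<in> S" "\<And>s. s \<in> S \<Longrightarrow> (\<lambda>x y. s x (y + 1)) \<in> S"
    and zero: "\<And>s. s \<in> S \<Longrightarrow> (\<lambda>x y. s 0 y) \<in> S" "\<And>s. s \<in> S \<Longrightarrow> (\<lambda>x y. s x 0) \<in> S"
    and per: "\<And>s x y. s \<in> S \<Longrightarrow> [s (x + int p) y = s x y] (mod int p)"
      "\<And>s x y. s \<in> S \<Longrightarrow> [s x (y + int p) = s x y] (mod int p)"
    and s: "s \<in> S" and abs: "\<And>y. [s 0 y = 0] (mod int p)" "\<And>x. [s x 0 = 0] (mod int p)"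
    and nz: "\<not> int p dvd s a b"
  obtains t where "t \<in> S" "\<And>x y. [t x y = x * y] (mod int p)"
proof -
  obtain i b1 where
    i: "\<And>x y. [(xdiff ^^ i) s x y = (xdiff ^^ i) s 0 y + x * ((xdiff ^^ i) s 1 y - (xdiff ^^ i) s 0 y)] (mod int p)"
    and b1: "\<not> int p dvd (xdiff ^^ i) s 1 b1 - (xdiff ^^ i) s 0 b1"
    using xdiff_affine[where s = s, OF p per(1)[OF s] abs(1) nz] by blast
  define t where "t = (xdiff ^^ i) s"
  have t: "t \<in> S" unfolding t_def
  proof (induction i)
    case (Suc i)
    show ?case using sub[OF shift(1)[OF Suc] Suc] by (simp add: xdiff_def[abs_def])
  qed (use s in simp)
  have t0: "[t x 0 = 0] (mod int p)" for x unfolding t_def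
  proof (induction i arbitrary: x)
    case (Suc i)
    show ?case using cong_diff[OF Suc[of "x + 1"] Suc[of x]] by (simp add: xdiff_def)
  qed (use abs in simp)
  define c where "c y = t 1 y - t 0 y" for y
  \<comment> \<open>Removing the value at \<open>x = 0\<close> leaves exactly the linear part
    \<open>x * c y\<close>. The swap in \<open>s3\<close> then lets the same reduction run on
    \<open>y\<close>, and differences in \<open>y\<close> keep linearity in
    \<open>x\<close>.\<close>
  define s2 where "s2 x y = t x y - t 0 y" for x y
  have s2: "s2 \<in> S" using sub[OF t zero(1)[OF t]] unfolding s2_def[abs_def] .
  have s2c: "[s2 x y = x * c y] (mod int p)" for x y
    using i[of x y] unfolding s2_def c_def t_def by (simp add: cong_iff_dvd_diff algebra_simps)
  define s3 where "s3 y x = s2 x y" for x y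
  have s3: "[s3 (y + int p) x = s3 y x] (mod int p)" for x y using per(2)[OF s2] unfolding s3_def .
  have s30: "[s3 0 x = 0] (mod int p)" for x
    using cong_diff[OF t0[of x] t0[of 0]] unfolding s3_def s2_def by simp
  have "s3 b1 1 = t 1 b1 - t 0 b1" unfolding s3_def s2_def ..
  then have s3nz: "\<not> int p dvd s3 b1 1" using b1 unfolding t_def by simp
  obtain j b2 where
    j: "\<And>y x. [(xdiff ^^ j) s3 y x = (xdiff ^^ j) s3 0 x + y * ((xdiff ^^ j) s3 1 x - (xdiff ^^ j) s3 0 x)] (mod int p)"
    and b2: "\<not> int p dvd (xdiff ^^ j) s3 1 b2 - (xdiff ^^ j) s3 0 b2"
    using xdiff_affine[where s = s3, OF p s3 s30 s3nz] by blast
  define t' where "t' = (xdiff ^^ j) s3"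
  have t': "(\<lambda>x y. t' y x) \<in> S" unfolding t'_def
  proof (induction j)
    case (Suc j)
    show ?case using sub[OF shift(2)[OF Suc] Suc] by (simp add: xdiff_def[abs_def])
  qed (use s2 in \<open>simp add: s3_def[abs_def]\<close>)
  have lin: "[t' y x = x * t' y 1] (mod int p)" for x y unfolding t'_def
  proof (induction j arbitrary: y)
    case 0
    have "[s2 x y = x * s2 1 y] (mod int p)"
      using s2c[of x y] s2c[of 1 y] by (metis cong_scalar_left cong_sym cong_trans mult_1)
    then show ?case by (simp add: s3_def)
  next
    case (Suc j)
    show ?case using cong_diff[OF Suc[of "y + 1"] Suc[of y]] by (simp add: xdiff_def right_diff_distrib)
  qed
  define e where "e = t' 1 1 - t' 0 1"
  have e: "[t' y x - t' 0 x = e * (x * y)] (mod int p)" for x y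
  proof -
    have "[t' y x - t' 0 x = y * (t' 1 x - t' 0 x)] (mod int p)"
      using j[of y x] unfolding t'_def by (simp add: cong_iff_dvd_diff algebra_simps)
    also have "[y * (t' 1 x - t' 0 x) = y * (x * t' 1 1 - x * t' 0 1)] (mod int p)"
      by (intro cong_scalar_left cong_diff lin)
    finally show ?thesis by (simp add: e_def algebra_simps)
  qed
  have "\<not> int p dvd e"
  proof
    assume "int p dvd e"
    then have "int p dvd e * (b2 * 1)" by simp
    then have "int p dvd t' 1 b2 - t' 0 b2" using e[where x = b2 and y = 1] cong_dvd_iff by blast
    then show False using b2 unfolding t'_def by simp
  qed
  then have "coprime e (int p)" using p by (metis coprime_commute prime_imp_coprime prime_nat_int_transfer)
  then obtain f where f: "[e * f = 1] (mod int p)" using cong_solve_coprime_int by blast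
  let ?r = "\<lambda>x y. f * (t' y x - t' 0 x)"
  have "?r \<in> S" using scale[OF sub[OF t' zero(2)[OF t']], of f] .
  moreover have "[?r x y = x * y] (mod int p)" for x y
  proof -
    have "[?r x y = f * (e * (x * y))] (mod int p)" using e by (rule cong_scalar_left)
    also have "f * (e * (x * y)) = (e * f) * (x * y)" by simp
    also have "[(e * f) * (x * y) = 1 * (x * y)] (mod int p)" using f by (rule cong_scalar_right)
    finally show ?thesis by simp
  qed
  ultimately show thesis by (rule that)
qed

section \<open>Clones of congruence preserving functions of a group\<close>

text \<open>Only the restriction has to lie in the clone, so operations can be written as plain
  lambda terms without caring about values outside \<open>nlists n A\<close>.\<close>

definition clone_op :: "'a set \<Rightarrow> 'a operation set \<Rightarrow> nat \<Rightarrow> ('a list \<Rightarrow> 'a) \<Rightarrow> bool" where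
  "clone_op A C n f \<longleftrightarrow> (n, restrict f (nlists n A)) \<in> C"

lemma clone_op_cong:
  assumes "clone_op A C n f" "\<And>xs. xs \<in> nlists n A \<Longrightarrow> f xs = g xs"
  shows "clone_op A C n g"
  using assms restrict_ext[of "nlists n A" f g] unfolding clone_op_def by simp

lemma clone_op_operations:
  assumes "clone A C" "clone_op A C n f"
  shows "(n, restrict f (nlists n A)) \<in> operations A"
  using assms clone_subset unfolding clone_op_def by blast

lemma clone_op_arity: "clone A C \<Longrightarrow> clone_op A C n f \<Longrightarrow> 1 \<le> n"
  using clone_op_operations by (fastforce simp: operations_def)

lemma clone_op_closed:
  assumes "clone A C" "clone_op A C n f" "xs \<in> nlists n A"
  shows "f xs \<in> A"
proof -
  have "restrict f (nlists n A) \<in> nlists n A \<rightarrow>\<^sub>E A"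
    using clone_op_operations[OF assms(1,2)] by (simp add: operations_def)
  then show ?thesis using PiE_mem[OF _ assms(3)] assms(3) by fastforce
qed

lemma clone_op_nth: "clone A C \<Longrightarrow> i < n \<Longrightarrow> clone_op A C n (\<lambda>xs. xs ! i)"
  using clone_proj[of A C i n] unfolding clone_op_def proj_op_def by simp

lemma nlists_map_upt:
  assumes "\<And>i. i < n \<Longrightarrow> h i \<in> A"
  shows "map h [0..<n] \<in> nlists n A"
  using assms by (intro nlistsI) auto

lemma nlists_length: "xs \<in> nlists n A \<Longrightarrow> length xs = n"
  by (rule nlistsE_length)

lemma clone_op_compose:
  assumes C: "clone A C" and f: "clone_op A C n f"
    and h: "\<And>i. i < n \<Longrightarrow> clone_op A C m (h i)"
  shows "clone_op A C m (\<lambda>xs. f (map (\<lambda>i. h i xs) [0..<n]))"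
proof -
  let ?f = "restrict f (nlists n A)"
  let ?gs = "map (\<lambda>i. restrict (h i) (nlists m A)) [0..<n]"
  have "compose_op A m ?f ?gs \<in> C"
    using C f h unfolding clone_op_def by (intro clone_compose[of A C n]) auto
  moreover have "(\<lambda>xs\<in>nlists m A. ?f (map (\<lambda>g. g xs) ?gs))
      = (\<lambda>xs\<in>nlists m A. f (map (\<lambda>i. h i xs) [0..<n]))"
  proof (rule restrict_ext)
    fix xs assume xs: "xs \<in> nlists m A"
    have "map (\<lambda>g. g xs) ?gs = map (\<lambda>i. h i xs) [0..<n]" using xs by simp
    moreover have "map (\<lambda>i. h i xs) [0..<n] \<in> nlists n A"
      using clone_op_closed[OF C h xs] by (rule nlists_map_upt)
    ultimately show "?f (map (\<lambda>g. g xs) ?gs) = f (map (\<lambda>i. h i xs) [0..<n])"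
      by (simp only: restrict_apply if_True)
  qed
  ultimately show ?thesis unfolding clone_op_def compose_op_def by simp
qed

lemma (in normal) coset_congruence:
  "congruence (carrier G) (group_operations G)
    {(x, y) \<in> carrier G \<times> carrier G. H #> x = H #> y}"
proof -
  let ?\<theta> = "{(x, y) \<in> carrier G \<times> carrier G. H #> x = H #> y}"
  interpret h: group_hom G "G Mod H" "(#>) H" by (rule group_hom_Mod)
  have mem: "xs ! i \<in> carrier G" if "xs \<in> nlists n (carrier G)" "i < n" for xs n i
    using nlistsE_nth_in that by metis
  have "equiv (carrier G) ?\<theta>"
    by (rule equivI) (auto simp: refl_on_def sym_on_def trans_on_def)
  moreover have "preserves (carrier G) (2, \<lambda>xs\<in>nlists 2 (carrier G). xs ! 0 \<otimes> xs ! 1) ?\<theta>"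
    unfolding preserves_def split
  proof (intro ballI impI)
    fix xs ys
    assume xs: "xs \<in> nlists 2 (carrier G)" and ys: "ys \<in> nlists 2 (carrier G)"
      and *: "\<forall>i<2. (xs ! i, ys ! i) \<in> ?\<theta>"
    have "(xs ! 0, ys ! 0) \<in> ?\<theta>" "(xs ! 1, ys ! 1) \<in> ?\<theta>" using * by simp_all
    then have c: "xs ! 0 \<in> carrier G" "ys ! 0 \<in> carrier G" "xs ! 1 \<in> carrier G" "ys ! 1 \<in> carrier G"
      and "H #> xs ! 0 = H #> ys ! 0" "H #> xs ! 1 = H #> ys ! 1" by auto
    then have "H #> (xs ! 0 \<otimes> xs ! 1) = H #> (ys ! 0 \<otimes> ys ! 1)" by (simp only: h.hom_mult)
    then show "((\<lambda>xs\<in>nlists 2 (carrier G). xs ! 0 \<otimes> xs ! 1) xs,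
        (\<lambda>xs\<in>nlists 2 (carrier G). xs ! 0 \<otimes> xs ! 1) ys) \<in> ?\<theta>"
      using xs ys c by simp
  qed
  moreover have "preserves (carrier G) (1, \<lambda>xs\<in>nlists 1 (carrier G). inv (xs ! 0)) ?\<theta>"
    unfolding preserves_def split
  proof (intro ballI impI)
    fix xs ys
    assume xs: "xs \<in> nlists 1 (carrier G)" and ys: "ys \<in> nlists 1 (carrier G)"
      and *: "\<forall>i<1. (xs ! i, ys ! i) \<in> ?\<theta>"
    have "(xs ! 0, ys ! 0) \<in> ?\<theta>" using * by simp
    then have c: "xs ! 0 \<in> carrier G" "ys ! 0 \<in> carrier G"
      and "H #> xs ! 0 = H #> ys ! 0" by auto
    then have "H #> (inv (xs ! 0)) = H #> (inv (ys ! 0))" by (simp only: h.hom_inv)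
    then show "((\<lambda>xs\<in>nlists 1 (carrier G). inv (xs ! 0)) xs,
        (\<lambda>xs\<in>nlists 1 (carrier G). inv (xs ! 0)) ys) \<in> ?\<theta>"
      using xs ys c by simp
  qed
  moreover have "preserves (carrier G) (const_op (carrier G) 1 \<one>) ?\<theta>"
    unfolding preserves_def const_op_def by simp
  ultimately show ?thesis
    unfolding congruence_def group_operations_def by (simp only: ball_simps simp_thms)
qed

locale cp_clone = group G for G (structure) +
  fixes C :: "'a operation set"
  assumes clone: "clone (carrier G) C"
    and Pol_subset: "Pol (carrier G) (group_operations G) \<subseteq> C"
    and subset_Comp: "C \<subseteq> Comp (carrier G) (group_operations G)"
begin

abbreviation "Op \<equiv> clone_op (carrier G) C"

lemmas Op_closed = clone_op_closed[OF clone]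
  and Op_arity = clone_op_arity[OF clone]
  and Op_nth = clone_op_nth[OF clone]
  and Op_compose = clone_op_compose[OF clone]

lemma Pol_generators:
  "group_operations G \<union> {const_op (carrier G) n a | n a. 1 \<le> n \<and> a \<in> carrier G} \<subseteq> C"
  using Pol_subset hull_subset unfolding Pol_def by (rule order_trans[rotated])

lemma Op_const: "1 \<le> n \<Longrightarrow> a \<in> carrier G \<Longrightarrow> Op n (\<lambda>_. a)"
  using Pol_generators unfolding clone_op_def const_op_def by blast

lemma Op_mult:
  assumes "Op n f" "Op n g"
  shows "Op n (\<lambda>xs. f xs \<otimes> g xs)"
proof -
  have "Op 2 (\<lambda>xs. xs ! 0 \<otimes> xs ! 1)"
    using Pol_generators unfolding clone_op_def group_operations_def by blast
  then have "Op n (\<lambda>xs. (\<lambda>xs. xs ! 0 \<otimes> xs ! 1) (map (\<lambda>i. (if i = 0 then f else g) xs) [0..<2]))"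
    by (rule Op_compose) (use assms in simp)
  then show ?thesis by simp
qed

lemma Op_inv:
  assumes "Op n f"
  shows "Op n (\<lambda>xs. inv (f xs))"
proof -
  have "Op 1 (\<lambda>xs. inv (xs ! 0))"
    using Pol_generators unfolding clone_op_def group_operations_def by blast
  then have "Op n (\<lambda>xs. (\<lambda>xs. inv (xs ! 0)) (map (\<lambda>i. f xs) [0..<1]))"
    by (rule Op_compose) (use assms in simp)
  then show ?thesis by simp
qed

lemma Op_nat_pow:
  assumes "Op n f"
  shows "Op n (\<lambda>xs. f xs [^] (k::nat))"
proof (induction k)
  case 0
  then show ?case using Op_const[OF Op_arity[OF assms] one_closed] by simp
next
  case (Suc k)
  then show ?case using Op_mult[OF Suc assms] by simp
qed

lemma Op_update:
  assumes f: "Op n f" and g: "Op n g"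
  shows "Op n (\<lambda>xs. f (xs[j := g xs]))"
proof -
  let ?h = "\<lambda>i. if i = j then g else (\<lambda>xs. xs ! i)"
  have "Op n (\<lambda>xs. f (map (\<lambda>i. ?h i xs) [0..<n]))"
    by (rule Op_compose[OF f]) (use g Op_nth in simp)
  then show ?thesis
  proof (rule clone_op_cong)
    fix xs assume "xs \<in> nlists n (carrier G)"
    then have "map (\<lambda>i. ?h i xs) [0..<n] = xs[j := g xs]"
      by (intro nth_equalityI) (auto simp: nlists_length nth_list_update)
    then show "f (map (\<lambda>i. ?h i xs) [0..<n]) = f (xs[j := g xs])" by simp
  qed
qed

lemma Op_compatible:
  assumes f: "Op n f" and N: "N \<lhd> G" and xs: "xs \<in> nlists n (carrier G)"
    and ys: "ys \<in> nlists n (carrier G)" and eq: "\<And>i. i < n \<Longrightarrow> xs ! i \<otimes> inv (ys ! i) \<in> N"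
  shows "f xs \<otimes> inv (f ys) \<in> N"
proof -
  interpret N: normal N G by fact
  let ?\<theta> = "{(x, y) \<in> carrier G \<times> carrier G. N #> x = N #> y}"
  have "preserves (carrier G) (n, restrict f (nlists n (carrier G))) ?\<theta>"
    using f subset_Comp N.coset_congruence unfolding clone_op_def Comp_def by blast
  moreover have "(xs ! i, ys ! i) \<in> ?\<theta>" if "i < n" for i
    using eq[OF that] N.rcos_eq_iff nlistsE_nth_in[OF xs that] nlistsE_nth_in[OF ys that] by simp
  ultimately have "(restrict f (nlists n (carrier G)) xs, restrict f (nlists n (carrier G)) ys) \<in> ?\<theta>"
    unfolding preserves_def split using xs ys by blast
  then have "f xs \<in> carrier G" "f ys \<in> carrier G" "N #> f xs = N #> f ys" using xs ys by simp_all
  then show ?thesis using N.rcos_eq_iff[of "f xs" "f ys"] by blast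
qed

end

section \<open>Reduction to absorbing operations\<close>

context group
begin

definition absorbing :: "nat \<Rightarrow> ('a list \<Rightarrow> 'a) \<Rightarrow> bool" where
  "absorbing n f \<longleftrightarrow> (\<forall>xs\<in>nlists n (carrier G). \<forall>i<n. xs ! i = \<one> \<longrightarrow> f xs = \<one>)"

lemma absorbingD: "absorbing n f \<Longrightarrow> xs \<in> nlists n (carrier G) \<Longrightarrow> i < n \<Longrightarrow> xs ! i = \<one> \<Longrightarrow> f xs = \<one>"
  unfolding absorbing_def by blast

text \<open>Setting a variable to the neutral element lowers the arity, and dividing \<open>f\<close> by the result
  makes it absorb this variable.\<close>

lemma clone_op_subset_by_absorbing:
  assumes C: "cp_clone G C" and C': "cp_clone G C'" and k: "1 \<le> k"
    and base: "\<And>n f. n \<le> k \<Longrightarrow> clone_op (carrier G) C n f \<Longrightarrow> clone_op (carrier G) C' n f"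
    and abs: "\<And>n f. k < n \<Longrightarrow> clone_op (carrier G) C n f \<Longrightarrow> absorbing n f
      \<Longrightarrow> clone_op (carrier G) C' n f"
    and f: "clone_op (carrier G) C n f"
  shows "clone_op (carrier G) C' n f"
  using f
proof (induction n arbitrary: f rule: less_induct)
  case (less n)
  interpret C: cp_clone G C by (rule C)
  interpret C': cp_clone G C' by (rule C')
  show ?case
  proof (cases "n \<le> k")
    case True
    then show ?thesis using base less.prems by blast
  next
    case False
    then have n: "2 \<le> n" "k < n" using k by auto
    \<comment> \<open>With one variable fixed, \<open>g\<close> comes from an operation of arity
      \<open>n - 1\<close>, which the induction hypothesis moves to \<open>C'\<close>; projections
      then restore the arity \<open>n\<close>.\<close>
    have restricted: "C'.Op n (\<lambda>xs. g (xs[i := \<one>]))" if g: "C.Op n g" and i: "i < n" for g i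
    proof -
      let ?h = "\<lambda>j ys. if j < i then ys ! j else if j = i then \<one> else ys ! (j - 1)"
      let ?g = "\<lambda>ys. g (map (\<lambda>j. ?h j ys) [0..<n])"
      have "C.Op (n - 1) ?g"
      proof (rule C.Op_compose[OF g])
        fix j assume j: "j < n"
        consider "j < i" | "j = i" | "i < j" by linarith
        then show "C.Op (n - 1) (?h j)"
        proof cases
          case 1
          then show ?thesis using i C.Op_nth[of j "n - 1"] by simp
        next
          case 2
          then show ?thesis using n C.Op_const[of "n - 1" \<one>] by simp
        next
          case 3
          then show ?thesis using j C.Op_nth[of "j - 1" "n - 1"] by simp
        qed
      qed
      then have "C'.Op (n - 1) ?g" using less.IH[of "n - 1"] n by simp
      then have "C'.Op n (\<lambda>xs. ?g (map (\<lambda>j. xs ! (if j < i then j else Suc j)) [0..<n - 1]))"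
        by (rule C'.Op_compose) (use C'.Op_nth in simp)
      then show ?thesis
      proof (rule clone_op_cong)
        fix xs assume xs: "xs \<in> nlists n (carrier G)"
        have "map (\<lambda>j. ?h j (map (\<lambda>j. xs ! (if j < i then j else Suc j)) [0..<n - 1])) [0..<n]
            = xs[i := \<one>]"
        proof (rule nth_equalityI)
          fix j assume "j < length (map (\<lambda>j. ?h j (map (\<lambda>j. xs ! (if j < i then j else Suc j)) [0..<n - 1])) [0..<n])"
          then have "j < n" by simp
          then show "map (\<lambda>j. ?h j (map (\<lambda>j. xs ! (if j < i then j else Suc j)) [0..<n - 1])) [0..<n] ! j
              = xs[i := \<one>] ! j"
            using i nlists_length[OF xs] by (auto simp: nth_list_update)
        qed (simp add: nlists_length[OF xs])
        then show "?g (map (\<lambda>j. xs ! (if j < i then j else Suc j)) [0..<n - 1]) = g (xs[i := \<one>])"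
          by simp
      qed
    qed
    \<comment> \<open>\<open>F\<close> absorbs the first \<open>j\<close> variables, and
      \<open>f\<close> is recovered from it by factors that already lie in
      \<open>C'\<close>.\<close>
    have "\<exists>F. C.Op n F \<and> (\<forall>xs\<in>nlists n (carrier G). \<forall>i<j. xs ! i = \<one> \<longrightarrow> F xs = \<one>)
        \<and> (C'.Op n F \<longrightarrow> C'.Op n f)" if "j \<le> n" for j
      using that
    proof (induction j)
      case 0
      then show ?case using less.prems by auto
    next
      case (Suc j)
      then obtain F where F: "C.Op n F" "C'.Op n F \<longrightarrow> C'.Op n f"
        and Fj: "\<And>xs i. xs \<in> nlists n (carrier G) \<Longrightarrow> i < j \<Longrightarrow> xs ! i = \<one> \<Longrightarrow> F xs = \<one>"
        by auto
      let ?F = "\<lambda>xs. F xs \<otimes> inv (F (xs[j := \<one>]))"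
      have upd: "xs[j := \<one>] \<in> nlists n (carrier G)" if "xs \<in> nlists n (carrier G)" for xs
        using that by (rule nlists_update_in_list) simp
      have "C.Op n (\<lambda>xs. F (xs[j := \<one>]))"
        using C.Op_update[OF F(1) C.Op_const] n by simp
      then have "C.Op n ?F" using F(1) C.Op_mult C.Op_inv by blast
      moreover have "?F xs = \<one>" if xs: "xs \<in> nlists n (carrier G)" and i: "i < Suc j" "xs ! i = \<one>" for xs i
      proof (cases "i = j")
        case True
        then have "xs[j := \<one>] = xs" using i by (metis list_update_id)
        then show ?thesis using C.Op_closed[OF F(1) xs] by simp
      next
        case False
        then have "F xs = \<one>" "F (xs[j := \<one>]) = \<one>"
          using Fj[OF xs, of i] Fj[OF upd[OF xs], of i] i by auto
        then show ?thesis by simp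
      qed
      moreover have "C'.Op n F" if "C'.Op n ?F"
      proof -
        have "C'.Op n (\<lambda>xs. ?F xs \<otimes> F (xs[j := \<one>]))"
          using C'.Op_mult[OF that restricted[OF F(1)]] Suc by simp
        then show ?thesis
          by (rule clone_op_cong) (use C.Op_closed[OF F(1)] upd in \<open>simp add: m_assoc\<close>)
      qed
      ultimately show ?case using F(2) by (intro exI[of _ ?F]) blast
    qed
    then obtain F where "C.Op n F" "absorbing n F" "C'.Op n F \<longrightarrow> C'.Op n f"
      unfolding absorbing_def by blast
    then show ?thesis using abs n by blast
  qed
qed

end

text \<open>\<open>V \<gamma>\<close> is the higher commutator of the normal subgroups \<open>\<gamma> i\<close>. As it is distributive over joins,
  every entry \<open>carrier G\<close> can be replaced by a normal subgroup for which the commutator stays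
  nontrivial, but becomes strictly smaller.\<close>

lemma (in cp_clone) absorbing_trivial:
  assumes fin: "finite (carrier G)" and D: "D \<lhd> G"
    and generated: "\<And>\<mu> H. \<mu> \<lhd> G \<Longrightarrow> \<mu> \<noteq> {\<one>} \<Longrightarrow> \<mu> \<subseteq> D \<Longrightarrow> subgroup H G
      \<Longrightarrow> (\<And>\<gamma>. \<gamma> \<lhd> G \<Longrightarrow> \<not> \<mu> \<subseteq> \<gamma> \<Longrightarrow> \<gamma> \<subseteq> H) \<Longrightarrow> H = carrier G"
    and n: "card (carrier G) \<le> n"
    and F: "Op n F" "absorbing n F" "\<And>xs. xs \<in> nlists n (carrier G) \<Longrightarrow> F xs \<in> D"
    and xs: "xs \<in> nlists n (carrier G)"
  shows "F xs = \<one>"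
proof (rule ccontr)
  assume nontriv: "F xs \<noteq> \<one>"
  interpret D: normal D G by (rule D)
  \<comment> \<open>Values are confined to \<open>D\<close> because \<open>generated\<close> speaks
    only about normal subgroups contained in \<open>D\<close>.\<close>
  define Ab where "Ab = {F. Op n F \<and> absorbing n F \<and> (\<forall>xs\<in>nlists n (carrier G). F xs \<in> D)}"
  define gens where "gens \<gamma> = {F xs | F xs. F \<in> Ab \<and> xs \<in> nlists n (carrier G) \<and> (\<forall>i<n. xs ! i \<in> \<gamma> i)}"
    for \<gamma> :: "nat \<Rightarrow> 'a set"
  define V where "V \<gamma> = generate G (gens \<gamma>)" for \<gamma>
  have n1: "1 \<le> n" using Op_arity F(1) by blast
  have Ab_closed: "F xs \<in> carrier G" if "F \<in> Ab" "xs \<in> nlists n (carrier G)" for F xs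
    using that D.subset unfolding Ab_def by blast
  have gensI: "F xs \<in> gens \<gamma>" if "F \<in> Ab" "xs \<in> nlists n (carrier G)" "\<forall>i<n. xs ! i \<in> \<gamma> i"
    for F xs \<gamma>
    unfolding gens_def by (rule CollectI, intro exI conjI) (rule refl that)+
  have gens_closed: "gens \<gamma> \<subseteq> carrier G" for \<gamma> using Ab_closed unfolding gens_def by blast
  have gensD: "gens \<gamma> \<subseteq> D" for \<gamma> unfolding gens_def Ab_def by blast
  have V_sub: "subgroup (V \<gamma>) G" for \<gamma> unfolding V_def by (rule generate_is_subgroup[OF gens_closed])
  have V_least: "V \<gamma> \<subseteq> K" if "subgroup K G" "gens \<gamma> \<subseteq> K" for \<gamma> K
    unfolding V_def using generate_subgroup_incl that by blast
  have V_normal: "V \<gamma> \<lhd> G" for \<gamma>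
    unfolding V_def
  proof (rule normal_generateI[OF gens_closed])
    fix h g assume "h \<in> gens \<gamma>" and g: "g \<in> carrier G"
    then obtain F xs where F: "F \<in> Ab" and xs: "xs \<in> nlists n (carrier G)" "\<forall>i<n. xs ! i \<in> \<gamma> i"
      and h: "h = F xs" unfolding gens_def by blast
    have "(\<lambda>xs. g \<otimes> F xs \<otimes> inv g) \<in> Ab"
      unfolding Ab_def absorbing_def
    proof (intro CollectI conjI ballI allI impI)
      show "Op n (\<lambda>xs. g \<otimes> F xs \<otimes> inv g)"
        using F g n1 unfolding Ab_def by (intro Op_mult Op_const) auto
      show "g \<otimes> F xs \<otimes> inv g \<in> D" if "xs \<in> nlists n (carrier G)" for xs
        using D.inv_op_closed2[OF g] F that unfolding Ab_def by blast
      show "g \<otimes> F xs \<otimes> inv g = \<one>" if "xs \<in> nlists n (carrier G)" "i < n" "xs ! i = \<one>" for xs i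
        using absorbingD[of n F xs i] F that g unfolding Ab_def by simp
    qed
    from gensI[OF this xs] show "g \<otimes> h \<otimes> inv g \<in> gens \<gamma>" unfolding h .
  qed
  have upd: "xs[j := x] \<in> nlists n (carrier G)"
    if "xs \<in> nlists n (carrier G)" "x \<in> carrier G" for xs j x
    using nlists_update_in_list that by metis
  \<comment> \<open>A difference of an absorbing operation in variable \<open>j\<close> is absorbing
    again. This is the source of distributivity over joins: it makes the annihilator
    \<open>H\<close> below closed under products.\<close>
  have shift: "(\<lambda>zs. F (zs[j := zs ! j \<otimes> y]) \<otimes> inv (F (zs[j := y]))) \<in> Ab"
    if F: "F \<in> Ab" and j: "j < n" and y: "y \<in> carrier G" for F j y
    unfolding Ab_def absorbing_def
  proof (intro CollectI conjI ballI allI impI)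
    have FO: "Op n F" using F unfolding Ab_def by blast
    have "Op n (\<lambda>zs. zs ! j \<otimes> y)" using Op_mult Op_nth[OF j] Op_const[OF n1 y] by blast
    then show "Op n (\<lambda>zs. F (zs[j := zs ! j \<otimes> y]) \<otimes> inv (F (zs[j := y])))"
      by (rule Op_mult[OF Op_update[OF FO] Op_inv[OF Op_update[OF FO Op_const[OF n1 y]]]])
  next
    fix zs assume zs: "zs \<in> nlists n (carrier G)"
    have zj: "zs ! j \<otimes> y \<in> carrier G" using nlistsE_nth_in[OF zs j] y by simp
    then have "F (zs[j := zs ! j \<otimes> y]) \<in> D" "F (zs[j := y]) \<in> D"
      using F upd[OF zs] y unfolding Ab_def by blast+
    then show "F (zs[j := zs ! j \<otimes> y]) \<otimes> inv (F (zs[j := y])) \<in> D" by simp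
    fix i assume i: "i < n" "zs ! i = \<one>"
    show "F (zs[j := zs ! j \<otimes> y]) \<otimes> inv (F (zs[j := y])) = \<one>"
    proof (cases "i = j")
      case True
      then show ?thesis using i y Ab_closed[OF F upd[OF zs y]] by simp
    next
      case False
      have "F (zs[j := zs ! j \<otimes> y]) = \<one>" "F (zs[j := y]) = \<one>"
        using absorbingD[of n F "zs[j := _]" i] F i False upd[OF zs] zj y unfolding Ab_def by auto
      then show ?thesis by simp
    qed
  qed
  have smaller: "\<exists>\<beta>. \<beta> \<lhd> G \<and> V (\<gamma>(j := \<beta>)) \<noteq> {\<one>} \<and> V (\<gamma>(j := \<beta>)) \<subset> V \<gamma>"
    if j: "j < n" and \<gamma>j: "\<gamma> j = carrier G" and V: "V \<gamma> \<noteq> {\<one>}" for \<gamma> j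
  proof (rule ccontr)
    assume contra: "\<nexists>\<beta>. \<beta> \<lhd> G \<and> V (\<gamma>(j := \<beta>)) \<noteq> {\<one>} \<and> V (\<gamma>(j := \<beta>)) \<subset> V \<gamma>"
    \<comment> \<open>Compatibility with \<open>\<beta>\<close> and absorption in variable
      \<open>j\<close> put this subgroup into \<open>\<beta>\<close> as well as into
      \<open>V \<gamma>\<close>. If \<open>V \<gamma>\<close> is not below \<open>\<beta>\<close>,
      it is properly smaller, and \<open>contra\<close> leaves only the trivial group.\<close>
    have trivial: "V (\<gamma>(j := \<beta>)) = {\<one>}" if \<beta>: "\<beta> \<lhd> G" "\<not> V \<gamma> \<subseteq> \<beta>" for \<beta>
    proof -
      interpret \<beta>: normal \<beta> G by (rule \<beta>)
      have "gens (\<gamma>(j := \<beta>)) \<subseteq> gens \<gamma>"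
      proof
        fix h assume "h \<in> gens (\<gamma>(j := \<beta>))"
        then obtain F xs where F: "F \<in> Ab" "h = F xs" and xs: "xs \<in> nlists n (carrier G)"
          and i: "\<forall>i<n. xs ! i \<in> (\<gamma>(j := \<beta>)) i" unfolding gens_def by blast
        have "xs ! i \<in> \<gamma> i" if "i < n" for i
          using i that \<gamma>j nlistsE_nth_in[OF xs that] by (cases "i = j") auto
        then show "h \<in> gens \<gamma>" unfolding F(2) by (intro gensI F xs) simp
      qed
      then have 1: "V (\<gamma>(j := \<beta>)) \<subseteq> V \<gamma>" unfolding V_def by (rule mono_generate)
      have "gens (\<gamma>(j := \<beta>)) \<subseteq> \<beta>"
      proof
        fix h assume "h \<in> gens (\<gamma>(j := \<beta>))"
        then obtain F xs where F: "F \<in> Ab" and h: "h = F xs" and xs: "xs \<in> nlists n (carrier G)"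
          and i: "\<forall>i<n. xs ! i \<in> (\<gamma>(j := \<beta>)) i" unfolding gens_def by blast
        have "F xs \<otimes> inv (F (xs[j := \<one>])) \<in> \<beta>"
        proof (rule Op_compatible[OF _ \<beta>(1) xs upd[OF xs one_closed]])
          show "Op n F" using F unfolding Ab_def by blast
          fix i' assume i': "i' < n"
          show "xs ! i' \<otimes> inv (xs[j := \<one>] ! i') \<in> \<beta>"
            using i i' nlistsE_nth_in[OF xs i'] nlists_length[OF xs] by (cases "i' = j") auto
        qed
        moreover have "F (xs[j := \<one>]) = \<one>"
          using absorbingD[of n F "xs[j := \<one>]" j] F upd[OF xs one_closed] j nlists_length[OF xs]
          unfolding Ab_def by simp
        ultimately show "h \<in> \<beta>" using h Ab_closed[OF F xs] by simp
      qed
      then have "V (\<gamma>(j := \<beta>)) \<subseteq> \<beta>" by (rule V_least[OF \<beta>.subgroup_axioms])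
      then show ?thesis using contra 1 \<beta> by blast
    qed
    \<comment> \<open>The elements that can be put into position \<open>j\<close> without producing
      a nontrivial value. \<open>H\<close> is a subgroup containing every normal subgroup not above
      \<open>V \<gamma>\<close>, so \<open>generated\<close> makes it the whole group, and
      \<open>V \<gamma>\<close> becomes trivial.\<close>
    define H where "H = {x \<in> carrier G. \<forall>F\<in>Ab. \<forall>xs\<in>nlists n (carrier G).
      (\<forall>i<n. i \<noteq> j \<longrightarrow> xs ! i \<in> \<gamma> i) \<longrightarrow> F (xs[j := x]) = \<one>}"
    have HD: "F (xs[j := x]) = \<one>"
      if "x \<in> H" "F \<in> Ab" "xs \<in> nlists n (carrier G)" "\<forall>i<n. i \<noteq> j \<longrightarrow> xs ! i \<in> \<gamma> i" for x F xs
      using that unfolding H_def by blast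
    have unit: "F (xs[j := \<one>]) = \<one>" if "F \<in> Ab" "xs \<in> nlists n (carrier G)" for F xs
      using absorbingD[of n F "xs[j := \<one>]" j] that upd[of xs \<one>] j nlists_length[of xs] unfolding Ab_def
      by auto
    have shifted: "F (xs[j := x \<otimes> y]) = F (xs[j := y])"
      if x: "x \<in> H" and y: "y \<in> carrier G" and F: "F \<in> Ab" and xs: "xs \<in> nlists n (carrier G)"
        "\<forall>i<n. i \<noteq> j \<longrightarrow> xs ! i \<in> \<gamma> i" for x y F xs
    proof -
      have xc: "x \<in> carrier G" using x unfolding H_def by blast
      have "F ((xs[j := x])[j := xs[j := x] ! j \<otimes> y]) \<otimes> inv (F ((xs[j := x])[j := y])) = \<one>"
        using HD[OF x shift[OF F j y] xs] .
      then have "F (xs[j := x \<otimes> y]) \<otimes> inv (F (xs[j := y])) = \<one>"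
        using j nlists_length[OF xs(1)] by simp
      moreover have "F (xs[j := x \<otimes> y]) \<in> carrier G" "F (xs[j := y]) \<in> carrier G"
        using Ab_closed[OF F upd[OF xs(1)]] xc y by auto
      ultimately show ?thesis by (metis inv_equality inv_inv inv_closed)
    qed
    have "subgroup H G"
    proof
      show "H \<subseteq> carrier G" unfolding H_def by blast
      show "\<one> \<in> H" unfolding H_def using unit by blast
      fix x y assume x: "x \<in> H"
      then have xc: "x \<in> carrier G" unfolding H_def by blast
      have "F (xs[j := inv x]) = \<one>" if "F \<in> Ab" "xs \<in> nlists n (carrier G)"
        "\<forall>i<n. i \<noteq> j \<longrightarrow> xs ! i \<in> \<gamma> i" for F xs
        using shifted[OF x inv_closed[OF xc] that] unit[OF that(1,2)] xc by simp
      then show "inv x \<in> H" unfolding H_def using xc by blast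
      assume y: "y \<in> H"
      then have yc: "y \<in> carrier G" unfolding H_def by blast
      have "F (xs[j := x \<otimes> y]) = \<one>" if "F \<in> Ab" "xs \<in> nlists n (carrier G)"
        "\<forall>i<n. i \<noteq> j \<longrightarrow> xs ! i \<in> \<gamma> i" for F xs
        using shifted[OF x yc that] HD[OF y that] by simp
      then show "x \<otimes> y \<in> H" unfolding H_def using xc yc by blast
    qed
    moreover have "\<beta> \<subseteq> H" if \<beta>: "\<beta> \<lhd> G" "\<not> V \<gamma> \<subseteq> \<beta>" for \<beta>
    proof
      interpret \<beta>: normal \<beta> G by (rule \<beta>)
      fix x assume x: "x \<in> \<beta>"
      have "F (xs[j := x]) = \<one>" if F: "F \<in> Ab" and xs: "xs \<in> nlists n (carrier G)"
        "\<forall>i<n. i \<noteq> j \<longrightarrow> xs ! i \<in> \<gamma> i" for F xs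
      proof -
        have "xs[j := x] \<in> nlists n (carrier G)" by (rule upd[OF xs(1) subsetD[OF \<beta>.subset x]])
        moreover have "\<forall>i<n. xs[j := x] ! i \<in> (\<gamma>(j := \<beta>)) i"
          using xs x nlists_length[OF xs(1)] by (auto simp: nth_list_update)
        ultimately have "F (xs[j := x]) \<in> gens (\<gamma>(j := \<beta>))" by (rule gensI[OF F])
        then have "F (xs[j := x]) \<in> V (\<gamma>(j := \<beta>))" unfolding V_def by (rule generate.incl)
        then show ?thesis using trivial[OF \<beta>] by blast
      qed
      then show "x \<in> H" unfolding H_def using x \<beta>.subset by blast
    qed
    ultimately have H: "H = carrier G"
      using generated[OF V_normal V V_least[OF D.subgroup_axioms gensD]] by blast
    have "gens \<gamma> \<subseteq> {\<one>}"
    proof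
      fix h assume "h \<in> gens \<gamma>"
      then obtain F xs where F: "F \<in> Ab" "h = F xs" and xs: "xs \<in> nlists n (carrier G)"
        "\<forall>i<n. xs ! i \<in> \<gamma> i" unfolding gens_def by blast
      have "F (xs[j := xs ! j]) = \<one>"
        by (rule HD[OF _ F(1) xs(1)]) (use H nlistsE_nth_in[OF xs(1) j] xs(2) in auto)
      then show "h \<in> {\<one>}" using F by simp
    qed
    then have "V \<gamma> \<subseteq> {\<one>}" by (rule V_least[OF triv_subgroup])
    then show False using V subgroup.one_closed[OF V_sub[of \<gamma>]] by blast
  qed
  \<comment> \<open>Every replacement loses at least one element of \<open>V \<gamma>\<close>; after
    \<open>n\<close> replacements nothing would be left, not even the neutral element.\<close>
  have "\<exists>\<gamma>. (\<forall>i<n. j \<le> i \<longrightarrow> \<gamma> i = carrier G) \<and> V \<gamma> \<noteq> {\<one>} \<and> card (V \<gamma>) + j \<le> card (carrier G)"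
    if "j \<le> n" for j
    using that
  proof (induction j)
    case 0
    have "F xs \<in> gens (\<lambda>_. carrier G)"
      by (rule gensI[OF _ xs]) (use F nlistsE_nth_in[OF xs] in \<open>simp_all add: Ab_def\<close>)
    then have "V (\<lambda>_. carrier G) \<noteq> {\<one>}" using nontriv generate.incl unfolding V_def by fast
    then show ?case using card_mono[OF fin subgroup.subset[OF V_sub]] by (intro exI[of _ "\<lambda>_. carrier G"]) simp
  next
    case (Suc j)
    then obtain \<gamma> where \<gamma>: "\<forall>i<n. j \<le> i \<longrightarrow> \<gamma> i = carrier G" "V \<gamma> \<noteq> {\<one>}"
      "card (V \<gamma>) + j \<le> card (carrier G)" by auto
    then obtain \<beta> where \<beta>: "V (\<gamma>(j := \<beta>)) \<noteq> {\<one>}" "V (\<gamma>(j := \<beta>)) \<subset> V \<gamma>"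
      using smaller[of j \<gamma>] Suc by auto
    have "card (V (\<gamma>(j := \<beta>))) < card (V \<gamma>)"
      using psubset_card_mono[OF finite_subset[OF subgroup.subset[OF V_sub] fin] \<beta>(2)] .
    then have "card (V (\<gamma>(j := \<beta>))) + Suc j \<le> card (carrier G)" using \<gamma>(3) by linarith
    moreover have "\<forall>i<n. Suc j \<le> i \<longrightarrow> (\<gamma>(j := \<beta>)) i = carrier G" using \<gamma>(1) by simp
    ultimately show ?case using \<beta>(1) by (intro exI[of _ "\<gamma>(j := \<beta>)"] conjI)
  qed
  from this[of n] obtain \<gamma> where "card (V \<gamma>) + n \<le> card (carrier G)" by auto
  then have "card (V \<gamma>) = 0" using n by simp
  then show False
    using finite_subset[OF subgroup.subset[OF V_sub] fin, of \<gamma>] subgroup.one_closed[OF V_sub[of \<gamma>]] by auto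
qed

lemma fermat_int:
  assumes p: "Factorial_Ring.prime (p::nat)" and a: "\<not> int p dvd a"
  shows "[a ^ (p - 1) = 1] (mod int p)"
proof -
  let ?k = "nat (a mod int p)"
  have k: "int ?k = a mod int p" using prime_gt_0_nat[OF p] by simp
  then have ak: "[a = int ?k] (mod int p)" by (simp add: cong_def)
  then have "\<not> p dvd ?k" using a by (metis cong_dvd_iff int_dvd_int_iff)
  then have "[?k ^ (p - 1) = 1] (mod p)" by (rule fermat_theorem[OF p])
  then have "[int ?k ^ (p - 1) = 1] (mod int p)"
    by (metis cong_int_iff of_nat_1 of_nat_power)
  then show ?thesis using cong_pow[OF ak] cong_trans by blast
qed

section \<open>Splitting pairs and direct factors of prime order\<close>

context group
begin

lemma pow_coset_closed:
  assumes "N \<lhd> G" "x \<in> N"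
  shows "x [^] (i::int) \<in> N"
  using assms normal_imp_subgroup subgroup_int_pow_closed by blast

lemma exists_prime_torsion:
  assumes "finite (carrier G)" "x \<in> carrier G" "x \<noteq> \<one>"
  obtains p k where "Factorial_Ring.prime (p::nat)" "x [^] (k::nat) \<noteq> \<one>" "(x [^] k) [^] p = \<one>"
proof -
  have "ord x \<noteq> 1" using assms ord_eq_1 by blast
  then obtain p where p: "Factorial_Ring.prime p" "p dvd ord x" using prime_factor_nat by blast
  have 0: "0 < ord x" using ord_ge_1[OF assms(1,2)] by simp
  let ?k = "ord x div p"
  have "?k < ord x" using 0 p(1) prime_gt_1_nat by (simp add: div_less_dividend)
  moreover have "0 < ?k" using 0 p by (simp add: dvd_imp_le div_greater_zero_iff prime_gt_0_nat)
  ultimately have "x [^] ?k \<noteq> \<one>" using pow_eq_id[OF assms(2)] nat_dvd_not_less by blast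
  moreover have "(x [^] ?k) [^] p = \<one>" using p assms by (simp add: nat_pow_pow)
  ultimately show thesis using that p by blast
qed

text \<open>A splitting pair without \<open>\<mu> \<subseteq> \<delta>\<close>. This inclusion is
  the whole difference between strong splitting and the splitting caused by a direct factor.\<close>

definition normal_split :: "'a set \<Rightarrow> 'a set \<Rightarrow> bool" where
  "normal_split \<mu> \<delta> \<longleftrightarrow> \<mu> \<lhd> G \<and> \<delta> \<lhd> G \<and> \<mu> \<noteq> {\<one>} \<and> \<delta> \<noteq> carrier G
     \<and> (\<forall>\<alpha>. \<alpha> \<lhd> G \<longrightarrow> \<alpha> \<subseteq> \<delta> \<or> \<mu> \<subseteq> \<alpha>)"

lemma splits_strongly_normal_subgroup_lattice_iff:
  "splits_strongly (normal_subgroup_lattice G) \<longleftrightarrow> (\<exists>\<mu> \<delta>. normal_split \<mu> \<delta> \<and> \<mu> \<subseteq> \<delta>)"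
proof -
  have "{\<one>} \<subseteq> N" "N \<subseteq> carrier G" if "N \<lhd> G" for N
    using normal_imp_subgroup[OF that] by (auto simp: subgroup_def)
  then show ?thesis
    unfolding splits_strongly_def normal_subgroup_lattice_bottom normal_subgroup_lattice_top
      normal_split_def
    by (simp add: normal_subgroup_lattice_def lless_def Bex_def) blast
qed

lemma mem_adjoin_one_iff:
  assumes "u \<in> carrier G"
  shows "x \<in> normal.adjoin {\<one>} G u \<longleftrightarrow> (\<exists>i::int. x = u [^] i)"
proof -
  interpret one: normal "{\<one>}" G by (rule one_is_normal)
  have "x \<otimes> inv (u [^] i) = \<one> \<longleftrightarrow> x = u [^] i" if "x \<in> carrier G" for i :: int
    using assms that by (metis int_pow_closed inv_closed inv_equality inv_inv r_inv)
  then show ?thesis using assms unfolding one.adjoin_def by auto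
qed

lemma adjoin_one_normal:
  assumes "u \<in> carrier G" "\<And>g. g \<in> carrier G \<Longrightarrow> u \<otimes> g = g \<otimes> u"
  shows "normal.adjoin {\<one>} G u \<lhd> G"
proof -
  interpret one: normal "{\<one>}" G by (rule one_is_normal)
  show ?thesis
    by (rule one.adjoin_normal) (use assms in \<open>simp_all add: m_assoc mult_inv_cancel\<close>)
qed

text \<open>If the lattice does not split strongly, a splitting pair is a pair of complements, the lower
  one being a central subgroup of prime order. The other one has no \<open>p\<close>-torsion, since the
  product of central elements of order \<open>p\<close> of both would generate a normal subgroup
  contradicting the splitting. Hence a power map is the projection.\<close>

lemma split_complement_projection:
  assumes fin: "finite (carrier G)" and nil: "nilpotent G"
    and no_strong: "\<nexists>\<mu> \<delta>. normal_split \<mu> \<delta> \<and> \<mu> \<subseteq> \<delta>" and split: "normal_split \<mu> \<delta>"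
  obtains p u N where "Factorial_Ring.prime (p::nat)" "u \<in> carrier G" "u \<noteq> \<one>" "u [^] p = \<one>"
    "\<And>x y. x \<in> carrier G \<Longrightarrow> y \<in> carrier G \<Longrightarrow> (x \<otimes> y) [^] N = x [^] N \<otimes> y [^] (N::nat)"
    "\<And>x. x \<in> carrier G \<Longrightarrow> \<exists>i::int. x [^] N = u [^] i" "u [^] N = u"
    "\<And>x. x \<in> \<mu> \<Longrightarrow> x [^] N = x"
proof -
  have \<mu>: "\<mu> \<lhd> G" "\<mu> \<noteq> {\<one>}" and \<delta>: "\<delta> \<lhd> G" "\<delta> \<noteq> carrier G"
    and all: "\<And>\<alpha>. \<alpha> \<lhd> G \<Longrightarrow> \<alpha> \<subseteq> \<delta> \<or> \<mu> \<subseteq> \<alpha>"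
    using split unfolding normal_split_def by blast+
  interpret \<mu>: normal \<mu> G by (rule \<mu>)
  interpret \<delta>: normal \<delta> G by (rule \<delta>)
  \<comment> \<open>A nontrivial intersection would form a strong splitting with
    \<open>\<delta>\<close>. Dually, a proper product of both would form one with
    \<open>\<mu>\<close>.\<close>
  have inter: "\<mu> \<inter> \<delta> = {\<one>}"
  proof (rule ccontr)
    assume "\<mu> \<inter> \<delta> \<noteq> {\<one>}"
    then have "normal_split (\<mu> \<inter> \<delta>) \<delta>"
      unfolding normal_split_def using \<delta> all normal_subgroup_intersect[OF \<mu>(1) \<delta>(1)] by blast
    then show False using no_strong by blast
  qed
  have prod: "\<mu> <#> \<delta> = carrier G"
  proof (rule ccontr)
    assume ne: "\<mu> <#> \<delta> \<noteq> carrier G"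
    have prodI: "m \<otimes> d \<in> \<mu> <#> \<delta>" if "m \<in> \<mu>" "d \<in> \<delta>" for m d
      unfolding set_mult_def by (intro UN_I[OF that(1)] UN_I[OF that(2)] singletonI)
    have \<delta>_sub: "\<delta> \<subseteq> \<mu> <#> \<delta>"
      using prodI[OF \<mu>.one_closed] \<delta>.mem_carrier by auto
    have \<mu>_sub: "\<mu> \<subseteq> \<mu> <#> \<delta>"
      using prodI[OF _ \<delta>.one_closed] \<mu>.mem_carrier by auto
    have "normal_split \<mu> (\<mu> <#> \<delta>)"
      unfolding normal_split_def using \<mu> ne all \<delta>_sub normal_subgroup_set_mult_closed[OF \<mu>(1) \<delta>(1)]
      by blast
    then show False using no_strong \<mu>_sub by blast
  qed
  obtain m where m: "m \<in> \<mu>" "m \<noteq> \<one>" using \<mu>(2) \<mu>.one_closed by blast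
  obtain p k where p: "Factorial_Ring.prime (p::nat)" and k: "m [^] (k::nat) \<noteq> \<one>" "(m [^] k) [^] p = \<one>"
    by (rule exists_prime_torsion[OF fin \<mu>.mem_carrier[OF m(1)] m(2)])
  have "m [^] k \<in> \<mu>" using pow_coset_closed[OF \<mu>(1) m(1), of "int k"] by (simp add: int_pow_int)
  then obtain u where u: "u \<in> \<mu>" "u \<noteq> \<one>" "u [^] p = \<one>"
    and central: "\<And>g. g \<in> carrier G \<Longrightarrow> u \<otimes> g = g \<otimes> u"
    using nilpotent_central_torsion[OF nil \<mu>(1) _ k] by metis
  have uc: "u \<in> carrier G" using u \<mu>.mem_carrier by blast
  have "\<not> normal.adjoin {\<one>} G u \<subseteq> \<delta>"
  proof
    assume "normal.adjoin {\<one>} G u \<subseteq> \<delta>"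
    moreover have "u = u [^] (1::int)" using uc by simp
    ultimately have "u \<in> \<delta>" using mem_adjoin_one_iff[OF uc] by blast
    then show False using inter u by blast
  qed
  \<comment> \<open>The powers of \<open>u\<close> form a normal subgroup that is not below
    \<open>\<delta>\<close>, so it lies above \<open>\<mu>\<close>.\<close>
  then have \<mu>_cyclic: "\<exists>i::int. x = u [^] i" if "x \<in> \<mu>" for x
    using all[OF adjoin_one_normal[OF uc central]] mem_adjoin_one_iff[OF uc] that by blast
  have \<mu>_central: "x \<otimes> g = g \<otimes> x" if x: "x \<in> \<mu>" and g: "g \<in> carrier G" for x g
    using \<mu>_cyclic[OF x] int_pow_commutes[OF uc g central[OF g]] by auto
  have free: "x = \<one>" if x: "x \<in> \<delta>" "x [^] p = \<one>" for x
  proof (rule ccontr)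
    assume "x \<noteq> \<one>"
    then obtain z where z: "z \<in> \<delta>" "z \<noteq> \<one>" "z [^] p = \<one>"
      and zcentral: "\<And>g. g \<in> carrier G \<Longrightarrow> z \<otimes> g = g \<otimes> z"
      using nilpotent_central_torsion[OF nil \<delta>(1) x(1) _ x(2)] by metis
    have zc: "z \<in> carrier G" using z \<delta>.mem_carrier by blast
    let ?w = "u \<otimes> z"
    have wc: "?w \<in> carrier G" using uc zc by simp
    have "?w \<otimes> g = g \<otimes> ?w" if g: "g \<in> carrier G" for g
    proof -
      have "?w \<otimes> g = u \<otimes> g \<otimes> z" using zcentral[OF g] g uc zc by (simp add: m_assoc)
      then show ?thesis using central[OF g] g uc zc by (simp add: m_assoc)
    qed
    then have "normal.adjoin {\<one>} G ?w \<lhd> G" using adjoin_one_normal[OF wc] by blast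
    then consider "normal.adjoin {\<one>} G ?w \<subseteq> \<delta>" | "\<mu> \<subseteq> normal.adjoin {\<one>} G ?w" using all by blast
    then show False
    proof cases
      case 1
      have "?w = ?w [^] (1::int)" using wc by simp
      then have "?w \<in> \<delta>" using 1 mem_adjoin_one_iff[OF wc] by blast
      then have "?w \<otimes> inv z \<in> \<delta>" using z by simp
      then have "u \<in> \<delta>" using uc zc by (simp add: m_assoc)
      then show False using inter u by blast
    next
      case 2
      then obtain i :: int where "u = ?w [^] i" using mem_adjoin_one_iff[OF wc] u by blast
      \<comment> \<open>Solved for \<open>z [^] i\<close>, this puts it into both
        \<open>\<mu>\<close> and \<open>\<delta>\<close>, so it is trivial and \<open>p\<close>
        divides \<open>i\<close>. Then \<open>u [^] i\<close> is trivial too, and so is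
        \<open>u\<close>.\<close>
      then have ui: "u = u [^] i \<otimes> z [^] i" using int_pow_mult_distrib[OF central uc zc] zc by simp
      then have "z [^] i = inv (u [^] i) \<otimes> u"
        using uc zc by (metis int_pow_closed inv_solve_left)
      then have "z [^] i \<in> \<mu>" using u pow_coset_closed[OF \<mu>(1) u(1), of i] by simp
      then have zi: "z [^] i = \<one>" using inter pow_coset_closed[OF \<delta>(1) z(1)] by blast
      then have "z [^] i = z [^] (0::int)" by simp
      then have "[i = 0] (mod int p)" using int_pow_eq_prime[OF zc z(2,3) p] by blast
      then have "u [^] i = \<one>" using int_pow_cong[OF uc u(3), of i 0] by simp
      then show False using ui zi u by simp
    qed
  qed
  have \<delta>_fin: "finite \<delta>" using \<delta>.subset fin finite_subset by blast
  \<comment> \<open>\<open>N0\<close> annihilates \<open>\<delta>\<close> and is prime to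
    \<open>p\<close>. Multiplied by its inverse \<open>N1\<close> modulo \<open>p\<close>, it is an
    exponent that acts as 0 on \<open>\<delta>\<close> and as 1 on \<open>\<mu>\<close>.\<close>
  define N0 where "N0 = (\<Prod>d\<in>\<delta>. ord d)"
  have N0: "d [^] N0 = \<one>" if "d \<in> \<delta>" for d
    using pow_eq_id[OF \<delta>.mem_carrier[OF that]] that \<delta>_fin unfolding N0_def by (simp add: dvd_prodI)
  have "coprime (ord d) p" if d: "d \<in> \<delta>" for d
  proof (rule ccontr)
    assume "\<not> coprime (ord d) p"
    then have dvd: "p dvd ord d" using p by (metis coprime_commute prime_imp_coprime)
    have dc: "d \<in> carrier G" using d \<delta>.mem_carrier by blast
    obtain k where k: "ord d = p * k" using dvd by blast
    have "d [^] k \<in> \<delta>" using pow_coset_closed[OF \<delta>(1) d, of "int k"] by (simp add: int_pow_int)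
    moreover have "(d [^] k) [^] p = \<one>"
      using pow_ord_eq_1[OF dc] dc by (simp add: nat_pow_pow k mult.commute)
    ultimately have "d [^] k = \<one>" by (rule free)
    then have "p * k dvd k" using pow_eq_id[OF dc] k by simp
    moreover have "0 < ord d" using ord_ge_1[OF fin dc] by simp
    ultimately show False using k p prime_gt_1_nat by (auto dest!: dvd_imp_le)
  qed
  then have "coprime N0 p" unfolding N0_def by (intro prod_coprime_left)
  then obtain N1 where N1: "[N0 * N1 = 1] (mod p)" using cong_solve_coprime_nat by force
  define N where "N = N0 * N1"
  have u_pow: "(u [^] (i::int)) [^] N = u [^] i" for i
  proof -
    have "[int N * i = 1 * i] (mod int p)"
      using N1 unfolding N_def by (intro cong_scalar_right) (metis cong_int_iff of_nat_1)
    then have "u [^] (i * int N) = u [^] i" by (intro int_pow_cong[OF uc u(3)]) (simp add: mult.commute)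
    then show ?thesis using int_pow_pow[OF uc, of i "int N"] by (simp add: int_pow_int)
  qed
  have \<mu>_pow: "x [^] N = x" if "x \<in> \<mu>" for x using \<mu>_cyclic[OF that] u_pow by auto
  have decomp: "\<exists>m\<in>\<mu>. \<exists>d\<in>\<delta>. x = m \<otimes> d" if "x \<in> carrier G" for x
    using that prod unfolding set_mult_def by blast
  have proj: "(m \<otimes> d) [^] N = m" if m: "m \<in> \<mu>" and d: "d \<in> \<delta>" for m d
  proof -
    have c: "m \<in> carrier G" "d \<in> carrier G" using m d \<mu>.mem_carrier \<delta>.mem_carrier by auto
    have "(m \<otimes> d) [^] N = m [^] N \<otimes> d [^] N" by (rule pow_mult_distrib[OF \<mu>_central[OF m c(2)] c])
    also have "d [^] N = \<one>" using N0[OF d] nat_pow_pow[OF c(2), of N0 N1] unfolding N_def by simp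
    finally show ?thesis using \<mu>_pow[OF m] c by simp
  qed
  show thesis
  proof (rule that[OF p uc u(2,3)])
    fix x y assume "x \<in> carrier G" "y \<in> carrier G"
    then obtain m d m' d' where x: "m \<in> \<mu>" "d \<in> \<delta>" "x = m \<otimes> d" and y: "m' \<in> \<mu>" "d' \<in> \<delta>" "y = m' \<otimes> d'"
      using decomp by meson
    have c: "m \<in> carrier G" "d \<in> carrier G" "m' \<in> carrier G" "d' \<in> carrier G"
      using x y \<mu>.mem_carrier \<delta>.mem_carrier by auto
    have "x \<otimes> y = m \<otimes> (d \<otimes> m') \<otimes> d'" using x y c by (simp add: m_assoc)
    also have "d \<otimes> m' = m' \<otimes> d" using \<mu>_central[OF y(1) c(2)] by simp
    also have "m \<otimes> (m' \<otimes> d) \<otimes> d' = (m \<otimes> m') \<otimes> (d \<otimes> d')" using c by (simp add: m_assoc)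
    finally have "(x \<otimes> y) [^] N = m \<otimes> m'" using proj[of "m \<otimes> m'" "d \<otimes> d'"] x y by simp
    then show "(x \<otimes> y) [^] N = x [^] N \<otimes> y [^] N" using x y proj by simp
  next
    fix x assume "x \<in> carrier G"
    then obtain m d where "m \<in> \<mu>" "d \<in> \<delta>" "x = m \<otimes> d" using decomp by meson
    then show "\<exists>i::int. x [^] N = u [^] i" using proj \<mu>_cyclic by auto
  next
    show "u [^] N = u" using \<mu>_pow u by blast
  qed (rule \<mu>_pow)
qed

end

section \<open>Transfer of operations on a direct factor of prime order\<close>

lemma (in cp_clone) Op_int_pow: "Op n f \<Longrightarrow> Op n (\<lambda>xs. f xs [^] (k::int))"
  using Op_nat_pow[of n f] Op_inv[OF Op_nat_pow[of n f]] by (cases "k < 0") (simp_all add: int_pow_def2 del: pow_nat)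

lemma (in cp_clone) Op_int_pow_sum:
  assumes "finite B" "1 \<le> n" "u \<in> carrier G" "\<And>b. b \<in> B \<Longrightarrow> Op n (\<lambda>xs. u [^] (t b xs :: int))"
  shows "Op n (\<lambda>xs. u [^] (\<Sum>b\<in>B. t b xs))"
  using assms(1,4)
proof (induction B rule: finite_induct)
  case empty
  then show ?case using Op_const[OF assms(2) one_closed] by simp
next
  case (insert b B)
  then have "Op n (\<lambda>xs. u [^] t b xs \<otimes> u [^] (\<Sum>b\<in>B. t b xs))" by (intro Op_mult) auto
  then show ?case using insert assms(3) by (simp add: int_pow_mult)
qed

context group
begin

text \<open>A nontrivial absorbing function with values in a direct factor of order \<open>p\<close> yields, together
  with the group operation, all functions on this factor; so two clones with the same binary
  functions agree on them.\<close>

lemma absorbing_projection_transfer: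
  assumes fin: "finite (carrier G)" and C: "cp_clone G C" and C': "cp_clone G C'"
    and binary: "\<And>f. clone_op (carrier G) C 2 f \<Longrightarrow> clone_op (carrier G) C' 2 f"
    and p: "Factorial_Ring.prime (p::nat)" and u: "u \<in> carrier G" "u \<noteq> \<one>" "u [^] p = \<one>"
    and hom: "\<And>x y. x \<in> carrier G \<Longrightarrow> y \<in> carrier G \<Longrightarrow> (x \<otimes> y) [^] N = x [^] N \<otimes> y [^] (N::nat)"
    and range: "\<And>x. x \<in> carrier G \<Longrightarrow> \<exists>i::int. x [^] N = u [^] i" and uN: "u [^] N = u"
    and F: "clone_op (carrier G) C n F" "absorbing n F" and n: "2 \<le> n"
  shows "clone_op (carrier G) C' n (\<lambda>xs. F xs [^] N)"
proof -
  interpret C: cp_clone G C by (rule C)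
  interpret C': cp_clone G C' by (rule C')
  note cong_u = int_pow_cong[OF u(1,3)]
  \<comment> \<open>The discrete logarithm of the projection to base \<open>u\<close>. It is
    determined only modulo \<open>p\<close>, so everything about it is stated as a
    congruence.\<close>
  define ell where "ell x = (SOME i::int. x [^] N = u [^] i)" for x
  have ell: "x [^] N = u [^] ell x" if "x \<in> carrier G" for x
    unfolding ell_def by (rule someI_ex[OF range[OF that]])
  have u_pow: "(u [^] (i::int)) [^] N = u [^] i" for i
  proof -
    have "(u [^] i) [^] N = u [^] (i * int N)" using int_pow_pow[OF u(1), of i "int N"] by (simp add: int_pow_int)
    also have "\<dots> = (u [^] N) [^] i" using int_pow_pow[OF u(1), of "int N" i] by (simp add: int_pow_int mult.commute)
    finally show ?thesis by (simp add: uN)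
  qed
  have idem: "(x [^] N) [^] N = x [^] N" if "x \<in> carrier G" for x using ell[OF that] u_pow by simp
  have ell_u: "[ell (u [^] i) = i] (mod int p)" for i :: int
    using ell[of "u [^] i"] u_pow[of i] u(1) int_pow_eq_prime[OF u p, of i] by (simp add: cong_sym)
  have ell_pow: "[ell (x [^] N) = ell x] (mod int p)" if "x \<in> carrier G" for x
    using ell_u[of "ell x"] ell[OF that] by simp
  have ell_mult: "[ell (u \<otimes> x) = ell x + 1] (mod int p)" if x: "x \<in> carrier G" for x
  proof -
    have "(u \<otimes> x) [^] N = u [^] (1::int) \<otimes> u [^] ell x" using hom[OF u(1) x] ell[OF x] uN u(1) by simp
    then have "u [^] ell (u \<otimes> x) = u [^] (ell x + 1)"
      using ell[of "u \<otimes> x"] x u(1) by (simp add: int_pow_mult add.commute)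
    then show ?thesis using int_pow_eq_prime[OF u p] by blast
  qed
  have ell_one: "[ell \<one> = 0] (mod int p)" using ell_u[of 0] by simp

  define K where "K = {x \<in> carrier G. x [^] N = \<one>}"
  have inv_pow: "inv x [^] N = inv (x [^] N)" if "x \<in> carrier G" for x using nat_pow_inv[OF that] .
  have K_normal: "K \<lhd> G"
  proof (rule normal_invI)
    show "subgroup K G" unfolding K_def
      by (rule subgroup.intro) (auto simp: hom inv_pow)
    fix x h assume "x \<in> carrier G" "h \<in> K"
    then show "x \<otimes> h \<otimes> inv x \<in> K" unfolding K_def by (simp add: hom inv_pow)
  qed
  \<comment> \<open>\<open>K\<close> is the kernel of the projection. An argument and its projection
    agree modulo \<open>K\<close>, hence so do the values of \<open>F\<close>.\<close>
  have proj_args: "F xs [^] N = F (map (\<lambda>x. x [^] N) xs) [^] N" if xs: "xs \<in> nlists n (carrier G)" for xs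
  proof -
    let ?ys = "map (\<lambda>x. x [^] N) xs"
    have ys: "?ys \<in> nlists n (carrier G)"
      using xs unfolding nlists_def by auto
    have "F xs \<otimes> inv (F ?ys) \<in> K"
    proof (rule C.Op_compatible[OF F(1) K_normal xs ys])
      fix i assume i: "i < n"
      then have "xs ! i \<in> carrier G" using nlistsE_nth_in[OF xs] by blast
      then show "xs ! i \<otimes> inv (?ys ! i) \<in> K"
        using i nlists_length[OF xs] unfolding K_def by (simp add: hom inv_pow idem)
    qed
    then have "F xs [^] N \<otimes> inv (F ?ys [^] N) = \<one>"
      using C.Op_closed[OF F(1) xs] C.Op_closed[OF F(1) ys] unfolding K_def by (simp add: hom inv_pow)
    then show ?thesis
      using C.Op_closed[OF F(1) xs] C.Op_closed[OF F(1) ys] by (metis inv_equality inv_inv inv_closed nat_pow_closed)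
  qed

  show ?thesis
  proof (cases "\<forall>xs\<in>nlists n (carrier G). F xs [^] N = \<one>")
    case True
    then show ?thesis using C'.Op_const[of n \<one>] n by (auto elim!: clone_op_cong)
  next
    case False
    then obtain bs where bs: "bs \<in> nlists n (carrier G)" "F bs [^] N \<noteq> \<one>" by blast
    define as where "as = map (\<lambda>x. x [^] N) bs"
    have as: "as \<in> nlists n (carrier G)" using bs(1) unfolding nlists_def as_def by auto
    have asF: "F as [^] N \<noteq> \<one>" using proj_args[OF bs(1)] bs(2) unfolding as_def by simp
    \<comment> \<open>All arguments but the first two are frozen at a point where \<open>F\<close>
      survives the projection; \<open>g\<close> still absorbs both remaining variables and is not
      trivial after projection.\<close>
    define g where "g x y = F (as[0 := x, 1 := y])" for x y
    have upd: "as[0 := x, 1 := y] \<in> nlists n (carrier G)" if "x \<in> carrier G" "y \<in> carrier G" for x y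
      using as that by (intro nlists_update_in_list)
    have g_closed: "g x y \<in> carrier G" if "x \<in> carrier G" "y \<in> carrier G" for x y
      unfolding g_def by (rule C.Op_closed[OF F(1) upd[OF that]])
    define s where "s x y = ell (g (u [^] x) (u [^] y))" for x y :: int
    \<comment> \<open>The functions of exponents that are well defined modulo \<open>p\<close> and
      realized by \<open>C'\<close>. Differences of such functions are again realized, as
      \<open>product_from_absorbing\<close> requires.\<close>
    define S where "S = {s. C'.Op 2 (\<lambda>xs. u [^] (s (ell (xs ! 0)) (ell (xs ! 1)) :: int))
      \<and> (\<forall>x x' y y'. [x = x'] (mod int p) \<longrightarrow> [y = y'] (mod int p) \<longrightarrow> [s x y = s x' y'] (mod int p))}"
    have SI: "s \<in> S" if "C'.Op 2 (\<lambda>xs. u [^] (s (ell (xs ! 0)) (ell (xs ! 1)) :: int))"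
        "\<And>x x' y y'. [x = x'] (mod int p) \<Longrightarrow> [y = y'] (mod int p) \<Longrightarrow> [s x y = s x' y'] (mod int p)" for s
      using that unfolding S_def by blast
    have SD: "C'.Op 2 (\<lambda>xs. u [^] (s (ell (xs ! 0)) (ell (xs ! 1)) :: int))" if "s \<in> S" for s
      using that unfolding S_def by blast
    have SC: "[s x y = s x' y'] (mod int p)" if "s \<in> S" "[x = x'] (mod int p)" "[y = y'] (mod int p)" for s x x' y y'
      using that unfolding S_def by blast
    have mem2: "xs ! 0 \<in> carrier G" "xs ! 1 \<in> carrier G" "length xs = 2" if "xs \<in> nlists 2 (carrier G)" for xs
      using nlistsE_nth_in[OF that] nlists_length[OF that] by simp_all
    have arg: "C'.Op 2 (\<lambda>xs. u [^] (s (ell (a xs)) (ell (b xs)) :: int))"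
      if s: "s \<in> S" and a: "C'.Op 2 a" and b: "C'.Op 2 b" for s a b
    proof -
      have "C'.Op 2 (\<lambda>xs. (\<lambda>xs. u [^] (s (ell (xs ! 0)) (ell (xs ! 1)) :: int))
          (map (\<lambda>i. (if i = 0 then a else b) xs) [0..<2]))"
        by (rule C'.Op_compose[OF SD[OF s]]) (use a b in simp)
      then show ?thesis by simp
    qed
    have "s \<in> S"
    proof (rule SI)
      let ?h = "\<lambda>i xs. if i = 0 then xs ! 0 [^] N else if i = 1 then xs ! 1 [^] N else as ! i"
      have "C.Op 2 (\<lambda>xs. F (map (\<lambda>i. ?h i xs) [0..<n]))"
      proof (rule C.Op_compose[OF F(1)])
        fix i assume "i < n"
        then have "as ! i \<in> carrier G" using nlistsE_nth_in[OF as] by blast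
        then show "C.Op 2 (?h i)"
          using C.Op_nat_pow[OF C.Op_nth[of 0 2]] C.Op_nat_pow[OF C.Op_nth[of 1 2]] C.Op_const[of 2]
            by (cases "i = 0"; cases "i = 1") simp_all
      qed
      then have "C.Op 2 (\<lambda>xs. F (map (\<lambda>i. ?h i xs) [0..<n]) [^] N)" by (rule C.Op_nat_pow)
      then have "C'.Op 2 (\<lambda>xs. F (map (\<lambda>i. ?h i xs) [0..<n]) [^] N)" by (rule binary)
      then show "C'.Op 2 (\<lambda>xs. u [^] (s (ell (xs ! 0)) (ell (xs ! 1)) :: int))"
      proof (rule clone_op_cong)
        fix xs assume xs: "xs \<in> nlists 2 (carrier G)"
        have "map (\<lambda>i. ?h i xs) [0..<n] = as[0 := xs ! 0 [^] N, 1 := xs ! 1 [^] N]"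
          using n nlists_length[OF as] by (intro nth_equalityI) (auto simp: nth_list_update)
        then have "F (map (\<lambda>i. ?h i xs) [0..<n]) = g (xs ! 0 [^] N) (xs ! 1 [^] N)"
          unfolding g_def by simp
        also have "\<dots> = g (u [^] ell (xs ! 0)) (u [^] ell (xs ! 1))" using ell mem2[OF xs] by simp
        finally show "F (map (\<lambda>i. ?h i xs) [0..<n]) [^] N = u [^] s (ell (xs ! 0)) (ell (xs ! 1))"
          unfolding s_def using ell[OF g_closed] u(1) by simp
      qed
      fix x x' y y' assume "[x = x'] (mod int p)" "[y = y'] (mod int p)"
      then have "u [^] x = u [^] x'" "u [^] y = u [^] y'" by (simp_all only: cong_u)
      then show "[s x y = s x' y'] (mod int p)" unfolding s_def by simp
    qed
    have g_one: "g \<one> y = \<one>" "g y \<one> = \<one>" if "y \<in> carrier G" for y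
      unfolding g_def
      using n nlists_length[OF as]
      by (intro absorbingD[OF F(2) upd, of _ _ 0] absorbingD[OF F(2) upd, of _ _ 1]; simp add: that)+
    have abs: "[s 0 y = 0] (mod int p)" "[s y 0 = 0] (mod int p)" for y
      using g_one[of "u [^] y"] ell_one u(1) unfolding s_def by simp_all
    have nz: "\<not> int p dvd s (ell (as ! 0)) (ell (as ! 1))"
    proof
      assume "int p dvd s (ell (as ! 0)) (ell (as ! 1))"
      then have "u [^] s (ell (as ! 0)) (ell (as ! 1)) = u [^] (0::int)"
        by (intro cong_u) (simp add: cong_0_iff)
      moreover have "u [^] ell (as ! i) = as ! i" if "i < n" for i
      proof -
        have "bs ! i \<in> carrier G" "as ! i = bs ! i [^] N"
          using that nlistsE_nth_in[OF bs(1)] nlists_length[OF bs(1)] unfolding as_def by auto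
        then show ?thesis using ell[of "as ! i"] idem by simp
      qed
      ultimately have "u [^] ell (g (as ! 0) (as ! 1)) = \<one>" using n unfolding s_def by simp
      moreover have "g (as ! 0) (as ! 1) = F as" unfolding g_def by simp
      ultimately show False using ell[OF C.Op_closed[OF F(1) as]] asF by simp
    qed
    have nth2: "C'.Op 2 (\<lambda>xs. xs ! 0)" "C'.Op 2 (\<lambda>xs. xs ! 1)" by (simp_all add: C'.Op_nth)
    have const2: "C'.Op 2 (\<lambda>_. a)" if "a \<in> carrier G" for a using C'.Op_const[of 2 a] that by simp
    obtain t where t: "t \<in> S" and prod: "\<And>x y. [t x y = x * y] (mod int p)"
    proof (rule product_from_absorbing[of p S s, OF p _ _ _ _ _ _ _ _ \<open>s \<in> S\<close> abs nz])
      fix s t assume st: "s \<in> S" "t \<in> S"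
      show "(\<lambda>x y. s x y - t x y) \<in> S"
      proof (rule SI)
        show "C'.Op 2 (\<lambda>xs. u [^] (s (ell (xs ! 0)) (ell (xs ! 1)) - t (ell (xs ! 0)) (ell (xs ! 1))))"
          unfolding int_pow_diff[OF u(1)] by (intro C'.Op_mult C'.Op_inv SD st)
      qed (intro cong_diff SC[OF st(1)] SC[OF st(2)])
    next
      fix s and c :: int assume s: "s \<in> S"
      show "(\<lambda>x y. c * s x y) \<in> S"
      proof (rule SI)
        show "C'.Op 2 (\<lambda>xs. u [^] (c * s (ell (xs ! 0)) (ell (xs ! 1))))"
          using C'.Op_int_pow[OF SD[OF s], of c] int_pow_pow[OF u(1)] by (simp add: mult.commute)
      qed (intro cong_scalar_left SC[OF s])
    next
      fix s assume s: "s \<in> S"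
      show "(\<lambda>x y. s (x + 1) y) \<in> S"
      proof (rule SI)
        have "C'.Op 2 (\<lambda>xs. u [^] s (ell (u \<otimes> xs ! 0)) (ell (xs ! 1)))"
          by (intro arg s C'.Op_mult const2 nth2 u)
        then show "C'.Op 2 (\<lambda>xs. u [^] s (ell (xs ! 0) + 1) (ell (xs ! 1)))"
          by (rule clone_op_cong) (intro cong_u SC[OF s] ell_mult cong_refl mem2)
      qed (intro SC[OF s] cong_add cong_refl)
      show "(\<lambda>x y. s x (y + 1)) \<in> S"
      proof (rule SI)
        have "C'.Op 2 (\<lambda>xs. u [^] s (ell (xs ! 0)) (ell (u \<otimes> xs ! 1)))"
          by (intro arg s C'.Op_mult const2 nth2 u)
        then show "C'.Op 2 (\<lambda>xs. u [^] s (ell (xs ! 0)) (ell (xs ! 1) + 1))"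
          by (rule clone_op_cong) (intro cong_u SC[OF s] ell_mult cong_refl mem2)
      qed (intro SC[OF s] cong_add cong_refl)
      show "(\<lambda>x y. s 0 y) \<in> S"
      proof (rule SI)
        have "C'.Op 2 (\<lambda>xs. u [^] s (ell \<one>) (ell (xs ! 1)))" by (intro arg s const2 nth2 one_closed)
        then show "C'.Op 2 (\<lambda>xs. u [^] s 0 (ell (xs ! 1)))"
          by (rule clone_op_cong) (intro cong_u SC[OF s] ell_one cong_refl)
      qed (intro SC[OF s] cong_refl)
      show "(\<lambda>x y. s x 0) \<in> S"
      proof (rule SI)
        have "C'.Op 2 (\<lambda>xs. u [^] s (ell (xs ! 0)) (ell \<one>))" by (intro arg s const2 nth2 one_closed)
        then show "C'.Op 2 (\<lambda>xs. u [^] s (ell (xs ! 0)) 0)"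
          by (rule clone_op_cong) (intro cong_u SC[OF s] ell_one cong_refl)
      qed (intro SC[OF s] cong_refl)
      fix x y
      show "[s (x + int p) y = s x y] (mod int p)" "[s x (y + int p) = s x y] (mod int p)"
        by (intro SC[OF s]; simp add: cong_def)+
    qed blast
    have mult: "C'.Op n (\<lambda>xs. u [^] (\<sigma> xs * \<tau> xs :: int))"
      if "C'.Op n (\<lambda>xs. u [^] (\<sigma> xs :: int))" "C'.Op n (\<lambda>xs. u [^] (\<tau> xs :: int))" for \<sigma> \<tau>
    proof -
      have "C'.Op n (\<lambda>xs. (\<lambda>xs. u [^] (t (ell (xs ! 0)) (ell (xs ! 1)) :: int))
          (map (\<lambda>i. (if i = 0 then (\<lambda>xs. u [^] \<sigma> xs) else (\<lambda>xs. u [^] \<tau> xs)) xs) [0..<2]))"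
        by (rule C'.Op_compose[OF SD[OF t]]) (use that in simp)
      then show ?thesis
      proof (rule clone_op_cong)
        fix xs
        have "[t (ell (u [^] \<sigma> xs)) (ell (u [^] \<tau> xs)) = \<sigma> xs * \<tau> xs] (mod int p)"
          using SC[OF t ell_u ell_u] prod cong_trans by blast
        then show "(\<lambda>xs. u [^] (t (ell (xs ! 0)) (ell (xs ! 1)) :: int))
          (map (\<lambda>i. (if i = 0 then (\<lambda>xs. u [^] \<sigma> xs) else (\<lambda>xs. u [^] \<tau> xs)) xs) [0..<2])
          = u [^] (\<sigma> xs * \<tau> xs)" using cong_u by simp
      qed
    qed
    have const: "C'.Op n (\<lambda>_. u [^] (c::int))" for c using C'.Op_const n u(1) by simp
    have pow: "C'.Op n (\<lambda>xs. u [^] (\<sigma> xs ^ k :: int))" if "C'.Op n (\<lambda>xs. u [^] (\<sigma> xs :: int))" for \<sigma> k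
      by (induction k) (use const[of 1] mult[OF that] in simp_all)
    have diff: "C'.Op n (\<lambda>xs. u [^] (\<sigma> xs - \<tau> xs :: int))"
      if "C'.Op n (\<lambda>xs. u [^] (\<sigma> xs :: int))" "C'.Op n (\<lambda>xs. u [^] (\<tau> xs :: int))" for \<sigma> \<tau>
      unfolding int_pow_diff[OF u(1)] by (intro C'.Op_mult C'.Op_inv that)
    have prod: "C'.Op n (\<lambda>xs. u [^] (\<Prod>i<k. \<sigma> i xs :: int))"
      if "\<And>i. i < k \<Longrightarrow> C'.Op n (\<lambda>xs. u [^] (\<sigma> i xs :: int))" for \<sigma> and k :: nat
      using that by (induction k) (use const[of 1] mult in simp_all)
    have coord: "C'.Op n (\<lambda>xs. u [^] ell (xs ! i))" if i: "i < n" for i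
      by (rule clone_op_cong[OF C'.Op_nat_pow[OF C'.Op_nth[OF i]], of N])
        (use ell nlistsE_nth_in i in metis)
    define B where "B = nlists n ((\<lambda>x. x [^] N) ` carrier G)"
    \<comment> \<open>By Fermat's theorem, for \<open>b\<close> in \<open>B\<close>,
      \<open>e b xs\<close> is 1 modulo \<open>p\<close> if the projection of \<open>xs\<close> is
      \<open>b\<close> and 0 otherwise. The sum below is the interpolation of \<open>F\<close> on
      the direct factor.\<close>
    define e where "e b xs = (\<Prod>i<n. 1 - (ell (xs ! i) - ell (b ! i)) ^ (p - 1))" for b xs
    have "finite B"
      unfolding B_def nlists_def using finite_lists_length_eq[of "(\<lambda>x. x [^] N) ` carrier G" n] fin
      by (simp add: conj_commute)
    then have "C'.Op n (\<lambda>xs. u [^] (\<Sum>b\<in>B. ell (F b) * e b xs))"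
      unfolding e_def using n
      by (intro C'.Op_int_pow_sum mult const prod diff pow coord u) auto
    then show ?thesis
    proof (rule clone_op_cong)
      fix xs assume xs: "xs \<in> nlists n (carrier G)"
      let ?b = "map (\<lambda>x. x [^] N) xs"
      have len: "length xs = n" by (rule nlists_length[OF xs])
      have xi: "xs ! i \<in> carrier G" if "i < n" for i by (rule nlistsE_nth_in[OF xs that])
      have b: "?b \<in> B" using xs unfolding B_def nlists_def by auto
      have zero_pow: "(0::int) ^ (p - 1) = 0" using prime_gt_1_nat[OF p] by (simp add: power_0_left)
      have e1: "[e ?b xs = 1] (mod int p)"
      proof -
        have "[1 - (ell (xs ! i) - ell (?b ! i)) ^ (p - 1) = 1] (mod int p)" if i: "i < n" for i
        proof -
          have "[ell (xs ! i) - ell (?b ! i) = ell (xs ! i) - ell (xs ! i)] (mod int p)"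
            using ell_pow[OF xi[OF i]] i len by (intro cong_diff cong_refl) simp
          then have "[(ell (xs ! i) - ell (?b ! i)) ^ (p - 1) = 0 ^ (p - 1)] (mod int p)"
            by (intro cong_pow) simp
          then have "[1 - (ell (xs ! i) - ell (?b ! i)) ^ (p - 1) = 1 - 0 ^ (p - 1)] (mod int p)"
            by (intro cong_diff cong_refl)
          then show ?thesis by (simp only: zero_pow diff_0_right)
        qed
        then have "[e ?b xs = (\<Prod>i<n. 1)] (mod int p)" unfolding e_def by (intro cong_prod) simp
        then show ?thesis by simp
      qed
      have e0: "[e b xs = 0] (mod int p)" if bB: "b \<in> B" "b \<noteq> ?b" for b
      proof -
        have bl: "length b = n" using bB(1) nlists_length unfolding B_def by blast
        then obtain i where i: "i < n" "b ! i \<noteq> ?b ! i" using bB(2) len nth_equalityI[of b ?b] by auto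
        obtain y where y: "y \<in> carrier G" "b ! i = y [^] N"
          using nlistsE_nth_in[of b n] i bB(1) unfolding B_def by blast
        have "\<not> [ell (xs ! i) = ell (b ! i)] (mod int p)"
        proof
          assume "[ell (xs ! i) = ell (b ! i)] (mod int p)"
          then have "u [^] ell (xs ! i) = u [^] ell (b ! i)" by (rule cong_u)
          then have "xs ! i [^] N = b ! i" using ell[OF xi[OF i(1)]] ell[of "b ! i"] y idem by simp
          then show False using i len by simp
        qed
        then have "\<not> int p dvd ell (xs ! i) - ell (b ! i)" by (simp add: cong_iff_dvd_diff)
        then have "[1 - (ell (xs ! i) - ell (b ! i)) ^ (p - 1) = 1 - 1] (mod int p)"
          by (intro cong_diff cong_refl fermat_int[OF p])
        then have "int p dvd 1 - (ell (xs ! i) - ell (b ! i)) ^ (p - 1)" by (simp add: cong_0_iff)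
        also have "\<dots> dvd e b xs" unfolding e_def using i(1) by (intro dvd_prodI) auto
        finally show ?thesis by (simp add: cong_0_iff)
      qed
      have "[(\<Sum>b\<in>B. ell (F b) * e b xs) = (\<Sum>b\<in>B. if b = ?b then ell (F b) else 0)] (mod int p)"
      proof (rule cong_sum)
        fix b assume "b \<in> B"
        then show "[ell (F b) * e b xs = (if b = ?b then ell (F b) else 0)] (mod int p)"
          using cong_scalar_left[OF e1, of "ell (F b)"] cong_scalar_left[OF e0, of b "ell (F b)"] by auto
      qed
      also have "(\<Sum>b\<in>B. if b = ?b then ell (F b) else 0) = ell (F ?b)" using b \<open>finite B\<close> by simp
      finally have "u [^] (\<Sum>b\<in>B. ell (F b) * e b xs) = u [^] ell (F ?b)" by (rule cong_u)
      also have "\<dots> = F ?b [^] N"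
        by (rule ell[symmetric], rule C.Op_closed[OF F(1)]) (use xs in \<open>auto simp: nlists_def\<close>)
      also have "\<dots> = F xs [^] N" using proj_args[OF xs] by simp
      finally show "u [^] (\<Sum>b\<in>B. ell (F b) * e b xs) = F xs [^] N" .
    qed
  qed
qed

section \<open>Clones are determined by their operations of bounded arity\<close>

lemma cp_clone_iff:
  "cp_clone G C \<longleftrightarrow> clone (carrier G) C \<and> Pol (carrier G) (group_operations G) \<subseteq> C
    \<and> C \<subseteq> Comp (carrier G) (group_operations G)"
  by (simp add: cp_clone_def cp_clone_axioms_def is_group)

text \<open>For an absorbing operation of large arity, the components in the direct factors split
  off by splitting pairs lie in \<open>C'\<close> by the transfer. Dividing them out leaves an
  operation with values in the common kernel \<open>D\<close> of the projections. No nontrivial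
  normal subgroup inside \<open>D\<close> is the lower end of a splitting pair, so what remains is
  trivial.\<close>

lemma cp_clone_subset_if_bounded_arity:
  assumes fin: "finite (carrier G)" and nil: "nilpotent G"
    and no_strong: "\<nexists>\<mu> \<delta>. normal_split \<mu> \<delta> \<and> \<mu> \<subseteq> \<delta>"
    and C: "cp_clone G C" and C': "cp_clone G C'"
    and base: "\<And>n f. n \<le> card (carrier G) + 2 \<Longrightarrow> clone_op (carrier G) C n f \<Longrightarrow> clone_op (carrier G) C' n f"
    and f: "clone_op (carrier G) C n f"
  shows "clone_op (carrier G) C' n f"
proof (rule clone_op_subset_by_absorbing[OF C C' _ base _ f])
  fix n F
  assume n: "card (carrier G) + 2 < n" and F: "clone_op (carrier G) C n F" and absF: "absorbing n F"
  interpret C: cp_clone G C by (rule C)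
  interpret C': cp_clone G C' by (rule C')
  define Sp where "Sp = {\<mu>. \<exists>\<delta>. normal_split \<mu> \<delta>}"
  have "Sp \<subseteq> Pow (carrier G)"
    unfolding Sp_def normal_split_def using normal_imp_subgroup subgroup.subset by blast
  then have fin_Sp: "finite Sp" using fin finite_subset by blast
  define good where "good \<mu> N \<longleftrightarrow>
    (\<forall>x\<in>carrier G. \<forall>y\<in>carrier G. (x \<otimes> y) [^] N = x [^] N \<otimes> y [^] N) \<and>
    (\<forall>x\<in>carrier G. (x [^] N) [^] N = x [^] N) \<and> (\<forall>x\<in>\<mu>. x [^] N = x) \<and>
    (\<forall>F. C.Op n F \<longrightarrow> absorbing n F \<longrightarrow> C'.Op n (\<lambda>xs. F xs [^] N))" for \<mu> and N :: nat
  have "\<exists>N. good \<mu> N" if \<mu>: "\<mu> \<in> Sp" for \<mu>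
  proof -
    obtain \<delta> where split: "normal_split \<mu> \<delta>" using \<mu> unfolding Sp_def by blast
    show ?thesis
    proof (rule split_complement_projection[OF fin nil no_strong split])
      fix p :: nat and u and N :: nat
      assume p: "Factorial_Ring.prime p" and u: "u \<in> carrier G" "u \<noteq> \<one>" "u [^] p = \<one>"
        and hom: "\<And>x y. x \<in> carrier G \<Longrightarrow> y \<in> carrier G \<Longrightarrow> (x \<otimes> y) [^] N = x [^] N \<otimes> y [^] N"
        and range: "\<And>x. x \<in> carrier G \<Longrightarrow> \<exists>i::int. x [^] N = u [^] i" and uN: "u [^] N = u"
        and id: "\<And>x. x \<in> \<mu> \<Longrightarrow> x [^] N = x"
      have "(x [^] N) [^] N = x [^] N" if x: "x \<in> carrier G" for x
      proof -
        obtain i :: int where i: "x [^] N = u [^] i" using range[OF x] by blast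
        have "(u [^] i) [^] int N = (u [^] int N) [^] i"
          using int_pow_pow[OF u(1)] by (simp add: mult.commute)
        then show ?thesis using i uN by (simp add: int_pow_int)
      qed
      moreover have "C'.Op n (\<lambda>xs. F xs [^] N)" if "C.Op n F" "absorbing n F" for F
        by (rule absorbing_projection_transfer[OF fin C C' base p u hom range uN that]) (use n in simp_all)
      ultimately have "good \<mu> N" unfolding good_def using hom id by simp
      then show "\<exists>N. good \<mu> N" by blast
    qed
  qed
  then obtain N where N: "\<And>\<mu>. \<mu> \<in> Sp \<Longrightarrow> good \<mu> (N \<mu>)" by metis
  have N_hom: "(x \<otimes> y) [^] N \<mu> = x [^] N \<mu> \<otimes> y [^] N \<mu>"
    if "\<mu> \<in> Sp" "x \<in> carrier G" "y \<in> carrier G" for \<mu> x y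
    using N[OF that(1)] that(2,3) unfolding good_def by blast
  have N_idem: "(x [^] N \<mu>) [^] N \<mu> = x [^] N \<mu>" if "\<mu> \<in> Sp" "x \<in> carrier G" for \<mu> x
    using N[OF that(1)] that(2) unfolding good_def by blast
  have N_id: "x [^] N \<mu> = x" if "\<mu> \<in> Sp" "x \<in> \<mu>" for \<mu> x
    using N[OF that(1)] that(2) unfolding good_def by blast
  have N_op: "C'.Op n (\<lambda>xs. F xs [^] N \<mu>)" if "\<mu> \<in> Sp" "C.Op n F" "absorbing n F" for \<mu> F
    using N[OF that(1)] that(2,3) unfolding good_def by blast
  \<comment> \<open>The projections are power maps and hence commute, so dividing out one component
    does not bring back a component that was removed earlier.\<close>
  have reduce: "\<exists>F'. C.Op n F' \<and> absorbing n F' \<and> (C'.Op n F' \<longrightarrow> C'.Op n F)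
      \<and> (\<forall>\<mu>\<in>I. \<forall>xs\<in>nlists n (carrier G). F' xs [^] N \<mu> = \<one>)" if "finite I" "I \<subseteq> Sp" for I
    using that
  proof (induction I rule: finite_induct)
    case empty
    then show ?case using F absF by blast
  next
    case (insert \<nu> I)
    then have \<nu>: "\<nu> \<in> Sp" by simp
    obtain F' where F': "C.Op n F'" "absorbing n F'" "C'.Op n F' \<longrightarrow> C'.Op n F"
      and kill: "\<And>\<mu> xs. \<mu> \<in> I \<Longrightarrow> xs \<in> nlists n (carrier G) \<Longrightarrow> F' xs [^] N \<mu> = \<one>"
      using insert by auto
    let ?F = "\<lambda>xs. F' xs \<otimes> inv (F' xs [^] N \<nu>)"
    have closed: "F' xs \<in> carrier G" if "xs \<in> nlists n (carrier G)" for xs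
      by (rule C.Op_closed[OF F'(1) that])
    have "C.Op n ?F" by (intro C.Op_mult C.Op_inv C.Op_nat_pow F'(1))
    moreover have "absorbing n ?F" using F'(2) unfolding absorbing_def by simp
    moreover have "C'.Op n F'" if "C'.Op n ?F"
    proof (rule clone_op_cong[OF C'.Op_mult[OF that N_op[OF \<nu> F'(1,2)]]])
      fix xs assume "xs \<in> nlists n (carrier G)"
      then show "?F xs \<otimes> F' xs [^] N \<nu> = F' xs" using closed by (simp add: m_assoc)
    qed
    moreover have "?F xs [^] N \<mu> = \<one>" if \<mu>: "\<mu> \<in> insert \<nu> I" and xs: "xs \<in> nlists n (carrier G)" for \<mu> xs
    proof -
      have "\<mu> \<in> Sp" using \<mu> insert by auto
      then have eq: "?F xs [^] N \<mu> = F' xs [^] N \<mu> \<otimes> inv ((F' xs [^] N \<nu>) [^] N \<mu>)"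
        using closed[OF xs] by (simp add: N_hom nat_pow_inv)
      show ?thesis
      proof (cases "\<mu> = \<nu>")
        case True
        then show ?thesis using eq closed[OF xs] N_idem[OF \<nu>] by simp
      next
        case False
        have "(F' xs [^] N \<nu>) [^] N \<mu> = (F' xs [^] N \<mu>) [^] N \<nu>"
          using closed[OF xs] by (simp add: nat_pow_pow mult.commute)
        then show ?thesis using eq kill[of \<mu>, OF _ xs] False \<mu> by simp
      qed
    qed
    ultimately show ?case using F'(3) by (intro exI[of _ ?F]) blast
  qed
  from reduce[OF fin_Sp subset_refl]
  obtain F' where F': "C.Op n F'" "absorbing n F'" "C'.Op n F' \<longrightarrow> C'.Op n F"
    and kill: "\<forall>\<mu>\<in>Sp. \<forall>xs\<in>nlists n (carrier G). F' xs [^] N \<mu> = \<one>"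
    by (elim exE conjE)
  define D where "D = {x \<in> carrier G. \<forall>\<mu>\<in>Sp. x [^] N \<mu> = \<one>}"
  have D: "D \<lhd> G"
  proof (rule normal_invI)
    show "subgroup D G" unfolding D_def by (rule subgroup.intro) (auto simp: N_hom nat_pow_inv)
    fix x h assume "x \<in> carrier G" "h \<in> D"
    then show "x \<otimes> h \<otimes> inv x \<in> D" unfolding D_def by (simp add: N_hom nat_pow_inv)
  qed
  have "F' xs = \<one>" if xs: "xs \<in> nlists n (carrier G)" for xs
  proof (rule C.absorbing_trivial[OF fin D _ _ F'(1,2) _ xs])
    show "card (carrier G) \<le> n" using n by simp
    show "F' ys \<in> D" if "ys \<in> nlists n (carrier G)" for ys
      unfolding D_def using kill that C.Op_closed[OF F'(1) that] by simp
    fix \<mu> H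
    assume \<mu>: "\<mu> \<lhd> G" "\<mu> \<noteq> {\<one>}" "\<mu> \<subseteq> D" and H: "subgroup H G"
      and below: "\<And>\<gamma>. \<gamma> \<lhd> G \<Longrightarrow> \<not> \<mu> \<subseteq> \<gamma> \<Longrightarrow> \<gamma> \<subseteq> H"
    show "H = carrier G"
    proof (rule ccontr)
      assume neq: "H \<noteq> carrier G"
      \<comment> \<open>If the join of these subgroups were proper, it would be the upper end of a
        splitting pair for \<open>\<mu>\<close>. Then the power map for \<open>\<mu>\<close> would
        fix \<open>\<mu>\<close> pointwise, yet annihilate it as a part of \<open>D\<close>.\<close>
      let ?U = "\<Union>{\<gamma>. \<gamma> \<lhd> G \<and> \<not> \<mu> \<subseteq> \<gamma>}"
      have U: "?U \<subseteq> carrier G" using normal_imp_subgroup subgroup.subset by blast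
      have "generate G ?U \<lhd> G"
      proof (rule normal_generateI[OF U])
        fix h g assume "h \<in> ?U" and g: "g \<in> carrier G"
        then obtain \<gamma> where "\<gamma> \<lhd> G" "\<not> \<mu> \<subseteq> \<gamma>" "h \<in> \<gamma>" by blast
        then show "g \<otimes> h \<otimes> inv g \<in> ?U" using normal_invE(2)[of \<gamma> g h] g by blast
      qed
      moreover have "generate G ?U \<subseteq> H"
        using below by (intro generate_subgroup_incl[OF _ H]) blast
      then have "generate G ?U \<noteq> carrier G" using neq subgroup.subset[OF H] by blast
      moreover have "\<alpha> \<subseteq> generate G ?U \<or> \<mu> \<subseteq> \<alpha>" if "\<alpha> \<lhd> G" for \<alpha>
        using that generate.incl[of _ ?U G] by blast
      ultimately have "\<mu> \<in> Sp" unfolding Sp_def normal_split_def using \<mu>(1,2) by blast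
      then have "x = \<one>" if "x \<in> \<mu>" for x
        using N_id[OF _ that] that \<mu>(3) unfolding D_def by auto
      then show False using \<mu>(2) subgroup.one_closed[OF normal_imp_subgroup[OF \<mu>(1)]] by blast
    qed
  qed
  then have "C'.Op n F'"
    using C'.Op_const[of n \<one>] n by (auto elim!: clone_op_cong)
  then show "C'.Op n F" using F'(3) by blast
qed simp_all

text \<open>The part of a clone of arity at most \<open>card (carrier G) + 2\<close> determines the
  clone, and a finite group admits only finitely many such parts.\<close>

lemma finitely_many_expansions:
  assumes fin: "finite (carrier G)" and nil: "nilpotent G"
    and no_strong: "\<nexists>\<mu> \<delta>. normal_split \<mu> \<delta> \<and> \<mu> \<subseteq> \<delta>"
  shows "finite {C. cp_clone G C}"
proof -
  let ?k = "card (carrier G) + 2"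
  define low where "low C = {q \<in> C. fst q \<le> ?k}" for C :: "'a operation set"
  have ext: "restrict f (nlists n (carrier G)) = f" if "cp_clone G C" "(n, f) \<in> C" for C n f
  proof -
    have "(n, f) \<in> operations (carrier G)" using that clone_subset cp_clone_iff by blast
    then show ?thesis by (auto simp: operations_def PiE_restrict)
  qed
  have sub: "C \<subseteq> C'" if C: "cp_clone G C" and C': "cp_clone G C'" and low: "low C = low C'" for C C'
  proof
    fix q assume q: "q \<in> C"
    obtain n f where nf: "q = (n, f)" by force
    have "clone_op (carrier G) C' n f"
    proof (rule cp_clone_subset_if_bounded_arity[OF fin nil no_strong C C'])
      show "clone_op (carrier G) C n f" using q nf ext[OF C] unfolding clone_op_def by simp
      fix m g assume "m \<le> ?k" "clone_op (carrier G) C m g"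
      then have "(m, restrict g (nlists m (carrier G))) \<in> low C" unfolding low_def clone_op_def by simp
      then have "(m, restrict g (nlists m (carrier G))) \<in> low C'" using low by simp
      then show "clone_op (carrier G) C' m g" unfolding low_def clone_op_def by simp
    qed
    then show "q \<in> C'" using q nf ext[OF C] unfolding clone_op_def by simp
  qed
  have "inj_on low {C. cp_clone G C}" by (rule inj_onI) (use sub in blast)
  moreover have "low ` {C. cp_clone G C} \<subseteq> Pow (SIGMA n:{..?k}. nlists n (carrier G) \<rightarrow>\<^sub>E carrier G)"
    unfolding low_def cp_clone_iff using clone_subset[of "carrier G"] by (fastforce simp: operations_def)
  moreover have "finite (nlists n (carrier G))" for n
    using finite_lists_length_eq[OF fin, of n] unfolding nlists_def by (simp add: conj_commute)
  then have "finite (Pow (SIGMA n:{..?k}. nlists n (carrier G) \<rightarrow>\<^sub>E carrier G))"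
    using fin by (intro finite_Pow_iff[THEN iffD2] finite_SigmaI finite_PiE) simp_all
  ultimately show ?thesis by (rule inj_on_finite)
qed

end

section \<open>Degrees of integer functions on cubes and on groups\<close>

text \<open>The functions on a cube that are modulo \<open>p\<close> given by a multilinear polynomial of degree
  less than \<open>M\<close>.\<close>

definition cube_degree :: "nat \<Rightarrow> nat \<Rightarrow> (nat set \<Rightarrow> int) \<Rightarrow> bool" where
  "cube_degree p M F \<longleftrightarrow> (\<forall>A B. finite A \<longrightarrow> A \<inter> B = {} \<longrightarrow> M \<le> card A
     \<longrightarrow> int p dvd (\<Sum>S\<in>Pow A. (- 1) ^ card S * F (S \<union> B)))"

lemma cube_degreeD:
  "cube_degree p M F \<Longrightarrow> finite A \<Longrightarrow> A \<inter> B = {} \<Longrightarrow> M \<le> card A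
    \<Longrightarrow> int p dvd (\<Sum>S\<in>Pow A. (- 1) ^ card S * F (S \<union> B))"
  unfolding cube_degree_def by simp

lemma alternating_sum_insert:
  fixes g :: "nat set \<Rightarrow> int"
  assumes "finite A" "i \<notin> A"
  shows "(\<Sum>S\<in>Pow (insert i A). (- 1) ^ card S * g S) = (\<Sum>S\<in>Pow A. (- 1) ^ card S * (g S - g (insert i S)))"
proof -
  have "inj_on (insert i) (Pow A)" using assms(2) by (auto simp: inj_on_def)
  moreover have "card (insert i S) = Suc (card S)" if "S \<in> Pow A" for S
    using that assms by (meson PowD card_insert_disjoint finite_subset subset_iff)
  ultimately have "(\<Sum>S\<in>insert i ` Pow A. (- 1) ^ card S * g S) = (\<Sum>S\<in>Pow A. - ((- 1) ^ card S * g (insert i S)))"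
    by (simp add: sum.reindex)
  moreover have "Pow A \<inter> insert i ` Pow A = {}" using assms(2) by blast
  ultimately have "(\<Sum>S\<in>Pow (insert i A). (- 1) ^ card S * g S)
      = (\<Sum>S\<in>Pow A. (- 1) ^ card S * g S) + (\<Sum>S\<in>Pow A. - ((- 1) ^ card S * g (insert i S)))"
    using assms(1) by (simp add: Pow_insert sum.union_disjoint)
  then show ?thesis by (simp add: sum_subtractf sum_negf right_diff_distrib)
qed

lemma cube_degree_cong:
  assumes "cube_degree p M F" "\<And>S. [F S = H S] (mod int p)"
  shows "cube_degree p M H"
  unfolding cube_degree_def
proof (intro allI impI)
  fix A B :: "nat set" assume "finite A" "A \<inter> B = {}" "M \<le> card A"
  then have "int p dvd (\<Sum>S\<in>Pow A. (- 1) ^ card S * F (S \<union> B))" using assms(1) unfolding cube_degree_def by blast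
  moreover have "[(\<Sum>S\<in>Pow A. (- 1) ^ card S * F (S \<union> B)) = (\<Sum>S\<in>Pow A. (- 1) ^ card S * H (S \<union> B))] (mod int p)"
    by (intro cong_sum cong_scalar_left assms(2))
  ultimately show "int p dvd (\<Sum>S\<in>Pow A. (- 1) ^ card S * H (S \<union> B))" using cong_dvd_iff by blast
qed

lemma cube_degree_dvd: "(\<And>S. int p dvd F S) \<Longrightarrow> cube_degree p M F"
  unfolding cube_degree_def by (intro allI impI dvd_sum dvd_mult) simp

lemma cube_degree_mono: "cube_degree p M F \<Longrightarrow> M \<le> M' \<Longrightarrow> cube_degree p M' F"
  unfolding cube_degree_def by (meson order_trans)

lemma cube_degree_const: "cube_degree p (Suc 0) (\<lambda>_. c)"
  unfolding cube_degree_def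
proof (intro allI impI)
  fix A B :: "nat set" assume A: "finite A" "Suc 0 \<le> card A"
  then obtain i where "i \<in> A" by force
  then have "A = insert i (A - {i})" by blast
  then have "(\<Sum>S\<in>Pow A. (- 1) ^ card S * c) = 0"
    using alternating_sum_insert[of "A - {i}" i "\<lambda>_. c"] A by simp
  then show "int p dvd (\<Sum>S\<in>Pow A. (- 1) ^ card S * c)" by simp
qed

lemma cube_degree_add:
  "cube_degree p M F \<Longrightarrow> cube_degree p M H \<Longrightarrow> cube_degree p M (\<lambda>S. F S + H S)"
  unfolding cube_degree_def by (simp add: distrib_left sum.distrib)

lemma cube_degree_scale:
  assumes "cube_degree p M F"
  shows "cube_degree p M (\<lambda>S. c * F S)"
proof -
  have "(\<Sum>S\<in>Pow A. (- 1) ^ card S * (c * F (S \<union> B))) = c * (\<Sum>S\<in>Pow A. (- 1) ^ card S * F (S \<union> B))"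
    for A B :: "nat set"
    by (simp add: sum_distrib_left mult.left_commute)
  then show ?thesis using assms unfolding cube_degree_def by simp
qed

text \<open>On a face with direction \<open>i\<close> only the facet where \<open>i\<close> is
  present contributes, which costs one dimension. On a face where \<open>i\<close> is fixed, the sum
  is that of \<open>F\<close> or zero.\<close>

lemma cube_degree_coordinate:
  assumes "cube_degree p M F"
  shows "cube_degree p (Suc M) (\<lambda>S. if i \<in> S then F S else 0)"
  unfolding cube_degree_def
proof (intro allI impI)
  fix A B :: "nat set" assume A: "finite A" "A \<inter> B = {}" "Suc M \<le> card A"
  let ?H = "\<lambda>S. if i \<in> S then F S else 0"
  consider "i \<in> B" | "i \<in> A" | "i \<notin> A \<union> B" by blast
  then show "int p dvd (\<Sum>S\<in>Pow A. (- 1) ^ card S * ?H (S \<union> B))"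
  proof cases
    case 1
    then show ?thesis using assms A unfolding cube_degree_def by simp
  next
    case 2
    let ?A = "A - {i}"
    have iB: "i \<notin> B" using 2 A by blast
    have "A = insert i ?A" using 2 by blast
    then have "(\<Sum>S\<in>Pow A. (- 1) ^ card S * ?H (S \<union> B))
        = (\<Sum>S\<in>Pow ?A. (- 1) ^ card S * (?H (S \<union> B) - ?H (insert i S \<union> B)))"
      using alternating_sum_insert[of ?A i "\<lambda>S. ?H (S \<union> B)"] A by simp
    also have "\<dots> = (\<Sum>S\<in>Pow ?A. - ((- 1) ^ card S * F (S \<union> insert i B)))"
      by (rule sum.cong) (use iB in auto)
    also have "\<dots> = - (\<Sum>S\<in>Pow ?A. (- 1) ^ card S * F (S \<union> insert i B))" by (rule sum_negf)
    finally have eq: "(\<Sum>S\<in>Pow A. (- 1) ^ card S * ?H (S \<union> B))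
        = - (\<Sum>S\<in>Pow ?A. (- 1) ^ card S * F (S \<union> insert i B))" .
    have "finite ?A" "?A \<inter> insert i B = {}" "M \<le> card ?A" using A 2 by auto
    then show ?thesis unfolding eq dvd_minus_iff by (rule cube_degreeD[OF assms])
  next
    case 3
    then have "(\<Sum>S\<in>Pow A. (- 1) ^ card S * ?H (S \<union> B)) = 0" by (intro sum.neutral) auto
    then show ?thesis by simp
  qed
qed

text \<open>The counterpart of \<open>cube_degree\<close> on a group: degree less than
  \<open>M\<close> in the sense of Frechet, by vanishing of \<open>M\<close> successive differences
  along left translations.\<close>

primrec fun_degree :: "('a, 'b) monoid_scheme \<Rightarrow> nat \<Rightarrow> nat \<Rightarrow> ('a \<Rightarrow> int) \<Rightarrow> bool" where
  "fun_degree G p 0 \<phi> \<longleftrightarrow> (\<forall>x\<in>carrier G. int p dvd \<phi> x)"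
| "fun_degree G p (Suc M) \<phi> \<longleftrightarrow> (\<forall>g\<in>carrier G. fun_degree G p M (\<lambda>x. \<phi> (g \<otimes>\<^bsub>G\<^esub> x) - \<phi> x))"

context group
begin

lemma fun_degree_cong:
  assumes "fun_degree G p M \<phi>" "\<And>x. x \<in> carrier G \<Longrightarrow> [\<phi> x = \<psi> x] (mod int p)"
  shows "fun_degree G p M \<psi>"
  using assms
proof (induction M arbitrary: \<phi> \<psi>)
  case 0
  then show ?case using cong_dvd_iff by (metis fun_degree.simps(1))
next
  case (Suc M)
  have "fun_degree G p M (\<lambda>x. \<psi> (g \<otimes> x) - \<psi> x)" if g: "g \<in> carrier G" for g
    by (rule Suc.IH[of "\<lambda>x. \<phi> (g \<otimes> x) - \<phi> x"]) (use Suc.prems g in \<open>auto intro!: cong_diff\<close>)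
  then show ?case by simp
qed

definition left_invariant :: "nat \<Rightarrow> 'a set \<Rightarrow> ('a \<Rightarrow> int) \<Rightarrow> bool" where
  "left_invariant p K \<phi> \<longleftrightarrow> (\<forall>k\<in>K. \<forall>x\<in>carrier G. [\<phi> (k \<otimes> x) = \<phi> x] (mod int p))"

lemma left_invariantD:
  "left_invariant p K \<phi> \<Longrightarrow> k \<in> K \<Longrightarrow> x \<in> carrier G \<Longrightarrow> [\<phi> (k \<otimes> x) = \<phi> x] (mod int p)"
  unfolding left_invariant_def by blast

text \<open>If \<open>z\<close> is central modulo \<open>K\<close>, then translation by \<open>z\<close> commutes with all translations of
  \<open>K\<close>-invariant functions, and differencing \<open>p\<close> times along \<open>z\<close> annihilates them when
  \<open>z [^] p\<close> lies in \<open>K\<close>. Hence a bound for the functions invariant under the larger subgroup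
  \<open>adjoin z\<close> yields one for those invariant under \<open>K\<close>.\<close>

lemma fun_degree_adjoin:
  assumes K: "K \<lhd> G" and p: "Factorial_Ring.prime (p::nat)" and z: "z \<in> carrier G" "z [^] p \<in> K"
    and central: "\<And>g. g \<in> carrier G \<Longrightarrow> z \<otimes> g \<otimes> inv z \<otimes> inv g \<in> K"
    and M: "\<And>\<phi>. left_invariant p (normal.adjoin K G z) \<phi> \<Longrightarrow> fun_degree G p M \<phi>"
    and \<phi>: "left_invariant p K \<phi>"
  shows "fun_degree G p (p * M) \<phi>"
proof -
  interpret K: normal K G by (rule K)
  have shift: "[\<psi> (g \<otimes> (k \<otimes> x)) = \<psi> (g \<otimes> x)] (mod int p)"
    if \<psi>: "left_invariant p K \<psi>" and g: "g \<in> carrier G" and k: "k \<in> K" and x: "x \<in> carrier G" for \<psi> g k x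
  proof -
    have kc: "k \<in> carrier G" using k K.mem_carrier by blast
    have "g \<otimes> (k \<otimes> x) = (g \<otimes> k \<otimes> inv g) \<otimes> (g \<otimes> x)" using g kc x by (simp add: m_assoc inv_mult_cancel)
    then show ?thesis using left_invariantD[OF \<psi> K.inv_op_closed2[OF g k], of "g \<otimes> x"] g x by simp
  qed
  have inv_diff: "left_invariant p K (\<lambda>x. \<psi> (g \<otimes> x) - \<psi> x)"
    if \<psi>: "left_invariant p K \<psi>" and g: "g \<in> carrier G" for \<psi> g
    unfolding left_invariant_def by (intro ballI cong_diff shift[OF \<psi> g] left_invariantD[OF \<psi>])
  have inv_adjoin: "left_invariant p (K.adjoin z) \<psi>"
    if \<psi>: "left_invariant p K \<psi>" and zinv: "\<And>x. x \<in> carrier G \<Longrightarrow> [\<psi> (z \<otimes> x) = \<psi> x] (mod int p)" for \<psi>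
    unfolding left_invariant_def
  proof (intro ballI)
    fix k x assume k: "k \<in> K.adjoin z" and x: "x \<in> carrier G"
    then obtain i :: int where kc: "k \<in> carrier G" and ki: "k \<otimes> inv (z [^] i) \<in> K"
      unfolding K.adjoin_def by blast
    have "[\<psi> (z [^] i \<otimes> x) = \<psi> (z [^] (0::int) \<otimes> x)] (mod int p)" for i :: int
    proof (rule cong_const_of_succ)
      fix i :: int
      have "z [^] (i + 1) \<otimes> x = z \<otimes> (z [^] i \<otimes> x)"
        using z x by (simp add: add.commute[of i] int_pow_mult m_assoc)
      then show "[\<psi> (z [^] (i + 1) \<otimes> x) = \<psi> (z [^] i \<otimes> x)] (mod int p)"
        using zinv[of "z [^] i \<otimes> x"] z x by simp
    qed
    then have "[\<psi> (z [^] i \<otimes> x) = \<psi> x] (mod int p)" using x by simp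
    moreover have "k \<otimes> x = (k \<otimes> inv (z [^] i)) \<otimes> (z [^] i \<otimes> x)"
      using kc x z by (simp add: m_assoc inv_mult_cancel)
    then have "[\<psi> (k \<otimes> x) = \<psi> (z [^] i \<otimes> x)] (mod int p)"
      using left_invariantD[OF \<psi> ki, of "z [^] i \<otimes> x"] z x by simp
    ultimately show "[\<psi> (k \<otimes> x) = \<psi> x] (mod int p)" using cong_trans by blast
  qed
  define dz where "dz \<psi> x = \<psi> (z \<otimes> x) - \<psi> x" for \<psi> :: "'a \<Rightarrow> int" and x
  \<comment> \<open>Modulo \<open>K\<close> the difference along \<open>z\<close> commutes with all
    others. After \<open>D\<close> differences the function is therefore invariant under
    \<open>z\<close>, hence under \<open>K.adjoin z\<close>, and \<open>M\<close> further ones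
    suffice.\<close>
  have add_degree: "fun_degree G p (D + M) \<psi>"
    if "left_invariant p K \<psi>" "fun_degree G p D (dz \<psi>)" for D \<psi>
    using that
  proof (induction D arbitrary: \<psi>)
    case 0
    then have "[\<psi> (z \<otimes> x) = \<psi> x] (mod int p)" if "x \<in> carrier G" for x
      using that by (simp add: dz_def cong_iff_dvd_diff)
    then show ?case using M inv_adjoin 0 by simp
  next
    case (Suc D)
    have "fun_degree G p (D + M) (\<lambda>x. \<psi> (g \<otimes> x) - \<psi> x)" if g: "g \<in> carrier G" for g
    proof (rule Suc.IH[OF inv_diff[OF Suc.prems(1) g]])
      have "fun_degree G p D (\<lambda>x. dz \<psi> (g \<otimes> x) - dz \<psi> x)" using Suc.prems(2) g by simp
      then show "fun_degree G p D (dz (\<lambda>x. \<psi> (g \<otimes> x) - \<psi> x))"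
      proof (rule fun_degree_cong)
        fix x assume x: "x \<in> carrier G"
        have "z \<otimes> (g \<otimes> x) = (z \<otimes> g \<otimes> inv z \<otimes> inv g) \<otimes> (g \<otimes> (z \<otimes> x))"
          using g z x by (simp add: m_assoc inv_mult_cancel)
        then have "[\<psi> (z \<otimes> (g \<otimes> x)) = \<psi> (g \<otimes> (z \<otimes> x))] (mod int p)"
          using left_invariantD[OF Suc.prems(1) central[OF g], of "g \<otimes> (z \<otimes> x)"] g z x by simp
        then show "[dz \<psi> (g \<otimes> x) - dz \<psi> x = dz (\<lambda>x. \<psi> (g \<otimes> x) - \<psi> x) x] (mod int p)"
          unfolding dz_def by (simp add: cong_iff_dvd_diff algebra_simps)
      qed
    qed
    then show ?case by simp
  qed
  \<comment> \<open>Each difference along \<open>z\<close> costs \<open>M\<close>. Since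
    \<open>z [^] p\<close> lies in \<open>K\<close>, the translates along \<open>z\<close> have
    period \<open>p\<close>, so \<open>p\<close> differences annihilate and the bound is
    \<open>p * M\<close>.\<close>
  have nilp: "fun_degree G p (j * M) \<psi>"
    if "left_invariant p K \<psi>" "\<And>x. x \<in> carrier G \<Longrightarrow> int p dvd (dz ^^ j) \<psi> x" for j \<psi>
    using that
  proof (induction j arbitrary: \<psi>)
    case 0
    then show ?case by simp
  next
    case (Suc j)
    have "fun_degree G p (j * M) (dz \<psi>)"
    proof (rule Suc.IH)
      show "left_invariant p K (dz \<psi>)" using inv_diff[OF Suc.prems(1) z(1)] unfolding dz_def[abs_def] .
      show "int p dvd (dz ^^ j) (dz \<psi>) x" if "x \<in> carrier G" for x
        using Suc.prems(2)[OF that] by (simp add: funpow_Suc_right del: funpow.simps)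
    qed
    then show ?case using add_degree[OF Suc.prems(1), of "j * M"] by (simp add: add.commute)
  qed
  have dz_fdiff: "(dz ^^ j) \<phi> (z [^] k \<otimes> x) = (fdiff ^^ j) (\<lambda>k. \<phi> (z [^] k \<otimes> x)) k"
    if x: "x \<in> carrier G" for j x and k :: nat
  proof (induction j arbitrary: k)
    case (Suc j)
    have "z \<otimes> (z [^] k \<otimes> x) = z [^] Suc k \<otimes> x"
      unfolding nat_pow_Suc2[OF z(1)] using z x by (simp only: m_assoc nat_pow_closed)
    then show ?case using Suc[of k] Suc[of "Suc k"] by (simp add: dz_def fdiff_def del: nat_pow_Suc local.nat_pow_Suc)
  qed simp
  show ?thesis
  proof (rule nilp[OF \<phi>])
    fix x assume x: "x \<in> carrier G"
    have "int p dvd (fdiff ^^ p) (\<lambda>k. \<phi> (z [^] k \<otimes> x)) 0"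
    proof (rule fdiff_prime_period[OF p])
      fix k :: nat
      have "z [^] (k + p) \<otimes> x = z [^] p \<otimes> (z [^] k \<otimes> x)"
        using z x by (simp add: add.commute[of k] m_assoc flip: nat_pow_mult)
      then show "[\<phi> (z [^] (k + p) \<otimes> x) = \<phi> (z [^] k \<otimes> x)] (mod int p)"
        using left_invariantD[OF \<phi> z(2), of "z [^] k \<otimes> x"] z x by simp
    qed
    then show "int p dvd (dz ^^ p) \<phi> x" using dz_fdiff[OF x, of p 0] x by simp
  qed
qed

end

text \<open>The last of the iterated \<open>p\<close>-th powers of an element before they enter
  \<open>H\<close> provides \<open>p\<close>-torsion modulo \<open>H\<close>, which
  \<open>nilpotent_torsion_Mod\<close> replaces by central torsion.\<close>

lemma (in normal) nilpotent_prime_power_Mod: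
  assumes nil: "nilpotent G" and proper: "H \<noteq> carrier G"
    and p_power: "\<And>a. a \<in> carrier G \<Longrightarrow> \<exists>k. a [^] ((p::nat) ^ k) \<in> H"
  obtains z where "z \<in> carrier G" "z \<notin> H" "z [^] p \<in> H"
    "\<And>g. g \<in> carrier G \<Longrightarrow> z \<otimes> g \<otimes> inv z \<otimes> inv g \<in> H"
proof -
  obtain a where a: "a \<in> carrier G" "a \<notin> H" using proper subset by blast
  define k where "k = (LEAST k. a [^] (p ^ k) \<in> H)"
  have k: "a [^] (p ^ k) \<in> H" unfolding k_def by (rule LeastI_ex[OF p_power[OF a(1)]])
  have "k \<noteq> 0"
  proof
    assume "k = 0"
    then show False using k a by simp
  qed
  then obtain j where j: "k = Suc j" using not0_implies_Suc by blast
  let ?b = "a [^] (p ^ j)"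
  have b: "?b \<notin> H" using not_less_Least[of j "\<lambda>k. a [^] (p ^ k) \<in> H"] j unfolding k_def by simp
  have bp: "?b [^] p \<in> H" using k a(1) unfolding j by (simp add: nat_pow_pow mult.commute)
  show thesis
    using nilpotent_torsion_Mod[OF nil nat_pow_closed[OF a(1)] b bp] that by metis
qed

context group
begin

text \<open>Functions invariant under the whole group are constant, so \<open>M = 1\<close> serves
  there; each central extension of \<open>K\<close> gives the bound one step further down. This is
  nilpotency of the augmentation ideal of a finite \<open>p\<close>-group in characteristic
  \<open>p\<close>, in the language of differences.\<close>

lemma fun_degree_bounded:
  assumes fin: "finite (carrier G)" and nil: "nilpotent G" and p: "Factorial_Ring.prime (p::nat)"
    and K: "K \<lhd> G" "\<And>a. a \<in> carrier G \<Longrightarrow> \<exists>k. a [^] (p ^ k) \<in> K"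
  shows "\<exists>M. \<forall>\<phi>. left_invariant p K \<phi> \<longrightarrow> fun_degree G p M \<phi>"
  using K
proof (induction "card (carrier G) - card K" arbitrary: K rule: less_induct)
  case less
  interpret K: normal K G by (rule less.prems)
  show ?case
  proof (cases "K = carrier G")
    case True
    have "fun_degree G p 1 \<phi>" if "left_invariant p K \<phi>" for \<phi>
      using left_invariantD[OF that] True by (simp add: cong_iff_dvd_diff)
    then show ?thesis by blast
  next
    case False
    obtain z where z: "z \<in> carrier G" "z \<notin> K" "z [^] p \<in> K"
      and central: "\<And>g. g \<in> carrier G \<Longrightarrow> z \<otimes> g \<otimes> inv z \<otimes> inv g \<in> K"
      using K.nilpotent_prime_power_Mod[OF nil False less.prems(2)] by metis
    let ?K = "K.adjoin z"
    have K': "?K \<lhd> G" by (rule K.adjoin_normal[OF z(1) central])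
    have sub: "K \<subset> ?K" using K.adjoin_superset[OF z(1)] K.adjoin_self[OF z(1)] z(2) by blast
    have carr: "?K \<subseteq> carrier G" unfolding K.adjoin_def by blast
    have "card K < card ?K" using psubset_card_mono[OF finite_subset[OF carr fin] sub] .
    moreover have "card ?K \<le> card (carrier G)" using card_mono[OF fin carr] .
    ultimately have "card (carrier G) - card ?K < card (carrier G) - card K" by linarith
    moreover have "\<exists>k. a [^] (p ^ k) \<in> ?K" if "a \<in> carrier G" for a
      using less.prems(2)[OF that] sub by blast
    ultimately obtain M where "\<forall>\<phi>. left_invariant p ?K \<phi> \<longrightarrow> fun_degree G p M \<phi>"
      using less.hyps[OF _ K'] by blast
    then have "\<forall>\<phi>. left_invariant p K \<phi> \<longrightarrow> fun_degree G p (p * M) \<phi>"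
      using fun_degree_adjoin[OF less.prems(1) p z(1,3) central] by blast
    then show ?thesis by blast
  qed
qed

section \<open>Cubes in groups\<close>

text \<open>The subgroup, under pointwise multiplication, generated by constants and by single
  edges. Words grow on the left because \<open>fun_degree\<close> takes differences along left
  translations.\<close>

inductive_set cubes :: "(nat set \<Rightarrow> 'a) set" where
  one: "(\<lambda>S. \<one>) \<in> cubes"
| const: "a \<in> carrier G \<Longrightarrow> v \<in> cubes \<Longrightarrow> (\<lambda>S. a \<otimes> v S) \<in> cubes"
| var: "a \<in> carrier G \<Longrightarrow> v \<in> cubes \<Longrightarrow> (\<lambda>S. (if i \<in> S then a else \<one>) \<otimes> v S) \<in> cubes"

lemma cubes_closed: "v \<in> cubes \<Longrightarrow> v S \<in> carrier G"
  by (induction rule: cubes.induct) auto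

lemma cubes_const: "a \<in> carrier G \<Longrightarrow> (\<lambda>S. a) \<in> cubes"
  using cubes.const[OF _ cubes.one, of a] by simp

lemma cubes_var: "a \<in> carrier G \<Longrightarrow> (\<lambda>S. if i \<in> S then a else \<one>) \<in> cubes"
  using cubes.var[OF _ cubes.one, of a i] by (simp add: if_distrib[of "\<lambda>x. x \<otimes> \<one>"] cong: if_cong)

lemma cubes_mult:
  assumes v: "v \<in> cubes" and w: "w \<in> cubes"
  shows "(\<lambda>S. v S \<otimes> w S) \<in> cubes"
  using v
proof (induction rule: cubes.induct)
  case one
  then show ?case using w cubes_closed[OF w] by simp
next
  case (const a v)
  then show ?case
    using cubes.const[OF const(1,3)] cubes_closed[OF w] cubes_closed[OF const(2)] by (simp add: m_assoc)
next
  case (var a v i)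
  then show ?case
    using cubes.var[OF var(1,3), of i] cubes_closed[OF w] cubes_closed[OF var(2)] by (simp add: m_assoc)
qed

lemma cubes_inv:
  assumes v: "v \<in> cubes"
  shows "(\<lambda>S. inv (v S)) \<in> cubes"
  using v
proof (induction rule: cubes.induct)
  case one
  then show ?case using cubes.one by simp
next
  case (const a v)
  then show ?case
    using cubes_mult[OF const(3) cubes_const[of "inv a"]] cubes_closed[OF const(2)]
    by (simp add: inv_mult_group)
next
  case (var a v i)
  have "(\<lambda>S. inv (v S) \<otimes> (if i \<in> S then inv a else \<one>)) \<in> cubes"
    using cubes_mult[OF var(3) cubes_var[of "inv a" i]] var(1) by simp
  moreover have "inv (v S) \<otimes> (if i \<in> S then inv a else \<one>) = inv ((if i \<in> S then a else \<one>) \<otimes> v S)" for S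
    using var(1) cubes_closed[OF var(2)] by (simp add: inv_mult_group)
  ultimately show ?case by simp
qed

text \<open>A factor in front of the word changes \<open>\<phi>\<close> by a difference of lower
  degree; for an edge this difference is multiplied by a coordinate, which raises its degree back by
  one.\<close>

lemma cube_degree_fun_degree:
  assumes "v \<in> cubes" "fun_degree G p M \<phi>"
  shows "cube_degree p M (\<lambda>S. \<phi> (v S))"
  using assms
proof (induction arbitrary: M \<phi> rule: cubes.induct)
  case one
  show ?case
  proof (cases M)
    case 0
    then show ?thesis
      using one by (intro cube_degree_dvd) simp
  next
    case (Suc M')
    then show ?thesis using cube_degree_mono[OF cube_degree_const, of M] by simp
  qed
next
  case (const a v)
  show ?case
  proof (cases M)
    case 0
    then show ?thesis
      using const cubes_closed[OF const(2)] by (intro cube_degree_dvd) simp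
  next
    case (Suc M')
    have "cube_degree p M' (\<lambda>S. \<phi> (a \<otimes> v S) - \<phi> (v S))" 
      using const.IH[of M' "\<lambda>x. \<phi> (a \<otimes> x) - \<phi> x"] const.prems const(1) Suc by simp
    then have "cube_degree p M (\<lambda>S. \<phi> (v S) + (\<phi> (a \<otimes> v S) - \<phi> (v S)))"
      using Suc by (intro cube_degree_add[OF const.IH[OF const.prems]]) (simp add: cube_degree_mono)
    then show ?thesis by simp
  qed
next
  case (var a v i)
  show ?case
  proof (cases M)
    case 0
    then show ?thesis
      using var cubes_closed[OF var(2)] by (intro cube_degree_dvd) simp
  next
    case (Suc M')
    have "cube_degree p M' (\<lambda>S. \<phi> (a \<otimes> v S) - \<phi> (v S))" 
      using var.IH[of M' "\<lambda>x. \<phi> (a \<otimes> x) - \<phi> x"] var.prems var(1) Suc by simp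
    then have "cube_degree p M (\<lambda>S. \<phi> (v S) + (if i \<in> S then \<phi> (a \<otimes> v S) - \<phi> (v S) else 0))"
      using Suc by (intro cube_degree_add[OF var.IH[OF var.prems]]) (simp add: cube_degree_coordinate)
    moreover have "\<phi> (v S) + (if i \<in> S then \<phi> (a \<otimes> v S) - \<phi> (v S) else 0)
        = \<phi> ((if i \<in> S then a else \<one>) \<otimes> v S)" for S
      using cubes_closed[OF var(2)] by simp
    ultimately show ?thesis by simp
  qed
qed

text \<open>Modulo \<open>p\<close>, \<open>\<chi>\<close> turns a word into a sum of constants and
  multiples of coordinates, so it behaves as a polynomial of degree at most one.\<close>

lemma cube_degree_hom_mult:
  assumes v: "v \<in> cubes" and F: "cube_degree p M F"
    and hom: "\<And>x y. x \<in> carrier G \<Longrightarrow> y \<in> carrier G \<Longrightarrow> [\<chi> (x \<otimes> y) = \<chi> x + \<chi> y] (mod int p)"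
  shows "cube_degree p (Suc M) (\<lambda>S. \<chi> (v S) * F S)"
  using v
proof (induction rule: cubes.induct)
  have \<chi>1: "[\<chi> \<one> = 0] (mod int p)"
    using hom[of \<one> \<one>] by (simp add: cong_iff_dvd_diff)
  {
    case one
    show ?case
      by (rule cube_degree_dvd) (use \<chi>1 in \<open>simp add: cong_0_iff\<close>)
  next
    case (const a v)
    have "cube_degree p (Suc M) (\<lambda>S. \<chi> a * F S + \<chi> (v S) * F S)"
      by (intro cube_degree_add const.IH cube_degree_mono[OF cube_degree_scale[OF F]]) simp
    then show ?case
    proof (rule cube_degree_cong)
      fix S
      show "[\<chi> a * F S + \<chi> (v S) * F S = \<chi> (a \<otimes> v S) * F S] (mod int p)"
        using cong_scalar_right[OF cong_sym[OF hom[OF const(1) cubes_closed[OF const(2)]]]]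
        by (simp add: distrib_right)
    qed
  next
    case (var a v i)
    have "cube_degree p (Suc M) (\<lambda>S. (if i \<in> S then \<chi> a * F S else 0) + \<chi> (v S) * F S)"
      by (intro cube_degree_add var.IH cube_degree_coordinate cube_degree_scale F)
    then show ?case
    proof (rule cube_degree_cong)
      fix S
      show "[(if i \<in> S then \<chi> a * F S else 0) + \<chi> (v S) * F S
          = \<chi> ((if i \<in> S then a else \<one>) \<otimes> v S) * F S] (mod int p)"
        using cong_scalar_right[OF cong_sym[OF hom[OF var(1) cubes_closed[OF var(2)]]]]
          cubes_closed[OF var(2)]
        by (simp add: distrib_right)
    qed
  }
qed

end

section \<open>Clones of functions of bounded degree\<close>

lemma clone_Comp: "clone A (Comp A F)"
proof (rule cloneI)
  show "Comp A F \<subseteq> operations A" unfolding Comp_def by blast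
next
  fix n i :: nat assume i: "i < n"
  have "proj_op A n i \<in> operations A" using clone_proj[OF clone_operations i] .
  moreover have "preserves A (proj_op A n i) \<theta>" for \<theta>
    unfolding proj_op_def preserves_def using i by simp
  ultimately show "proj_op A n i \<in> Comp A F" unfolding Comp_def by blast
next
  fix n m f gs
  assume f: "(n, f) \<in> Comp A F" and len: "length gs = n"
    and gs: "\<And>g. g \<in> set gs \<Longrightarrow> (m, g) \<in> Comp A F"
  have fo: "(n, f) \<in> operations A" and go: "\<forall>g\<in>set gs. (m, g) \<in> operations A"
    using f gs unfolding Comp_def by blast+
  have "compose_op A m f gs \<in> operations A"
    by (rule clone_compose[OF clone_operations fo len]) (use go in blast)
  moreover have "preserves A (compose_op A m f gs) \<theta>" if \<theta>: "congruence A F \<theta>" for \<theta>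
    unfolding compose_op_def preserves_def split
  proof (intro ballI impI)
    fix xs ys assume xs: "xs \<in> nlists m A" and ys: "ys \<in> nlists m A"
      and eq: "\<forall>i<m. (xs ! i, ys ! i) \<in> \<theta>"
    have fp: "preserves A (n, f) \<theta>" using f \<theta> unfolding Comp_def by blast
    have gp: "(g xs, g ys) \<in> \<theta>" if "g \<in> set gs" for g
      using gs[OF that] \<theta> xs ys eq unfolding Comp_def preserves_def by blast
    have "(f (map (\<lambda>g. g xs) gs), f (map (\<lambda>g. g ys) gs)) \<in> \<theta>"
      using fp map_apply_nlists[OF len go xs] map_apply_nlists[OF len go ys] gp len
      unfolding preserves_def by simp
    then show "((\<lambda>xs\<in>nlists m A. f (map (\<lambda>g. g xs) gs)) xs, (\<lambda>xs\<in>nlists m A. f (map (\<lambda>g. g xs) gs)) ys) \<in> \<theta>"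
      using xs ys by simp
  qed
  ultimately show "compose_op A m f gs \<in> Comp A F" unfolding Comp_def by blast
qed

text \<open>The polymorphisms of the relation \<open>R\<close>, whose tuples are indexed by the type
  \<open>'i\<close> and may be infinite.\<close>

definition invariant_ops :: "'a set \<Rightarrow> ('i \<Rightarrow> 'a) set \<Rightarrow> 'a operation set" where
  "invariant_ops A R = {(n, f). (n, f) \<in> operations A \<and>
     (\<forall>vs. length vs = n \<longrightarrow> set vs \<subseteq> R \<longrightarrow> (\<lambda>S. f (map (\<lambda>v. v S) vs)) \<in> R)}"

lemma invariant_opsD:
  "(n, f) \<in> invariant_ops A R \<Longrightarrow> length vs = n \<Longrightarrow> set vs \<subseteq> R
    \<Longrightarrow> (\<lambda>S. f (map (\<lambda>v. v S) vs)) \<in> R"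
  unfolding invariant_ops_def by simp

lemma clone_invariant_ops:
  assumes R: "\<And>v S. v \<in> R \<Longrightarrow> v S \<in> A"
  shows "clone A (invariant_ops A R)"
proof (rule cloneI)
  show "invariant_ops A R \<subseteq> operations A" unfolding invariant_ops_def by blast
next
  have mem: "map (\<lambda>v. v S) vs \<in> nlists n A" if "length vs = n" "set vs \<subseteq> R" for vs n S
    using that R by (intro nlistsI) auto
  {
    fix n i :: nat assume i: "i < n"
    have "(\<lambda>S. (\<lambda>xs\<in>nlists n A. xs ! i) (map (\<lambda>v. v S) vs)) \<in> R" if vs: "length vs = n" "set vs \<subseteq> R" for vs
    proof -
      have "(\<lambda>S. (\<lambda>xs\<in>nlists n A. xs ! i) (map (\<lambda>v. v S) vs)) = vs ! i"
        using mem[OF vs] i vs by (intro ext) simp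
      then show ?thesis using vs i nth_mem by auto
    qed
    then show "proj_op A n i \<in> invariant_ops A R"
      using clone_proj[OF clone_operations i, of A] unfolding invariant_ops_def proj_op_def by simp
  next
    fix n m f gs
    assume f: "(n, f) \<in> invariant_ops A R" and len: "length gs = n"
      and gs: "\<And>g. g \<in> set gs \<Longrightarrow> (m, g) \<in> invariant_ops A R"
    have "compose_op A m f gs \<in> operations A"
      by (rule clone_compose[OF clone_operations _ len]) (use f gs in \<open>auto simp: invariant_ops_def\<close>)
    moreover have "(\<lambda>S. (\<lambda>xs\<in>nlists m A. f (map (\<lambda>g. g xs) gs)) (map (\<lambda>v. v S) vs)) \<in> R"
      if vs: "length vs = m" "set vs \<subseteq> R" for vs
    proof -
      let ?ws = "map (\<lambda>g S. g (map (\<lambda>v. v S) vs)) gs"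
      have "set ?ws \<subseteq> R" using gs vs unfolding invariant_ops_def by auto
      then have "(\<lambda>S. f (map (\<lambda>w. w S) ?ws)) \<in> R" using len by (intro invariant_opsD[OF f]) simp_all
      then show ?thesis using mem[OF vs] by (simp add: comp_def)
    qed
    ultimately show "compose_op A m f gs \<in> invariant_ops A R"
      unfolding invariant_ops_def compose_op_def by simp
  }
qed

section \<open>Clones of operations preserving twisted cubes\<close>

context group
begin

lemma congruence_normal:
  assumes \<theta>: "congruence (carrier G) (group_operations G) \<theta>"
  obtains N where "N \<lhd> G"
    "\<And>x y. x \<in> carrier G \<Longrightarrow> y \<in> carrier G \<Longrightarrow> (x, y) \<in> \<theta> \<longleftrightarrow> x \<otimes> inv y \<in> N"
proof -
  have eqv: "equiv (carrier G) \<theta>" using \<theta> unfolding congruence_def by blast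
  have refl: "(x, x) \<in> \<theta>" if "x \<in> carrier G" for x
    using eqv that by (meson equivE refl_onD)
  have sym: "(y, x) \<in> \<theta>" if "(x, y) \<in> \<theta>" for x y using eqv that by (meson equivE symD)
  have carr: "x \<in> carrier G" "y \<in> carrier G" if "(x, y) \<in> \<theta>" for x y
    using equiv_type[OF eqv] that by auto
  have mult: "(a \<otimes> c, b \<otimes> d) \<in> \<theta>" if ab: "(a, b) \<in> \<theta>" and cd: "(c, d) \<in> \<theta>" for a b c d
  proof -
    have pres: "preserves (carrier G) (2, \<lambda>xs\<in>nlists 2 (carrier G). xs ! 0 \<otimes> xs ! 1) \<theta>"
      by (rule bspec[OF conjunct2[OF \<theta>[unfolded congruence_def]]]) (simp add: group_operations_def)
    have mem: "[a, c] \<in> nlists 2 (carrier G)" "[b, d] \<in> nlists 2 (carrier G)"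
      using carr[OF ab] carr[OF cd] by (auto intro!: nlistsI)
    have "\<forall>i<2. ([a, c] ! i, [b, d] ! i) \<in> \<theta>" using ab cd by (auto simp: less_2_cases_iff)
    then have "((\<lambda>xs\<in>nlists 2 (carrier G). xs ! 0 \<otimes> xs ! 1) [a, c],
        (\<lambda>xs\<in>nlists 2 (carrier G). xs ! 0 \<otimes> xs ! 1) [b, d]) \<in> \<theta>"
      by (rule mp[OF bspec[OF bspec[OF pres[unfolded preserves_def split] mem(1)] mem(2)]])
    then show ?thesis using mem by simp
  qed
  define N where "N = {x \<in> carrier G. (x, \<one>) \<in> \<theta>}"
  have "N \<lhd> G"
  proof (rule normal_invI)
    show "subgroup N G"
    proof
      show "N \<subseteq> carrier G" "\<one> \<in> N" unfolding N_def using refl by auto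
      fix x y assume x: "x \<in> N"
      then have xc: "x \<in> carrier G" "(x, \<one>) \<in> \<theta>" unfolding N_def by auto
      have "(inv x \<otimes> x, inv x \<otimes> \<one>) \<in> \<theta>" using mult[OF refl xc(2), of "inv x"] xc by simp
      then show "inv x \<in> N" unfolding N_def using xc sym by simp
      assume "y \<in> N"
      then show "x \<otimes> y \<in> N" using xc mult[OF xc(2), of y \<one>] unfolding N_def by simp
    qed
    fix g x assume g: "g \<in> carrier G" and "x \<in> N"
    then have xc: "x \<in> carrier G" "(x, \<one>) \<in> \<theta>" unfolding N_def by auto
    have "(g \<otimes> x \<otimes> inv g, g \<otimes> \<one> \<otimes> inv g) \<in> \<theta>" using g by (intro mult xc refl) simp_all
    then show "g \<otimes> x \<otimes> inv g \<in> N" unfolding N_def using g xc by simp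
  qed
  moreover have "(x, y) \<in> \<theta> \<longleftrightarrow> x \<otimes> inv y \<in> N" if x: "x \<in> carrier G" and y: "y \<in> carrier G" for x y
  proof
    assume "(x, y) \<in> \<theta>"
    then have "(x \<otimes> inv y, y \<otimes> inv y) \<in> \<theta>" using y by (intro mult refl) simp_all
    then show "x \<otimes> inv y \<in> N" unfolding N_def using x y by simp
  next
    assume "x \<otimes> inv y \<in> N"
    then have "(x \<otimes> inv y \<otimes> y, \<one> \<otimes> y) \<in> \<theta>" unfolding N_def using y by (intro mult refl) simp_all
    then show "(x, y) \<in> \<theta>" using x y by (simp add: m_assoc)
  qed
  ultimately show thesis by (rule that)
qed

text \<open>Cubes alone are too rigid for monomials, whose values on a cube are powers of
  \<open>u\<close> with exponents of higher degree. The twist leaves room exactly for exponents of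
  degree less than \<open>m\<close>.\<close>

definition twisted_cubes :: "nat \<Rightarrow> 'a \<Rightarrow> nat \<Rightarrow> (nat set \<Rightarrow> 'a) set" where
  "twisted_cubes p u m = {\<lambda>S. v S \<otimes> u [^] (F S :: int) | v F. v \<in> cubes \<and> cube_degree p m F}"

lemma twisted_cubesI:
  "v \<in> cubes \<Longrightarrow> cube_degree p m F \<Longrightarrow> (\<And>S. w S = v S \<otimes> u [^] F S) \<Longrightarrow> w \<in> twisted_cubes p u m"
  unfolding twisted_cubes_def by (rule CollectI) (metis ext)

lemma twisted_cubes_of_cubes:
  assumes "u \<in> carrier G" "v \<in> cubes"
  shows "v \<in> twisted_cubes p u m"
  by (rule twisted_cubesI[OF assms(2), of p m "\<lambda>_. 0"])
    (use assms cubes_closed in \<open>simp_all add: cube_degree_dvd\<close>)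

definition degree_clone :: "nat \<Rightarrow> 'a \<Rightarrow> nat \<Rightarrow> 'a operation set" where
  "degree_clone p u m = Comp (carrier G) (group_operations G)
     \<inter> invariant_ops (carrier G) (twisted_cubes p u m)"

text \<open>Centrality of \<open>u\<close> lets the twists be collected on the right: products add
  the exponents and inverses negate them, and both keep the degree bound.\<close>

lemma cp_clone_degree_clone:
  assumes u: "u \<in> carrier G" and central: "\<And>g. g \<in> carrier G \<Longrightarrow> u \<otimes> g = g \<otimes> u"
  shows "cp_clone G (degree_clone p u m)"
proof -
  let ?A = "carrier G" and ?X = "twisted_cubes p u m" and ?C = "degree_clone p u m"
  let ?mult = "(2, \<lambda>xs\<in>nlists 2 ?A. xs ! 0 \<otimes> xs ! 1)" and ?inv = "(1, \<lambda>xs\<in>nlists 1 ?A. inv (xs ! 0))"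
  have closed: "v S \<in> ?A" if "v \<in> ?X" for v S
    using that u cubes_closed unfolding twisted_cubes_def by auto
  have central_pow: "u [^] (i::int) \<otimes> x = x \<otimes> u [^] i" if "x \<in> ?A" for i x
    by (rule int_pow_commutes[OF u that central[OF that]])
  have "clone ?A (invariant_ops ?A ?X)" by (rule clone_invariant_ops) (rule closed)
  then have clone: "clone ?A ?C"
    using clone_Inter[of "{Comp ?A (group_operations G), invariant_ops ?A ?X}" ?A]
      clone_Comp unfolding degree_clone_def by auto
  have ops: "group_operations G \<subseteq> Comp ?A (group_operations G)"
    using group_operations_in_operations unfolding Comp_def congruence_def by blast
  have const_op: "const_op ?A n a \<in> ?C" if "1 \<le> n" "a \<in> ?A" for n a
  proof -
    have o: "const_op ?A n a \<in> operations ?A" by (rule const_op_in_operations[OF that])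
    have "preserves ?A (const_op ?A n a) \<theta>" if "congruence ?A (group_operations G) \<theta>" for \<theta>
    proof -
      have "(a, a) \<in> \<theta>" using that \<open>a \<in> ?A\<close> unfolding congruence_def by (meson equivE refl_onD)
      then show ?thesis unfolding preserves_def const_op_def by simp
    qed
    then have "const_op ?A n a \<in> Comp ?A (group_operations G)" using o unfolding Comp_def by blast
    moreover have "(\<lambda>S. (\<lambda>xs\<in>nlists n ?A. a) (map (\<lambda>v. v S) vs)) \<in> ?X" if vs: "length vs = n" "set vs \<subseteq> ?X" for vs
    proof -
      have "map (\<lambda>v. v S) vs \<in> nlists n ?A" for S using vs closed by (intro nlistsI) auto
      then show ?thesis using twisted_cubes_of_cubes[OF u cubes_const[OF \<open>a \<in> ?A\<close>]] by simp
    qed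
    then have "const_op ?A n a \<in> invariant_ops ?A ?X"
      using o unfolding invariant_ops_def const_op_def by simp
    ultimately show ?thesis unfolding degree_clone_def by blast
  qed
  have mult_inv: "?mult \<in> invariant_ops ?A ?X"
  proof -
    have "(\<lambda>S. (\<lambda>xs\<in>nlists 2 ?A. xs ! 0 \<otimes> xs ! 1) (map (\<lambda>v. v S) vs)) \<in> ?X" if vs: "length vs = 2" "set vs \<subseteq> ?X" for vs
    proof -
      obtain a b where ab: "vs = [a, b]" using vs(1) by (auto simp: numeral_2_eq_2 length_Suc_conv)
      obtain v F w H where v: "v \<in> cubes" "cube_degree p m F" "a = (\<lambda>S. v S \<otimes> u [^] F S)"
        and w: "w \<in> cubes" "cube_degree p m H" "b = (\<lambda>S. w S \<otimes> u [^] H S)"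
        using vs(2) unfolding ab twisted_cubes_def by auto
      have "map (\<lambda>v. v S) vs \<in> nlists 2 ?A" for S using vs closed by (intro nlistsI) auto
      moreover have "a S \<otimes> b S = (v S \<otimes> w S) \<otimes> u [^] (F S + H S)" for S
      proof -
        have c: "v S \<in> ?A" "w S \<in> ?A" using v w cubes_closed by auto
        have "a S \<otimes> b S = v S \<otimes> (u [^] F S \<otimes> w S) \<otimes> u [^] H S"
          using c u v w by (simp add: m_assoc)
        also have "u [^] F S \<otimes> w S = w S \<otimes> u [^] F S" by (rule central_pow[OF c(2)])
        finally show ?thesis using c u by (simp add: m_assoc int_pow_mult)
      qed
      ultimately show ?thesis
        using ab by (intro twisted_cubesI[OF cubes_mult[OF v(1) w(1)] cube_degree_add[OF v(2) w(2)]]) simp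
    qed
    moreover have "?mult \<in> operations ?A"
      using group_operations_in_operations unfolding group_operations_def by blast
    ultimately show ?thesis unfolding invariant_ops_def by simp
  qed
  have inv_inv: "?inv \<in> invariant_ops ?A ?X"
  proof -
    have "(\<lambda>S. (\<lambda>xs\<in>nlists 1 ?A. inv (xs ! 0)) (map (\<lambda>v. v S) vs)) \<in> ?X" if vs: "length vs = 1" "set vs \<subseteq> ?X" for vs
    proof -
      obtain a where a: "vs = [a]" using vs(1) by (auto simp: length_Suc_conv)
      obtain v F where v: "v \<in> cubes" "cube_degree p m F" "a = (\<lambda>S. v S \<otimes> u [^] F S)"
        using vs(2) unfolding a twisted_cubes_def by auto
      have "map (\<lambda>v. v S) vs \<in> nlists 1 ?A" for S using vs closed by (intro nlistsI) auto
      moreover have "inv (a S) = inv (v S) \<otimes> u [^] (- 1 * F S)" for S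
        using cubes_closed[OF v(1)] u v(3) central_pow[of "inv (v S)" "- F S"]
        by (simp add: inv_mult_group int_pow_neg)
      ultimately show ?thesis
        using a by (intro twisted_cubesI[OF cubes_inv[OF v(1)] cube_degree_scale[OF v(2), of "- 1"]]) simp
    qed
    moreover have "?inv \<in> operations ?A"
      using group_operations_in_operations unfolding group_operations_def by blast
    ultimately show ?thesis unfolding invariant_ops_def by simp
  qed
  have "group_operations G \<union> {const_op ?A n a | n a. 1 \<le> n \<and> a \<in> ?A} \<subseteq> ?C"
    using const_op[of 1 \<one>] const_op ops mult_inv inv_inv
    unfolding degree_clone_def group_operations_def by auto
  then have "Pol ?A (group_operations G) \<subseteq> ?C"
    unfolding Pol_def by (rule hull_minimal) (rule clone)
  then show ?thesis using clone cp_clone_iff unfolding degree_clone_def by blast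
qed

section \<open>Groups whose normal subgroup lattice splits strongly\<close>

definition monomial_op :: "'a \<Rightarrow> ('a \<Rightarrow> int) \<Rightarrow> nat \<Rightarrow> 'a operation" where
  "monomial_op u \<chi> k = (k, \<lambda>xs\<in>nlists k (carrier G). u [^] (\<Prod>i<k. \<chi> (xs ! i)))"

text \<open>A normal subgroup containing \<open>u\<close> contains all values. Any other lies in
  \<open>\<delta>\<close>, where \<open>\<chi>\<close> vanishes modulo \<open>p\<close>, so
  congruent arguments even give equal values.\<close>

lemma monomial_op_Comp:
  assumes u: "u \<in> carrier G" "u [^] (p::nat) = \<one>" and k: "1 \<le> k"
    and split: "\<And>\<alpha>. \<alpha> \<lhd> G \<Longrightarrow> \<alpha> \<subseteq> \<delta> \<or> u \<in> \<alpha>"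
    and hom: "\<And>x y. x \<in> carrier G \<Longrightarrow> y \<in> carrier G \<Longrightarrow> [\<chi> (x \<otimes> y) = \<chi> x + \<chi> y] (mod int p)"
    and kernel: "\<And>x. x \<in> \<delta> \<Longrightarrow> [\<chi> x = 0] (mod int p)"
  shows "monomial_op u \<chi> k \<in> Comp (carrier G) (group_operations G)"
proof -
  have "monomial_op u \<chi> k \<in> operations (carrier G)"
    unfolding monomial_op_def using u k by (intro operationsI) auto
  moreover have "preserves (carrier G) (monomial_op u \<chi> k) \<theta>"
    if \<theta>: "congruence (carrier G) (group_operations G) \<theta>" for \<theta>
    unfolding monomial_op_def preserves_def split_conv
  proof (intro ballI impI)
    fix xs ys assume xs: "xs \<in> nlists k (carrier G)" and ys: "ys \<in> nlists k (carrier G)"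
      and eq: "\<forall>i<k. (xs ! i, ys ! i) \<in> \<theta>"
    let ?m = "\<lambda>xs. u [^] (\<Prod>i<k. \<chi> (xs ! i))"
    obtain N where N: "N \<lhd> G"
      and N_iff: "\<And>x y. x \<in> carrier G \<Longrightarrow> y \<in> carrier G \<Longrightarrow> (x, y) \<in> \<theta> \<longleftrightarrow> x \<otimes> inv y \<in> N"
      using congruence_normal[OF \<theta>] by metis
    interpret N: normal N G by (rule N)
    have "?m xs \<otimes> inv (?m ys) \<in> N"
    proof (cases "u \<in> N")
      case True
      then show ?thesis using pow_coset_closed[OF N True] by simp
    next
      case False
      have "[\<chi> (xs ! i) = \<chi> (ys ! i)] (mod int p)" if i: "i < k" for i
      proof -
        have c: "xs ! i \<in> carrier G" "ys ! i \<in> carrier G"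
          using nlistsE_nth_in[OF xs i] nlistsE_nth_in[OF ys i] by auto
        have "xs ! i \<otimes> inv (ys ! i) \<in> \<delta>" using split[OF N] False N_iff[OF c] eq i by blast
        then have "[\<chi> (xs ! i \<otimes> inv (ys ! i)) + \<chi> (ys ! i) = 0 + \<chi> (ys ! i)] (mod int p)"
          by (intro cong_add kernel cong_refl)
        moreover have "[\<chi> (xs ! i) = \<chi> (xs ! i \<otimes> inv (ys ! i)) + \<chi> (ys ! i)] (mod int p)"
          using hom[of "xs ! i \<otimes> inv (ys ! i)" "ys ! i"] c by (simp add: m_assoc)
        ultimately show ?thesis using cong_trans by simp blast
      qed
      then have "[(\<Prod>i<k. \<chi> (xs ! i)) = (\<Prod>i<k. \<chi> (ys ! i))] (mod int p)"
        by (intro cong_prod) simp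
      then have "?m xs = ?m ys" by (rule int_pow_cong[OF u])
      then show ?thesis using u N.one_closed by simp
    qed
    then have "(?m xs, ?m ys) \<in> \<theta>" using N_iff u by simp
    then show "((\<lambda>xs\<in>nlists k (carrier G). ?m xs) xs, (\<lambda>xs\<in>nlists k (carrier G). ?m xs) ys) \<in> \<theta>"
      using xs ys by simp
  qed
  ultimately show ?thesis unfolding Comp_def by blast
qed

text \<open>As \<open>\<chi>\<close> vanishes on powers of \<open>u\<close>, it does not see the
  twists of the arguments. A product of \<open>k\<close> values of \<open>\<chi>\<close> on cubes
  has degree at most \<open>k\<close>, hence less than \<open>m\<close>.\<close>

lemma monomial_op_invariant:
  assumes u: "u \<in> carrier G" "u [^] (p::nat) = \<one>" and k: "1 \<le> k" "k < m"
    and hom: "\<And>x y. x \<in> carrier G \<Longrightarrow> y \<in> carrier G \<Longrightarrow> [\<chi> (x \<otimes> y) = \<chi> x + \<chi> y] (mod int p)"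
    and \<chi>u: "\<And>i::int. [\<chi> (u [^] i) = 0] (mod int p)"
  shows "monomial_op u \<chi> k \<in> invariant_ops (carrier G) (twisted_cubes p u m)"
proof -
  have "(\<lambda>S. (\<lambda>xs\<in>nlists k (carrier G). u [^] (\<Prod>i<k. \<chi> (xs ! i))) (map (\<lambda>v. v S) vs)) \<in> twisted_cubes p u m"
    if vs: "length vs = k" "set vs \<subseteq> twisted_cubes p u m" for vs
  proof -
    have "cube_degree p (Suc j) (\<lambda>S. \<Prod>i<j. \<chi> ((vs ! i) S))" if "j \<le> k" for j
      using that
    proof (induction j)
      case 0
      then show ?case by (simp add: cube_degree_const)
    next
      case (Suc j)
      have "vs ! j \<in> twisted_cubes p u m" using vs Suc.prems nth_mem[of j vs] by auto
      then obtain v F where v: "v \<in> cubes" "vs ! j = (\<lambda>S. v S \<otimes> u [^] (F S :: int))"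
        unfolding twisted_cubes_def by blast
      have "cube_degree p (Suc (Suc j)) (\<lambda>S. \<chi> (v S) * (\<Prod>i<j. \<chi> ((vs ! i) S)))"
        by (rule cube_degree_hom_mult[OF v(1) _ hom]) (use Suc in simp_all)
      then show ?case
      proof (rule cube_degree_cong)
        fix S
        have "[\<chi> (v S) + 0 = \<chi> ((vs ! j) S)] (mod int p)"
          using cong_trans[OF cong_add[OF cong_refl cong_sym[OF \<chi>u]] cong_sym[OF hom]]
            cubes_closed[OF v(1)] u v(2) by simp
        then show "[\<chi> (v S) * (\<Prod>i<j. \<chi> ((vs ! i) S)) = (\<Prod>i<Suc j. \<chi> ((vs ! i) S))] (mod int p)"
          using cong_scalar_right[of "\<chi> (v S)" _ _ "\<Prod>i<j. \<chi> ((vs ! i) S)"] by (simp add: mult.commute)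
      qed
    qed
    from this[of k] have deg: "cube_degree p m (\<lambda>S. \<Prod>i<k. \<chi> ((vs ! i) S))"
      by (rule cube_degree_mono) (use k in simp_all)
    have "map (\<lambda>v. v S) vs \<in> nlists k (carrier G)" for S
      using vs u cubes_closed unfolding twisted_cubes_def by (intro nlistsI) auto
    then show ?thesis using u vs(1) by (intro twisted_cubesI[OF cubes.one deg]) simp
  qed
  moreover have "monomial_op u \<chi> k \<in> operations (carrier G)"
    unfolding monomial_op_def using u k by (intro operationsI) auto
  ultimately show ?thesis unfolding invariant_ops_def monomial_op_def by simp
qed

text \<open>On the cube with edges \<open>z\<close> the alternating sum of the exponents of \<open>u\<close> distinguishes the
  monomial of degree \<open>m\<close> from all functions of smaller degree.\<close>

lemma monomial_op_not_invariant:
  assumes p: "Factorial_Ring.prime (p::nat)" and u: "u \<in> carrier G" "u [^] p = \<one>"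
    and z: "z \<in> carrier G" "[\<chi> z = 1] (mod int p)" "[\<chi> \<one> = 0] (mod int p)"
    and \<phi>: "fun_degree G p M \<phi>" "\<And>i::int. [\<phi> (u [^] i) = i] (mod int p)"
    and m: "M \<le> m" "1 \<le> m"
  shows "monomial_op u \<chi> m \<notin> invariant_ops (carrier G) (twisted_cubes p u m)"
proof
  assume inv: "monomial_op u \<chi> m \<in> invariant_ops (carrier G) (twisted_cubes p u m)"
  let ?vs = "map (\<lambda>i S. if i \<in> S then z else \<one>) [0..<m]"
  let ?P = "\<lambda>S. \<Prod>i<m. \<chi> (if i \<in> S then z else \<one>)"
  have "set ?vs \<subseteq> twisted_cubes p u m"
    using twisted_cubes_of_cubes[OF u(1) cubes_var[OF z(1)]] by auto
  then have "(\<lambda>S. (\<lambda>xs\<in>nlists m (carrier G). u [^] (\<Prod>i<m. \<chi> (xs ! i))) (map (\<lambda>v. v S) ?vs)) \<in> twisted_cubes p u m"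
    by (intro invariant_opsD[OF inv[unfolded monomial_op_def]]) simp_all
  moreover have "(\<lambda>xs\<in>nlists m (carrier G). u [^] (\<Prod>i<m. \<chi> (xs ! i))) (map (\<lambda>v. v S) ?vs) = u [^] ?P S" for S
  proof -
    have "map (\<lambda>v. v S) ?vs \<in> nlists m (carrier G)" using z by (intro nlistsI) auto
    then show ?thesis by simp
  qed
  ultimately have "(\<lambda>S. u [^] ?P S) \<in> twisted_cubes p u m" by simp
  then obtain w F where w: "w \<in> cubes" and F: "cube_degree p m F"
    and eq: "(\<lambda>S. u [^] ?P S) = (\<lambda>S. w S \<otimes> u [^] (F S :: int))"
    unfolding twisted_cubes_def by blast
  \<comment> \<open>The cube \<open>w\<close> must itself consist of powers of \<open>u\<close>, so
    \<open>\<phi>\<close> recovers the exponent \<open>?P S - F S\<close>. Both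
    \<open>\<phi>\<close> on \<open>w\<close> and \<open>F\<close> have degree less than
    \<open>m\<close>, which would bound \<open>?P\<close> likewise.\<close>
  have wu: "w S = u [^] (?P S - F S)" for S
  proof -
    have "u [^] ?P S = w S \<otimes> u [^] F S" using eq by meson
    then have "u [^] ?P S \<otimes> inv (u [^] F S) = w S"
      using cubes_closed[OF w] u by (simp add: m_assoc)
    then show ?thesis by (simp add: int_pow_diff u)
  qed
  have "cube_degree p m (\<lambda>S. \<phi> (w S) + F S)"
    by (intro cube_degree_add F cube_degree_mono[OF cube_degree_fun_degree[OF w \<phi>(1)]] m)
  moreover have "[\<phi> (w S) + F S = ?P S] (mod int p)" for S
    using cong_add[OF \<phi>(2)[of "?P S - F S"] cong_refl[of "F S"]] wu[of S] by simp
  ultimately have "cube_degree p m ?P" by (rule cube_degree_cong)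
  then have dvd: "int p dvd (\<Sum>S\<in>Pow {..<m}. (- 1) ^ card S * ?P S)"
    using cube_degreeD[of p m ?P "{..<m}" "{}"] by simp
  have "[?P S = (if S = {..<m} then 1 else 0)] (mod int p)" if S: "S \<in> Pow {..<m}" for S
  proof (cases "S = {..<m}")
    case True
    have "[?P S = (\<Prod>i<m. 1)] (mod int p)" using True z by (intro cong_prod) simp
    then show ?thesis using True by simp
  next
    case False
    then obtain i where i: "i < m" "i \<notin> S" using S by blast
    then have "int p dvd \<chi> (if i \<in> S then z else \<one>)" using z(3) by (simp add: cong_0_iff)
    also have "\<dots> dvd ?P S" using i by (intro dvd_prodI) auto
    finally show ?thesis using False by (simp add: cong_0_iff)
  qed
  then have "[(\<Sum>S\<in>Pow {..<m}. (- 1) ^ card S * ?P S)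
      = (\<Sum>S\<in>Pow {..<m}. (- 1) ^ card S * (if S = {..<m} then 1 else 0))] (mod int p)"
    by (intro cong_sum cong_scalar_left)
  also have "(\<Sum>S\<in>Pow {..<m}. (- 1) ^ card S * (if S = {..<m} then 1 else 0)) = (- 1 :: int) ^ m"
    by (simp add: if_distrib[of "\<lambda>x. _ * x"] cong: if_cong)
  finally have "int p dvd (- 1) ^ m" using dvd cong_dvd_iff by blast
  then have "int p dvd 1" by (metis dvd_trans minus_one_power_iff dvd_minus_iff dvd_refl)
  then show False using prime_gt_1_nat[OF p] by simp
qed

lemma mem_subgroup_of_coprime_powers:
  assumes "subgroup N G" "c \<in> carrier G" "c [^] (a::int) \<in> N" "c [^] (b::int) \<in> N" "coprime a b"
  shows "c \<in> N"
proof -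
  obtain x y where xy: "a * x + b * y = 1" using assms(5) by (metis bezout_int coprime_iff_gcd_eq_1 mult.commute)
  have "c = c [^] (a * x + b * y)" using xy assms(2) by simp
  also have "\<dots> = (c [^] a) [^] x \<otimes> (c [^] b) [^] y" using assms(2) by (simp add: int_pow_mult int_pow_pow)
  also have "\<dots> \<in> N" using assms subgroup_int_pow_closed subgroup.m_closed by metis
  finally show ?thesis .
qed

text \<open>Otherwise the quotient has torsion of a prime order \<open>r\<close> different from
  \<open>p\<close>, and a central such \<open>z\<close> can be adjoined. By maximality
  \<open>u\<close> is then a power of \<open>z\<close> modulo \<open>N\<close>, so
  \<open>u [^] r\<close> lies in \<open>N\<close>; with \<open>u [^] p = \<one>\<close> this puts
  \<open>u\<close> into \<open>N\<close>.\<close>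

lemma maximal_normal_avoiding_imp_prime_power:
  assumes fin: "finite (carrier G)" and nil: "nilpotent G" and N: "N \<lhd> G"
    and p: "Factorial_Ring.prime (p::nat)" and u: "u \<in> carrier G" "u [^] p = \<one>" "u \<notin> N"
    and max: "\<And>K. K \<lhd> G \<Longrightarrow> N \<subset> K \<Longrightarrow> u \<in> K" and a: "a \<in> carrier G"
  shows "\<exists>k. a [^] (p ^ k) \<in> N"
proof -
  interpret N: normal N G by (rule N)
  interpret h: group_hom G "G Mod N" "(#>) N" by (rule N.group_hom_Mod)
  have pow_N: "(N #> x) [^]\<^bsub>G Mod N\<^esub> (n::nat) = \<one>\<^bsub>G Mod N\<^esub> \<longleftrightarrow> x [^] n \<in> N" if "x \<in> carrier G" for x n
    using N.rcos_eq_self_iff[of "x [^] n"] h.hom_nat_pow[OF that, of n] that by simp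
  have "0 < ord a" using ord_ge_1[OF fin a] by simp
  then obtain k m where km: "\<not> p dvd m" "ord a = m * p ^ k"
    using prime_power_canonical[OF p] by blast
  \<comment> \<open>This power removes the \<open>p\<close>-part of the order: \<open>?b\<close> has
    order dividing \<open>m\<close>, which is prime to \<open>p\<close>.\<close>
  let ?b = "a [^] (p ^ k)"
  have bc: "?b \<in> carrier G" using a by simp
  have bm: "?b [^] m = \<one>" using pow_ord_eq_1[OF a] a km by (simp add: nat_pow_pow mult.commute)
  have "?b \<in> N"
  proof (rule ccontr)
    assume b: "?b \<notin> N"
    have finQ: "finite (carrier (G Mod N))" using fin by (simp add: carrier_FactGroup)
    have neQ: "N #> ?b \<noteq> \<one>\<^bsub>G Mod N\<^esub>" using b N.rcos_eq_self_iff[OF bc] by simp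
    obtain r j where r: "Factorial_Ring.prime (r::nat)"
      and rj: "(N #> ?b) [^]\<^bsub>G Mod N\<^esub> (j::nat) \<noteq> \<one>\<^bsub>G Mod N\<^esub>"
        "((N #> ?b) [^]\<^bsub>G Mod N\<^esub> j) [^]\<^bsub>G Mod N\<^esub> r = \<one>\<^bsub>G Mod N\<^esub>"
      by (rule group.exists_prime_torsion[OF N.factorgroup_is_group finQ h.hom_closed[OF bc] neQ])
    let ?c = "?b [^] j"
    have cc: "?c \<in> carrier G" using bc by simp
    have c: "?c \<notin> N" using rj(1) pow_N[OF bc] by simp
    have cr: "?c [^] r \<in> N" using rj(2) pow_N[OF cc] h.hom_nat_pow[OF bc, of j] by simp
    have cm: "?c [^] m \<in> N"
      using bm bc N.one_closed by (metis nat_pow_one nat_pow_pow mult.commute)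
    have "coprime r p"
    proof (rule ccontr)
      assume "\<not> coprime r p"
      then have "r = p" using primes_coprime p r by blast
      then have "coprime (int r) (int m)"
        using km(1) prime_imp_coprime[OF p] by (simp add: coprime_int_iff)
      then show False
        using mem_subgroup_of_coprime_powers[OF N.subgroup_axioms cc, of "int r" "int m"] cr cm c
        by (simp add: int_pow_int)
    qed
    obtain z where z: "z \<in> carrier G" "z \<notin> N" "z [^] r \<in> N"
      and central: "\<And>g. g \<in> carrier G \<Longrightarrow> z \<otimes> g \<otimes> inv z \<otimes> inv g \<in> N"
      using N.nilpotent_torsion_Mod[OF nil cc c cr] by metis
    have "N \<subset> N.adjoin z" using N.adjoin_superset[OF z(1)] N.adjoin_self[OF z(1)] z(2) by blast
    moreover have "N.adjoin z \<lhd> G" by (rule N.adjoin_normal[OF z(1) central])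
    ultimately have "u \<in> N.adjoin z" using max by blast
    then obtain i :: int where "u \<otimes> inv (z [^] i) \<in> N" unfolding N.adjoin_def by blast
    then have "N #> u = N #> z [^] i" using N.rcos_eq_iff u z by simp
    then have "N #> (u [^] r) = N #> ((z [^] i) [^] r)"
      using h.hom_nat_pow[OF u(1)] h.hom_nat_pow[of "z [^] i"] z(1) by simp
    also have "(z [^] i) [^] r = (z [^] r) [^] i"
      using int_pow_pow[OF z(1), of i "int r"] int_pow_pow[OF z(1), of "int r" i]
      by (simp add: int_pow_int mult.commute)
    also have "N #> \<dots> = N"
      using N.rcos_eq_self_iff[of "(z [^] r) [^] i"] pow_coset_closed[OF N z(3)] z(1) by simp
    finally have "u [^] r \<in> N" using N.rcos_eq_self_iff[of "u [^] r"] u by simp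
    then show False
      using mem_subgroup_of_coprime_powers[OF N.subgroup_axioms u(1), of "int r" "int p"]
        u(2,3) N.one_closed \<open>coprime r p\<close> by (simp add: int_pow_int)
  qed
  then show ?thesis by blast
qed

lemma infinitely_many_expansions:
  assumes fin: "finite (carrier G)" and nil: "nilpotent G"
    and split: "normal_split \<mu> \<delta>\<^sub>0" and sub: "\<mu> \<subseteq> \<delta>\<^sub>0"
  shows "infinite {C. cp_clone G C}"
proof -
  have \<mu>: "\<mu> \<lhd> G" "\<mu> \<noteq> {\<one>}" and \<delta>\<^sub>0: "\<delta>\<^sub>0 \<lhd> G" "\<delta>\<^sub>0 \<noteq> carrier G"
    and all: "\<And>\<alpha>. \<alpha> \<lhd> G \<Longrightarrow> \<alpha> \<subseteq> \<delta>\<^sub>0 \<or> \<mu> \<subseteq> \<alpha>"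
    using split unfolding normal_split_def by blast+
  interpret \<mu>: normal \<mu> G by (rule \<mu>)
  obtain m where m: "m \<in> \<mu>" "m \<noteq> \<one>" using \<mu>(2) \<mu>.one_closed by blast
  obtain p k where p: "Factorial_Ring.prime (p::nat)" and k: "m [^] (k::nat) \<noteq> \<one>" "(m [^] k) [^] p = \<one>"
    by (rule exists_prime_torsion[OF fin \<mu>.mem_carrier[OF m(1)] m(2)])
  have "m [^] k \<in> \<mu>" using pow_coset_closed[OF \<mu>(1) m(1), of "int k"] by (simp add: int_pow_int)
  then obtain u where u\<mu>: "u \<in> \<mu>" and u1: "u \<noteq> \<one>" "u [^] p = \<one>"
    and central: "\<And>g. g \<in> carrier G \<Longrightarrow> u \<otimes> g = g \<otimes> u"
    using nilpotent_central_torsion[OF nil \<mu>(1) _ k] by metis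
  have u: "u \<in> carrier G" "u [^] p = \<one>" using u\<mu> u1 \<mu>.mem_carrier by auto
  have fin_sets: "finite {N. N \<lhd> G \<and> P N}" for P
  proof (rule finite_subset)
    show "{N. N \<lhd> G \<and> P N} \<subseteq> Pow (carrier G)" using normal_imp_subgroup subgroup.subset by blast
  qed (use fin in simp)
  \<comment> \<open>Enlarging \<open>\<delta>\<^sub>0\<close> preserves the dichotomy, and
    maximality makes the quotient by \<open>\<delta>\<close> cyclic of order
    \<open>p\<close>.\<close>
  obtain \<delta> where \<delta>: "\<delta> \<lhd> G" "\<delta> \<noteq> carrier G" "\<delta>\<^sub>0 \<subseteq> \<delta>"
    and \<delta>_max: "\<And>K. K \<lhd> G \<Longrightarrow> \<delta> \<subset> K \<Longrightarrow> K = carrier G"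
    using finite_has_maximal[OF fin_sets[of "\<lambda>N. N \<noteq> carrier G \<and> \<delta>\<^sub>0 \<subseteq> N"]] \<delta>\<^sub>0 by fastforce
  have dichotomy: "\<alpha> \<subseteq> \<delta> \<or> u \<in> \<alpha>" if "\<alpha> \<lhd> G" for \<alpha> using all[OF that] \<delta>(3) u\<mu> by blast
  have u\<delta>: "u \<in> \<delta>" using u\<mu> sub \<delta>(3) by blast
  have "{\<one>} \<lhd> G \<and> u \<notin> {\<one>}" using one_is_normal u1 by simp
  \<comment> \<open>In the quotient by \<open>N\<close> every element has \<open>p\<close>-power
    order while \<open>u\<close> survives, so differences modulo \<open>p\<close> can measure
    exponents of \<open>u\<close>.\<close>
  then obtain N where N: "N \<lhd> G" "u \<notin> N" and N_max: "\<And>K. K \<lhd> G \<Longrightarrow> N \<subset> K \<Longrightarrow> u \<in> K"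
    using finite_has_maximal[OF fin_sets[of "\<lambda>N. u \<notin> N"]] by fastforce
  have N\<delta>: "N \<subseteq> \<delta>" using dichotomy[OF N(1)] N(2) by blast
  have p_power: "\<exists>k. a [^] (p ^ k) \<in> N" if "a \<in> carrier G" for a
    using maximal_normal_avoiding_imp_prime_power[OF fin nil N(1) p u N(2) N_max that] .
  interpret N: normal N G by (rule N)
  interpret \<delta>: normal \<delta> G by (rule \<delta>)
  have "\<exists>k. a [^] (p ^ k) \<in> \<delta>" if "a \<in> carrier G" for a
    using p_power[OF that] subsetD[OF N\<delta>] by metis
  then obtain z where z: "z \<in> carrier G" "z \<notin> \<delta>" "z [^] p \<in> \<delta>"
    and z_central: "\<And>g. g \<in> carrier G \<Longrightarrow> z \<otimes> g \<otimes> inv z \<otimes> inv g \<in> \<delta>"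
    using \<delta>.nilpotent_prime_power_Mod[OF nil \<delta>(2), of p] by metis
  have "\<delta> \<subset> \<delta>.adjoin z" using \<delta>.adjoin_superset[OF z(1)] \<delta>.adjoin_self[OF z(1)] z(2) by blast
  moreover have "\<delta>.adjoin z \<lhd> G" by (rule \<delta>.adjoin_normal[OF z(1) z_central])
  ultimately have whole: "\<delta>.adjoin z = carrier G" using \<delta>_max by blast
  let ?Q = "G Mod \<delta>"
  interpret h: group_hom G ?Q "(#>) \<delta>" by (rule \<delta>.group_hom_Mod)
  let ?q = "\<delta> #> z"
  have q: "?q \<in> carrier ?Q" "?q \<noteq> \<one>\<^bsub>?Q\<^esub>" "?q [^]\<^bsub>?Q\<^esub> p = \<one>\<^bsub>?Q\<^esub>"
    using h.hom_closed[OF z(1)] \<delta>.rcos_eq_self_iff[OF z(1)] z h.hom_nat_pow[OF z(1), of p]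
      \<delta>.rcos_eq_self_iff[of "z [^] p"] by simp_all
  note q_eq = group.int_pow_eq_prime[OF \<delta>.factorgroup_is_group q p]
  \<comment> \<open>The discrete logarithm modulo \<open>\<delta>\<close> to base \<open>z\<close>,
    hence a homomorphism to the integers modulo \<open>p\<close>.\<close>
  define \<chi> where "\<chi> x = (SOME i::int. \<delta> #> x = ?q [^]\<^bsub>?Q\<^esub> i)" for x
  have \<chi>: "\<delta> #> x = ?q [^]\<^bsub>?Q\<^esub> \<chi> x" if x: "x \<in> carrier G" for x
  proof -
    have "x \<in> \<delta>.adjoin z" using x whole by simp
    then obtain i :: int where "x \<otimes> inv (z [^] i) \<in> \<delta>" unfolding \<delta>.adjoin_def by blast
    then have "\<delta> #> x = ?q [^]\<^bsub>?Q\<^esub> i"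
      using \<delta>.rcos_eq_iff[OF x, of "z [^] i"] z(1) h.hom_int_pow[OF z(1), of i] by simp
    then show ?thesis unfolding \<chi>_def by (rule someI)
  qed
  have \<chi>_hom: "[\<chi> (x \<otimes> y) = \<chi> x + \<chi> y] (mod int p)" if "x \<in> carrier G" "y \<in> carrier G" for x y
  proof -
    have "?q [^]\<^bsub>?Q\<^esub> \<chi> (x \<otimes> y) = (\<delta> #> x) \<otimes>\<^bsub>?Q\<^esub> (\<delta> #> y)"
      using \<chi>[of "x \<otimes> y"] that by (simp only: m_closed h.hom_mult)
    also have "\<dots> = ?q [^]\<^bsub>?Q\<^esub> (\<chi> x + \<chi> y)" using \<chi> that h.H.int_pow_mult[OF q(1)] by simp
    finally show ?thesis using q_eq by blast
  qed
  have \<chi>_kernel: "[\<chi> x = 0] (mod int p)" if x: "x \<in> \<delta>" for x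
  proof -
    have "?q [^]\<^bsub>?Q\<^esub> \<chi> x = ?q [^]\<^bsub>?Q\<^esub> (0::int)"
      using \<chi>[OF \<delta>.mem_carrier[OF x]] \<delta>.rcos_eq_self_iff[OF \<delta>.mem_carrier[OF x]] x by simp
    then show ?thesis using q_eq by blast
  qed
  have \<chi>_z: "[\<chi> z = 1] (mod int p)"
  proof -
    have "?q [^]\<^bsub>?Q\<^esub> \<chi> z = ?q [^]\<^bsub>?Q\<^esub> (1::int)" using \<chi>[OF z(1)] h.H.int_pow_1[OF q(1)] by simp
    then show ?thesis using q_eq by blast
  qed
  \<comment> \<open>Reads off the exponent of \<open>u\<close> modulo \<open>N\<close>. The defining
    predicate depends only on the coset of \<open>x\<close>, so even where no exponent exists the
    default chosen by \<open>SOME\<close> is constant on the coset, and \<open>\<phi>\<close> is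
    invariant under \<open>N\<close>.\<close>
  define \<phi> where "\<phi> x = (SOME i::int. x \<otimes> inv (u [^] i) \<in> N)" for x
  have "left_invariant p N \<phi>"
    unfolding left_invariant_def
  proof (intro ballI)
    fix n x assume n: "n \<in> N" and x: "x \<in> carrier G"
    have "n \<otimes> x \<otimes> inv (u [^] i) \<in> N \<longleftrightarrow> x \<otimes> inv (u [^] i) \<in> N" for i :: int
    proof -
      have nc: "n \<in> carrier G" using n N.mem_carrier by blast
      have "n \<otimes> x \<otimes> inv (u [^] i) = n \<otimes> (x \<otimes> inv (u [^] i))" using nc x u by (simp add: m_assoc)
      moreover have "inv n \<otimes> (n \<otimes> (x \<otimes> inv (u [^] i))) = x \<otimes> inv (u [^] i)"
        using nc x u by (intro inv_mult_cancel) simp_all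
      ultimately show ?thesis using n by (metis N.m_closed N.m_inv_closed)
    qed
    then show "[\<phi> (n \<otimes> x) = \<phi> x] (mod int p)" unfolding \<phi>_def by simp
  qed
  then obtain M where M: "fun_degree G p M \<phi>" using fun_degree_bounded[OF fin nil p N(1) p_power] by blast
  have \<phi>_u: "[\<phi> (u [^] i) = i] (mod int p)" for i :: int
  proof (rule ccontr)
    assume neq: "\<not> [\<phi> (u [^] i) = i] (mod int p)"
    let ?d = "i - \<phi> (u [^] i)"
    have "u [^] i \<otimes> inv (u [^] i) \<in> N" using u N.one_closed by simp
    then have "u [^] i \<otimes> inv (u [^] \<phi> (u [^] i)) \<in> N" unfolding \<phi>_def by (rule someI)
    then have "u [^] ?d \<in> N" by (simp add: int_pow_diff u)
    moreover have "u [^] int p \<in> N" using u N.one_closed by (simp add: int_pow_int)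
    moreover have "\<not> int p dvd ?d" using neq by (simp add: cong_iff_dvd_diff dvd_diff_commute)
    then have "coprime ?d (int p)"
      using p by (metis coprime_commute prime_imp_coprime prime_nat_int_transfer)
    ultimately show False using mem_subgroup_of_coprime_powers[OF N.subgroup_axioms u(1)] N(2) by blast
  qed
  let ?C = "degree_clone p u"
  have "monomial_op u \<chi> k \<in> ?C m" if "1 \<le> k" "k < m" for k m
    unfolding degree_clone_def
    using monomial_op_Comp[OF u that(1) dichotomy \<chi>_hom \<chi>_kernel]
      monomial_op_invariant[OF u that \<chi>_hom \<chi>_kernel[OF pow_coset_closed[OF \<delta>(1) u\<delta>]]] by blast
  moreover have "monomial_op u \<chi> m \<notin> ?C m" if "max M 1 \<le> m" for m
    unfolding degree_clone_def
    using monomial_op_not_invariant[OF p u z(1) \<chi>_z \<chi>_kernel[OF \<delta>.one_closed] M \<phi>_u, of m] that by simp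
  \<comment> \<open>The monomial of arity \<open>m\<close> lies in \<open>?C m'\<close> but not in
    \<open>?C m\<close>. The threshold \<open>max M 1\<close> ensures both the degree bound for
    \<open>\<phi>\<close> and a positive arity.\<close>
  ultimately have "?C m \<noteq> ?C m'" if "max M 1 \<le> m" "m < m'" for m m' using that by fastforce
  then have "inj_on ?C {max M 1..}" by (intro linorder_inj_onI) auto
  then have "infinite (?C ` {max M 1..})" using finite_imageD infinite_Ici by blast
  moreover have "?C ` {max M 1..} \<subseteq> {C. cp_clone G C}" using cp_clone_degree_clone[OF u(1) central] by blast
  ultimately show ?thesis using finite_subset by blast
qed

end

theorem corollary2:
  fixes G :: "('a, 'b) monoid_scheme"
  assumes "group G" and "finite (carrier G)" and "nilpotent G"
  shows "infinitely_many_cp_expansions (carrier G) (group_operations G)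
           \<longleftrightarrow> splits_strongly (normal_subgroup_lattice G)"
proof -
  interpret group G by fact
  have "infinitely_many_cp_expansions (carrier G) (group_operations G) \<longleftrightarrow> infinite {C. cp_clone G C}"
    unfolding infinitely_many_cp_expansions_def cp_clone_iff ..
  then show ?thesis
    unfolding splits_strongly_normal_subgroup_lattice_iff
    using finitely_many_expansions[OF assms(2,3)] infinitely_many_expansions[OF assms(2,3)] by blast
qed

end
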